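(* Let $X\subset\mathbb{R}^d$ be a finite point cloud in general position, and let $k\geq 0$. Then the $k$-th Rips and Delaunay--Rips persistence modules $\big(H_k(\mathcal{R}_r(X))\big)_{r\geq0}$ and $\big(H_k(\mathcal{DR}_r(X))\big)_{r\geq0}$ are multiplicatively strongly $c_{k+1}$-interleaved, where $c_{m}=\sqrt{2m/(m+1)}$. Consequently, $$W_\infty\big(\log \mathrm{Dgm}^k_{\mathcal{DR}}(X),\ \log \mathrm{Dgm}^k_{\mathcal{R}}(X)\big)\leq \log c_{k+1}.$$
   Context: General position: no $d+1$ points of $X$ lie on a common affine hyperplane and no $d+2$ points lie on a common $(d-1)$-sphere, so that the Delaunay complex $\mathsf{DEL}(X)$ (an abstract simplicial complex on vertex set $X$) is well defined. For a finite set $\sigma$, $\delta(\sigma)=\max_{x,y\in\sigma}\|x-y\|_2$ is its diameter. The Rips filtration is $\mathcal{R}_r(X)=\{\sigma\subseteq X,\ \sigma\neq\varnothing : \delta(\sigma)\le 2r\}$ and the Delaunay--Rips filtration is $\mathcal{DR}_r(X)=\{\sigma\in\mathsf{DEL}(X): \delta(\sigma)\le 2r\}$, for $r\ge0$. Homology is taken with coefficients in a field; the persistence module of a filtration consists of the groups $H_k(\mathcal{F}_r)$ with the maps induced by inclusions. Two persistence modules $(V_r)_{r\ge0},(W_r)_{r\ge0}$ are multiplicatively strongly $\eta$-interleaved ($\eta\ge1$) if there are linear maps $\Phi_r:V_r\to W_{\eta r}$ and $\Psi_r:W_r\to V_{\eta r}$ for all $r\ge0$ such that $\Psi_{\eta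 r}\circ\Phi_r$ and $\Phi_{\eta r}\circ\Psi_r$ equal the structure maps $V_r\to V_{\eta^2 r}$, $W_r\to W_{\eta^2 r}$, and $\Phi,\Psi$ commute with the structure maps ($\Phi_{r'}\circ(V_r\to V_{r'}) = (W_{\eta r}\to W_{\eta r'})\circ\Phi_r$ for $r\le r'$, and similarly for $\Psi$). $\mathrm{Dgm}^k_{\mathcal{F}}(X)$ is the $k$-dimensional persistence diagram (multiset of birth–death pairs $(b,d)$, possibly $d=\infty$) of the filtration; $\log D=\{(\log b,\log d):(b,d)\in D\}$ with $\log 0=-\infty$, $\log\infty=\infty$ (coordinates equal to $\pm\infty$ being matched with zero cost to equal infinite coordinates). $W_\infty$ is the bottleneck distance: the infimum over bijections between the diagrams augmented by diagonal points of the maximal $\ell^\infty$ cost, where pairs of diagonal points cost $0$. *)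

theory Defs
  imports "HOL-Analysis.Analysis"
begin

definition general_position :: "'a::euclidean_space set \<Rightarrow> bool" where
  "general_position X \<longleftrightarrow>
     (\<forall>S\<subseteq>X. card S = DIM('a) + 1 \<longrightarrow>
        \<not> (\<exists>a b. a \<noteq> 0 \<and> (\<forall>x\<in>S. a \<bullet> x = b))) \<and>
     (\<forall>S\<subseteq>X. card S = DIM('a) + 2 \<longrightarrow>
        \<not> (\<exists>c \<rho>. \<forall>x\<in>S. dist c x = \<rho>))"

definition rips :: "'a::euclidean_space set \<Rightarrow> real \<Rightarrow> 'a set set" where
  "rips X r = {\<sigma>. \<sigma> \<subseteq> X \<and> \<sigma> \<noteq> {} \<and> diameter \<sigma> \<le> 2 * r}"

definition voronoi :: "'a::euclidean_space set \<Rightarrow> 'a \<Rightarrow> 'a set" where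
  "voronoi X x = {c. \<forall>y\<in>X. dist c x \<le> dist c y}"

definition delaunay :: "'a::euclidean_space set \<Rightarrow> 'a set set" where
  "delaunay X = {\<sigma>. \<sigma> \<subseteq> X \<and> \<sigma> \<noteq> {} \<and> (\<Inter>x\<in>\<sigma>. voronoi X x) \<noteq> {}}"

definition delrips :: "'a::euclidean_space set \<Rightarrow> real \<Rightarrow> 'a set set" where
  "delrips X r = {\<sigma> \<in> delaunay X. diameter \<sigma> \<le> 2 * r}"

definition chains :: "'a set set \<Rightarrow> nat \<Rightarrow> ('a list \<Rightarrow> 'k::field) set" where
  "chains K n = {c. finite {xs. c xs \<noteq> 0} \<and>
      (\<forall>xs. c xs \<noteq> 0 \<longrightarrow> length xs = Suc n \<and> set xs \<in> K)}"

definition bd :: "('a list \<Rightarrow> 'k::field) \<Rightarrow> 'a list \<Rightarrow> 'k" where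
  "bd c = (\<lambda>ys. \<Sum>xs\<in>{xs. c xs \<noteq> 0}. \<Sum>i<length xs.
      (if 2 \<le> length xs \<and> take i xs @ drop (Suc i) xs = ys then (-1) ^ i * c xs else 0))"

definition cycles :: "'a set set \<Rightarrow> nat \<Rightarrow> ('a list \<Rightarrow> 'k::field) set" where
  "cycles K n = {c \<in> chains K n. bd c = (\<lambda>_. 0)}"

definition bnds :: "'a set set \<Rightarrow> nat \<Rightarrow> ('a list \<Rightarrow> 'k::field) set" where
  "bnds K n = bd ` chains K (Suc n)"

definition hcos :: "'a set set \<Rightarrow> nat \<Rightarrow> ('a list \<Rightarrow> 'k::field) \<Rightarrow> ('a list \<Rightarrow> 'k) set" where
  "hcos K n z = {(\<lambda>ys. z ys + b ys) | b. b \<in> bnds K n}"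

definition hom :: "'a set set \<Rightarrow> nat \<Rightarrow> ('a list \<Rightarrow> 'k::field) set set" where
  "hom K n = hcos K n ` cycles K n"

definition hadd :: "('a list \<Rightarrow> 'k::field) set \<Rightarrow> ('a list \<Rightarrow> 'k) set \<Rightarrow> ('a list \<Rightarrow> 'k) set" where
  "hadd A B = {(\<lambda>ys. a ys + b ys) | a b. a \<in> A \<and> b \<in> B}"

definition hsmul :: "'a set set \<Rightarrow> nat \<Rightarrow> 'k::field \<Rightarrow> ('a list \<Rightarrow> 'k) set \<Rightarrow> ('a list \<Rightarrow> 'k) set" where
  "hsmul K n c A = {(\<lambda>ys. c * a ys + b ys) | a b. a \<in> A \<and> b \<in> bnds K n}"

text \<open>Map H_n(K) \<rightarrow> H_n(L) induced by an inclusion K \<subseteq> L.\<close>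
definition hincl :: "'a set set \<Rightarrow> nat \<Rightarrow> ('a list \<Rightarrow> 'k::field) set \<Rightarrow> ('a list \<Rightarrow> 'k) set" where
  "hincl L n A = {(\<lambda>ys. a ys + b ys) | a b. a \<in> A \<and> b \<in> bnds L n}"

definition hlinear :: "'a set set \<Rightarrow> 'a set set \<Rightarrow> nat
    \<Rightarrow> (('a list \<Rightarrow> 'k::field) set \<Rightarrow> ('a list \<Rightarrow> 'k) set) \<Rightarrow> bool" where
  "hlinear K L n f \<longleftrightarrow>
     (\<forall>A\<in>hom K n. f A \<in> hom L n) \<and>
     (\<forall>A\<in>hom K n. \<forall>B\<in>hom K n. f (hadd A B) = hadd (f A) (f B)) \<and>
     (\<forall>c. \<forall>A\<in>hom K n. f (hsmul K n c A) = hsmul L n c (f A))"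

definition mult_strong_interleaved ::
  "'k::field itself \<Rightarrow> (real \<Rightarrow> 'a set set) \<Rightarrow> (real \<Rightarrow> 'a set set) \<Rightarrow> nat \<Rightarrow> real \<Rightarrow> bool" where
  "mult_strong_interleaved ty F G n \<eta> \<longleftrightarrow> \<eta> \<ge> 1 \<and>
    (\<exists>(\<Phi> :: real \<Rightarrow> ('a list \<Rightarrow> 'k) set \<Rightarrow> ('a list \<Rightarrow> 'k) set)
      (\<Psi> :: real \<Rightarrow> ('a list \<Rightarrow> 'k) set \<Rightarrow> ('a list \<Rightarrow> 'k) set).
      (\<forall>r\<ge>0. hlinear (F r) (G (\<eta> * r)) n (\<Phi> r)) \<and>
      (\<forall>r\<ge>0. hlinear (G r) (F (\<eta> * r)) n (\<Psi> r)) \<and>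
      (\<forall>r\<ge>0. \<forall>A\<in>hom (F r) n. \<Psi> (\<eta> * r) (\<Phi> r A) = hincl (F (\<eta> * \<eta> * r)) n A) \<and>
      (\<forall>r\<ge>0. \<forall>A\<in>hom (G r) n. \<Phi> (\<eta> * r) (\<Psi> r A) = hincl (G (\<eta> * \<eta> * r)) n A) \<and>
      (\<forall>r r'. 0 \<le> r \<and> r \<le> r' \<longrightarrow>
         (\<forall>A\<in>hom (F r) n. \<Phi> r' (hincl (F r') n A) = hincl (G (\<eta> * r')) n (\<Phi> r A))) \<and>
      (\<forall>r r'. 0 \<le> r \<and> r \<le> r' \<longrightarrow>
         (\<forall>A\<in>hom (G r) n. \<Psi> r' (hincl (G r') n A) = hincl (F (\<eta> * r')) n (\<Psi> r A))))"

text \<open>Linear span and dimension in the quotient space of cosets of Bd.\<close>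
definition qspan :: "('a list \<Rightarrow> 'k::field) set \<Rightarrow> ('a list \<Rightarrow> 'k) set set \<Rightarrow> ('a list \<Rightarrow> 'k) set set" where
  "qspan Bd F = {{(\<lambda>ys. (\<Sum>A\<in>F. u A * g A ys) + b ys) | b. b \<in> Bd} | u g. \<forall>A\<in>F. g A \<in> A}"

definition qdim :: "('a list \<Rightarrow> 'k::field) set \<Rightarrow> ('a list \<Rightarrow> 'k) set set \<Rightarrow> nat" where
  "qdim Bd S = (LEAST m. \<exists>F. finite F \<and> F \<subseteq> S \<and> card F = m \<and> S \<subseteq> qspan Bd F)"

definition rk :: "'k::field itself \<Rightarrow> (real \<Rightarrow> 'a set set) \<Rightarrow> nat \<Rightarrow> real \<Rightarrow> real \<Rightarrow> nat" where
  "rk ty F n s t = qdim (bnds (F t) n :: ('a list \<Rightarrow> 'k) set) (hincl (F t) n ` hom (F s) n)"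

definition evval :: "'b filter \<Rightarrow> ('b \<Rightarrow> 'c) \<Rightarrow> 'c" where
  "evval Fl f = (THE m. eventually (\<lambda>x. f x = m) Fl)"

text \<open>Multiplicity of the interval [b,d) (d possibly infinite).\<close>
definition pmult :: "'k::field itself \<Rightarrow> (real \<Rightarrow> 'a set set) \<Rightarrow> nat \<Rightarrow> real \<Rightarrow> ereal \<Rightarrow> int" where
  "pmult ty F n b d =
    (if d = \<infinity> then
       evval (at_right (0::real)) (\<lambda>e. evval at_top (\<lambda>T::real.
          int (rk ty F n b T) - int (rk ty F n (b - e) T)))
     else if d = -\<infinity> then 0
     else evval (at_right (0::real)) (\<lambda>e. let d' = real_of_ereal d in
          int (rk ty F n b (d' - e)) - int (rk ty F n (b - e) (d' - e))
          - int (rk ty F n b d') + int (rk ty F n (b - e) d')))"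

definition dgm :: "'k::field itself \<Rightarrow> (real \<Rightarrow> 'a set set) \<Rightarrow> nat \<Rightarrow> ereal \<times> ereal \<Rightarrow> nat" where
  "dgm ty F n p =
    (if \<exists>b. fst p = ereal b \<and> ereal b < snd p
     then nat (pmult ty F n (real_of_ereal (fst p)) (snd p)) else 0)"

definition eexp :: "ereal \<Rightarrow> ereal" where
  "eexp x = (if x = -\<infinity> then 0 else if x = \<infinity> then \<infinity> else ereal (exp (real_of_ereal x)))"

text \<open>log D: the point (b,d) of D becomes (log b, log d), log 0 = -\<infinity>, log \<infinity> = \<infinity>.\<close>
definition logdgm :: "(ereal \<times> ereal \<Rightarrow> nat) \<Rightarrow> ereal \<times> ereal \<Rightarrow> nat" where
  "logdgm D p = D (eexp (fst p), eexp (snd p))"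

definition cdist :: "ereal \<Rightarrow> ereal \<Rightarrow> ereal" where
  "cdist a b = (if a = b then 0
     else if \<bar>a\<bar> = \<infinity> \<or> \<bar>b\<bar> = \<infinity> then \<infinity>
     else ereal \<bar>real_of_ereal a - real_of_ereal b\<bar>)"

definition is_diag :: "ereal \<times> ereal \<Rightarrow> bool" where
  "is_diag p \<longleftrightarrow> (\<exists>x::real. p = (ereal x, ereal x))"

definition pcost :: "ereal \<times> ereal \<Rightarrow> ereal \<times> ereal \<Rightarrow> ereal" where
  "pcost p q = (if is_diag p \<and> is_diag q then 0
     else max (cdist (fst p) (fst q)) (cdist (snd p) (snd q)))"

text \<open>Diagram augmented by the diagonal (each diagonal point with infinite multiplicity);
  copies of points are labelled by a natural number.\<close>
definition augment :: "(ereal \<times> ereal \<Rightarrow> nat) \<Rightarrow> ((ereal \<times> ereal) \<times> nat) set" where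
  "augment D = {(p, i). i < D p} \<union> {((ereal x, ereal x), i) | x i. True}"

definition bottleneck :: "(ereal \<times> ereal \<Rightarrow> nat) \<Rightarrow> (ereal \<times> ereal \<Rightarrow> nat) \<Rightarrow> ereal" where
  "bottleneck D1 D2 = (INF f\<in>{f. bij_betw f (augment D1) (augment D2)}.
      SUP a\<in>augment D1. pcost (fst a) (fst (f a)))"

definition cconst :: "nat \<Rightarrow> real" where
  "cconst m = sqrt (2 * real m / (real m + 1))"

end

theory Submission
  imports Defs "HOL-Library.Function_Algebras" "HOL-Library.Equipollence"
begin

text \<open>Write \<open>c = c\<^bsub>k+1\<^esub>\<close> and let \<open>C\<^sub>s\<close> be the Cech complex. By Jung's theorem the \<open>(k+1)\<close>-skeleton of
  the Rips complex at scale \<open>r\<close> lies in \<open>C\<^bsub>c r\<^esub>\<close>, and conversely \<open>C\<^sub>s\<close> lies in the Rips complex at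
  scale \<open>s\<close>. Following Bauer and Edelsbrunner, \<open>C\<^sub>s\<close> collapses onto \<open>C\<^sub>s \<inter> DEL(X)\<close>: a simplex \<open>Q\<close>
  that is not Delaunay is matched with \<open>Q \<triangle> {x}\<close>, where \<open>x\<close> is the first point that no sphere
  enclosing \<open>Q\<close> excludes together with its predecessors and the points outside the open smallest
  enclosing ball of \<open>Q\<close>. Hence Rips cycles can be pushed into the Delaunay-Rips complex at scale \<open>c r\<close>,
  and the inclusion of the Delaunay-Rips into the Rips module has kernel and cokernel killed by
  scaling with \<open>c\<close>.

  For the diagrams, factor this inclusion through its image. Counting bars by ranks, the image has
  the births of the Delaunay-Rips module and the deaths of the Rips module; pairing the bars of equal
  birth (death) by order statistics, as in the induced matchings of Bauer and Lesnick, and composing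
  gives a matching whose coordinates differ by factors in \<open>[1, c]\<close>.\<close>

section \<open>Ordered chains\<close>

text \<open>In general the Rips complex has homology that its Delaunay part lacks, so it cannot be
  collapsed itself; the Cech complex mediates. The index \<open>k + 1\<close> of the constant arises
  because \<open>k\<close>-cycles and their fillings involve only simplices with at most
  \<open>k + 2\<close> vertices. Chains are supported on lists with repetitions allowed, so coning
  is plain prefixing, and one cone formula yields both the boundary calculus and the collapses.

  For the diagrams no interval decomposition is constructed. If \<open>Z s\<close> are the cycles
  and \<open>B t\<close> the boundaries, \<open>dim (Z s) - dim (Z s \<inter> B t)\<close> counts
  the bars born by \<open>s\<close> and alive at \<open>t\<close>. All three modules have this form:
  Delaunay-Rips cycles modulo Delaunay-Rips boundaries, Delaunay-Rips cycles modulo Rips boundaries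
  (the image), Rips cycles modulo Rips boundaries. The first two share their cycles, hence births;
  the last two share their boundaries, hence deaths. Each comparison becomes an inequality between
  dimensions of intersections. The factor in the matching is \<open>c\<close> and not its square
  because kernel and cokernel of the inclusion are each killed by a single scaling and act on
  different coordinates.\<close>

definition supp :: "('b \<Rightarrow> 'k::zero) \<Rightarrow> 'b set" where
  "supp c = {x. c x \<noteq> 0}"

lemma not_in_supp: "x \<notin> supp c \<longleftrightarrow> c x = 0"
  by (simp add: supp_def)

lemma supp_add: "supp (c + d) \<subseteq> supp c \<union> supp (d :: 'b \<Rightarrow> 'k::field)"
  by (auto simp: supp_def)

lemma supp_diff: "supp (c - d) \<subseteq> supp c \<union> supp (d :: 'b \<Rightarrow> 'k::field)"
  by (auto simp: supp_def)

definition face_coeff :: "'a list \<Rightarrow> 'a list \<Rightarrow> 'k::field" where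
  "face_coeff xs ys = (\<Sum>i<length xs. if take i xs @ drop (Suc i) xs = ys then (-1) ^ i else 0)"

text \<open>Unlike \<^const>\<open>bd\<close>, the augmented boundary maps a one-element list to the empty list.\<close>
definition abd :: "('a list \<Rightarrow> 'k::field) \<Rightarrow> 'a list \<Rightarrow> 'k" where
  "abd c = (\<lambda>ys. \<Sum>xs\<in>supp c. c xs * face_coeff xs ys)"

text \<open>Prefixing also applies to lists that already contain \<open>v\<close>, so the cone
  exists on every chain.\<close>

definition cone_chain :: "'a \<Rightarrow> ('a list \<Rightarrow> 'k::field) \<Rightarrow> 'a list \<Rightarrow> 'k" where
  "cone_chain v c = (\<lambda>ys. case ys of [] \<Rightarrow> 0 | w # ws \<Rightarrow> if w = v then c ws else 0)"

definition single :: "'b \<Rightarrow> 'b \<Rightarrow> 'k::field" where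
  "single x = (\<lambda>y. if x = y then 1 else 0)"

lemma abd_superset:
  assumes "finite S" "supp c \<subseteq> S"
  shows "abd c ys = (\<Sum>xs\<in>S. c xs * face_coeff xs ys)"
  unfolding abd_def using assms by (intro sum.mono_neutral_left) (auto simp: supp_def)

lemma abd_add:
  assumes "finite (supp c)" "finite (supp d)"
  shows "abd (c + d) = abd c + abd d"
proof
  fix ys
  let ?S = "supp c \<union> supp d"
  show "abd (c + d) ys = (abd c + abd d) ys"
    using assms abd_superset[of ?S c ys] abd_superset[of ?S d ys]
      abd_superset[of ?S "c + d" ys] supp_add[of c d]
    by (simp add: sum.distrib distrib_right)
qed

lemma abd_diff:
  assumes "finite (supp c)" "finite (supp d)"
  shows "abd (c - d) = abd c - abd d"
proof
  fix ys
  let ?S = "supp c \<union> supp d"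
  show "abd (c - d) ys = (abd c - abd d) ys"
    using assms abd_superset[of ?S c ys] abd_superset[of ?S d ys]
      abd_superset[of ?S "c - d" ys] supp_diff[of c d]
    by (simp add: sum_subtractf left_diff_distrib)
qed

lemma abd_scale:
  assumes "finite (supp c)"
  shows "abd (\<lambda>x. a * c x) = (\<lambda>ys. a * abd c ys)"
proof
  fix ys
  have "supp (\<lambda>x. a * c x) \<subseteq> supp c" by (auto simp: supp_def)
  then show "abd (\<lambda>x. a * c x) ys = a * abd c ys"
    using assms abd_superset[of "supp c" c ys] abd_superset[of "supp c" "\<lambda>x. a * c x" ys]
    by (simp add: sum_distrib_left mult.assoc)
qed

lemma abd_single: "abd (single xs) = face_coeff xs"
proof
  fix ys show "abd (single xs) ys = face_coeff xs ys"
    by (subst abd_superset[of "{xs}"]) (auto simp: supp_def single_def)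
qed

lemma face_coeff_Nil: "face_coeff [] = 0"
  by (auto simp: face_coeff_def)

text \<open>Deleting the head leaves \<open>us\<close>; deleting a later entry deletes one of
  \<open>us\<close> under the head, with the opposite sign.\<close>

lemma face_coeff_Cons: "face_coeff (v # us) = single us - cone_chain v (face_coeff us :: 'a list \<Rightarrow> 'k::field)"
proof
  fix ys :: "'a list"
  have "face_coeff (v # us) ys = (if us = ys then 1 else 0) +
     (\<Sum>i<length us. if v # (take i us @ drop (Suc i) us) = ys then (-1) ^ Suc i else (0::'k))"
    unfolding face_coeff_def
    by (simp only: length_Cons sum.lessThan_Suc_shift take_Suc_Cons drop_Suc_Cons append_Cons) simp
  also have "(\<Sum>i<length us. if v # (take i us @ drop (Suc i) us) = ys then (-1) ^ Suc i else (0::'k)) =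
     - cone_chain v (face_coeff us) ys"
    by (cases ys) (auto simp: cone_chain_def face_coeff_def sum_negf[symmetric] intro!: sum.cong)
  finally show "face_coeff (v # us) ys = (single us - cone_chain v (face_coeff us :: 'a list \<Rightarrow> 'k)) ys"
    unfolding single_def by (simp only: minus_apply) simp
qed

lemma face_coeff_nonzeroD:
  assumes "face_coeff xs ys \<noteq> (0::'b::field)"
  shows "length xs = Suc (length ys)" "set ys \<subseteq> set xs"
proof -
  obtain i where i: "i \<in> {..<length xs}" "(if take i xs @ drop (Suc i) xs = ys then (-1) ^ i else (0::'b)) \<noteq> 0"
    using assms unfolding face_coeff_def by (rule sum.not_neutral_contains_not_neutral)
  then have i: "i < length xs" "take i xs @ drop (Suc i) xs = ys" by (blast, presburger)
  then show "length xs = Suc (length ys)" by auto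
  show "set ys \<subseteq> set xs"
    using i set_take_subset set_drop_subset by fastforce
qed

lemma finite_supp_face_coeff: "finite (supp (face_coeff xs :: _ \<Rightarrow> 'b::field))"
proof (rule finite_subset)
  show "supp (face_coeff xs :: _ \<Rightarrow> 'b) \<subseteq> (\<lambda>i. take i xs @ drop (Suc i) xs) ` {..<length xs}"
  proof
    fix ys assume "ys \<in> supp (face_coeff xs :: _ \<Rightarrow> 'b)"
    then have "(\<Sum>i<length xs. if take i xs @ drop (Suc i) xs = ys then (-1) ^ i else (0::'b)) \<noteq> 0"
      by (simp add: face_coeff_def supp_def)
    then obtain i where "i \<in> {..<length xs}" "(if take i xs @ drop (Suc i) xs = ys then (-1) ^ i else (0::'b)) \<noteq> 0"
      by (rule sum.not_neutral_contains_not_neutral)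
    then have "ys = take i xs @ drop (Suc i) xs" "i \<in> {..<length xs}" by presburger+
    then show "ys \<in> (\<lambda>i. take i xs @ drop (Suc i) xs) ` {..<length xs}"
      by (rule image_eqI)
  qed
qed simp

lemma supp_cone: "supp (cone_chain v c) = (#) v ` supp c"
proof (intro equalityI subsetI)
  fix ys assume "ys \<in> supp (cone_chain v c)"
  then show "ys \<in> (#) v ` supp c"
    by (cases ys) (auto simp: supp_def cone_chain_def split: if_splits)
qed (auto simp: supp_def cone_chain_def)

lemma cone_0: "cone_chain v 0 = 0"
  by (auto simp: cone_chain_def fun_eq_iff split: list.splits)

text \<open>The cone homotopy. It holds down to one-element lists because
  \<open>abd (single [w])\<close> is \<open>single []\<close>, whose cone is
  \<open>single [v]\<close>; the unaugmented boundary would lose this term.\<close>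

lemma abd_cone:
  assumes "finite (supp c)"
  shows "abd (cone_chain v c) = c - cone_chain v (abd c)"
proof
  fix ys
  have "abd (cone_chain v c) ys = (\<Sum>us\<in>supp c. c us * face_coeff (v # us) ys)"
    unfolding abd_def supp_cone by (subst sum.reindex) (auto simp: cone_chain_def)
  also have "\<dots> = (\<Sum>us\<in>supp c. c us * single us ys) - (\<Sum>us\<in>supp c. c us * cone_chain v (face_coeff us) ys)"
    by (simp add: face_coeff_Cons right_diff_distrib sum_subtractf)
  also have "(\<Sum>us\<in>supp c. c us * single us ys) = c ys"
    using assms by (simp add: single_def if_distrib[of "(*) _"] sum.delta' not_in_supp cong: if_cong)
  also have "(\<Sum>us\<in>supp c. c us * cone_chain v (face_coeff us) ys) = cone_chain v (abd c) ys"
    by (auto simp: cone_chain_def abd_def split: list.splits)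
  finally show "abd (cone_chain v c) ys = (c - cone_chain v (abd c)) ys" by simp
qed

lemma finite_supp_single: "finite (supp (single x))"
  by (auto simp: supp_def single_def)

lemma finite_supp_cone: "finite (supp c) \<Longrightarrow> finite (supp (cone_chain v c))"
  by (simp add: supp_cone)

text \<open>Induction by the cone formula: the two boundaries of \<open>us\<close> cancel, and what
  remains is the cone over the iterated boundary of \<open>us\<close>.\<close>

lemma abd_face_coeff: "abd (face_coeff xs) = (0 :: 'a list \<Rightarrow> 'k::field)"
proof (induction xs)
  case Nil
  then show ?case by (auto simp: face_coeff_Nil abd_def supp_def)
next
  case (Cons v us)
  have "abd (face_coeff (v # us)) = abd (single us) - abd (cone_chain v (face_coeff us :: 'a list \<Rightarrow> 'k))"
    unfolding face_coeff_Cons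
    by (rule abd_diff) (auto intro: finite_supp_single finite_supp_cone finite_supp_face_coeff)
  also have "\<dots> = cone_chain v (abd (face_coeff us))"
    unfolding abd_cone[OF finite_supp_face_coeff] abd_single by simp
  finally show ?case unfolding Cons.IH cone_0 .
qed

lemma abd_nonzeroD:
  fixes c :: "'a list \<Rightarrow> 'k::field"
  assumes "abd c ys \<noteq> 0"
  obtains xs where "c xs \<noteq> 0" "length xs = Suc (length ys)" "set ys \<subseteq> set xs"
proof -
  obtain xs where "c xs * face_coeff xs ys \<noteq> 0"
    using assms unfolding abd_def by (rule sum.not_neutral_contains_not_neutral)
  then have "c xs \<noteq> 0" "(face_coeff xs ys :: 'k) \<noteq> 0" by auto
  then show thesis using face_coeff_nonzeroD[of xs ys, where 'b='k] that by blast
qed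

lemma supp_abd:
  fixes c :: "'a list \<Rightarrow> 'k::field"
  shows "supp (abd c) \<subseteq> (\<Union>xs\<in>supp c. supp (face_coeff xs :: _ \<Rightarrow> 'k))"
proof
  fix ys assume "ys \<in> supp (abd c)"
  then have "abd c ys \<noteq> 0" by (simp add: supp_def)
  then obtain xs where "c xs * face_coeff xs ys \<noteq> 0"
    unfolding abd_def by (rule sum.not_neutral_contains_not_neutral)
  then show "ys \<in> (\<Union>xs\<in>supp c. supp (face_coeff xs :: _ \<Rightarrow> 'k))" by (auto simp: supp_def)
qed

lemma abd_nonzero_length:
  assumes "abd c ys \<noteq> 0" "\<And>xs. c xs \<noteq> 0 \<Longrightarrow> length xs = n"
  shows "n = Suc (length ys)"
  using assms by (metis abd_nonzeroD)

lemma finite_supp_abd: "finite (supp c) \<Longrightarrow> finite (supp (abd c))"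
  by (rule finite_subset[OF supp_abd]) (auto simp: finite_supp_face_coeff)

lemma abd_abd:
  fixes c :: "'a list \<Rightarrow> 'k::field"
  assumes "finite (supp c)"
  shows "abd (abd c) = 0"
proof
  fix zs
  let ?Y = "\<Union>xs\<in>supp c. supp (face_coeff xs :: 'a list \<Rightarrow> 'k)"
  have fin: "finite ?Y" using assms by (auto simp: finite_supp_face_coeff)
  have "abd (abd c) zs = (\<Sum>ys\<in>?Y. abd c ys * face_coeff ys zs)"
    using abd_superset[OF fin supp_abd] .
  also have "\<dots> = (\<Sum>ys\<in>?Y. \<Sum>xs\<in>supp c. c xs * (face_coeff xs ys * face_coeff ys zs))"
    by (simp add: abd_def sum_distrib_right mult.assoc)
  also have "\<dots> = (\<Sum>xs\<in>supp c. c xs * (\<Sum>ys\<in>?Y. face_coeff xs ys * face_coeff ys zs))"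
    by (subst sum.swap) (simp add: sum_distrib_left)
  also have "\<dots> = (\<Sum>xs\<in>supp c. c xs * abd (face_coeff xs) zs)"
    by (intro sum.cong refl arg_cong2[of _ _ _ _ "(*)"] abd_superset[OF fin, symmetric]) auto
  finally show "abd (abd c) zs = 0 zs" by (simp add: abd_face_coeff)
qed

text \<open>The guard \<open>2 \<le> length xs\<close> in \<open>bd\<close> suppresses exactly the
  empty face.\<close>

lemma bd_conv_abd:
  fixes c :: "'a list \<Rightarrow> 'b::field"
  shows "bd c ys = (if ys = [] then 0 else abd c ys)"
proof -
  have *: "(\<Sum>i<length xs. (if 2 \<le> length xs \<and> take i xs @ drop (Suc i) xs = ys then (-1) ^ i * c xs else 0))
    = (if ys = [] then 0 else c xs * face_coeff xs ys)" for xs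
  proof (cases "2 \<le> length xs")
    case ge2: True
    show ?thesis
    proof (cases "ys = []")
      case True
      have "(\<Sum>i<length xs. (if 2 \<le> length xs \<and> take i xs @ drop (Suc i) xs = ys then (-1) ^ i * c xs else 0)) = 0"
      proof (rule sum.neutral, rule ballI, rule if_not_P)
        fix i assume i: "i \<in> {..<length xs}"
        then have "length (take i xs @ drop (Suc i) xs) = length xs - 1" by simp
        then have "0 < length (take i xs @ drop (Suc i) xs)" using ge2 by linarith
        then show "\<not> (2 \<le> length xs \<and> take i xs @ drop (Suc i) xs = ys)"
          unfolding True length_greater_0_conv by blast
      qed
      then show ?thesis using True by (simp only: if_True simp_thms)
    next
      case False
      have "(if 2 \<le> length xs \<and> take i xs @ drop (Suc i) xs = ys then (-1) ^ i * c xs else 0)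
        = c xs * (if take i xs @ drop (Suc i) xs = ys then (-1) ^ i else 0)" for i
        using ge2 by (cases "take i xs @ drop (Suc i) xs = ys") (simp_all only: simp_thms if_True if_False mult.commute[of _ "c xs"] mult_zero_right)
      then show ?thesis
        using False by (simp only: face_coeff_def sum_distrib_left if_False)
    qed
  next
    case False
    then have "face_coeff xs ys = (0::'b)" if "ys \<noteq> []"
      using face_coeff_nonzeroD(1)[of xs ys] that by (cases ys) auto
    moreover have "(\<Sum>i<length xs. (if 2 \<le> length xs \<and> take i xs @ drop (Suc i) xs = ys then (-1) ^ i * c xs else 0)) = 0"
      using False by (simp only: simp_thms if_False sum.neutral_const)
    ultimately show ?thesis by simp
  qed
  show ?thesis unfolding bd_def * by (simp add: abd_def supp_def)
qed

section \<open>Chain groups of simplicial complexes\<close>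

lemma chains_iff: "c \<in> chains K n \<longleftrightarrow> finite (supp c) \<and> (\<forall>xs. c xs \<noteq> 0 \<longrightarrow> length xs = Suc n \<and> set xs \<in> K)"
  by (auto simp: chains_def supp_def)

lemma chains_finite: "c \<in> chains K n \<Longrightarrow> finite (supp c)"
  by (simp add: chains_iff)

lemma bd_eq_abd:
  assumes "c \<in> chains K (Suc n)"
  shows "bd c = abd c"
proof
  fix ys
  have "abd c [] = 0"
    using abd_nonzero_length[of c "[]" "Suc (Suc n)"] assms unfolding chains_iff by fastforce
  then show "bd c ys = abd c ys" by (simp add: bd_conv_abd)
qed

lemma bd_add: "finite (supp c) \<Longrightarrow> finite (supp d) \<Longrightarrow> bd (c + d) = bd c + bd d"
  by (rule ext) (simp add: bd_conv_abd abd_add)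

lemma bd_diff: "finite (supp c) \<Longrightarrow> finite (supp d) \<Longrightarrow> bd (c - d) = bd c - bd d"
  by (rule ext) (simp add: bd_conv_abd abd_diff)

lemma bd_scale: "finite (supp c) \<Longrightarrow> bd (\<lambda>x. a * c x) = (\<lambda>ys. a * bd c ys)"
  by (rule ext) (simp add: bd_conv_abd abd_scale)

lemma bd_0: "bd 0 = 0"
  by (rule ext) (simp add: bd_conv_abd abd_def supp_def)

lemma chains_add: "c \<in> chains K n \<Longrightarrow> d \<in> chains K n \<Longrightarrow> c + d \<in> chains K n"
  unfolding chains_iff using finite_subset[OF supp_add[of c d]] by (metis add_0 finite_Un plus_fun_apply)

lemma chains_diff: "c \<in> chains K n \<Longrightarrow> d \<in> chains K n \<Longrightarrow> c - d \<in> chains K n"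
  unfolding chains_iff using finite_subset[OF supp_diff[of c d]] by (metis diff_self finite_Un minus_apply)

lemma chains_scale: "c \<in> chains K n \<Longrightarrow> (\<lambda>x. a * c x) \<in> chains K n"
  by (auto simp: chains_iff intro: finite_subset[of _ "supp c"] simp: supp_def)

lemma chains_0: "0 \<in> chains K n"
  by (auto simp: chains_iff supp_def)

lemma chains_mono: "K \<subseteq> L \<Longrightarrow> chains K n \<subseteq> chains L n"
  by (auto simp: chains_def)

definition simp_complex :: "'a set set \<Rightarrow> bool" where
  "simp_complex K \<longleftrightarrow> {} \<notin> K \<and> (\<forall>\<sigma>\<in>K. \<forall>\<tau>. \<tau> \<subseteq> \<sigma> \<and> \<tau> \<noteq> {} \<longrightarrow> \<tau> \<in> K)"

lemma abd_in_chains: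
  assumes "simp_complex K" "c \<in> chains K (Suc n)"
  shows "abd c \<in> chains K n"
  unfolding chains_iff
proof (intro conjI allI impI)
  show "finite (supp (abd c))" using assms by (simp add: chains_iff finite_supp_abd)
  fix ys assume "abd c ys \<noteq> 0"
  then obtain xs where xs: "c xs \<noteq> 0" "length xs = Suc (length ys)" "set ys \<subseteq> set xs" by (rule abd_nonzeroD)
  with assms have *: "length xs = Suc (Suc n)" "set xs \<in> K" by (auto simp: chains_iff)
  from * xs(2) show l: "length ys = Suc n" by simp
  then have "set ys \<noteq> {}" by auto
  then show "set ys \<in> K"
    using * xs assms(1) by (auto simp: simp_complex_def)
qed

lemma bd_in_chains:
  assumes "simp_complex K" "c \<in> chains K (Suc n)"
  shows "bd c \<in> chains K n"
  using abd_in_chains[OF assms] bd_eq_abd[OF assms(2)] by simp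

lemma bd_bd:
  assumes "simp_complex K" "c \<in> chains K (Suc n)"
  shows "bd (bd c) = 0"
proof (rule ext)
  fix ys
  have "bd (bd c) ys = (if ys = [] then 0 else abd (abd c) ys)"
    by (subst bd_eq_abd[OF assms(2)]) (rule bd_conv_abd)
  also have "\<dots> = 0 ys"
    by (simp add: abd_abd[OF chains_finite[OF assms(2)]])
  finally show "bd (bd c) ys = 0 ys" .
qed

subsection \<open>Deformation and collapses\<close>

text \<open>Vanishing of all relative homology groups of the pair \<open>(K, L)\<close>, in the form in which it
  composes and yields the isomorphism on absolute homology directly.\<close>
definition deforms :: "'k::field itself \<Rightarrow> 'a set set \<Rightarrow> 'a set set \<Rightarrow> bool" where
  "deforms ty K L \<longleftrightarrow> (\<forall>m. \<forall>w \<in> (chains K m :: ('a list \<Rightarrow> 'k) set). (m = 0 \<or> bd w \<in> chains L (m - 1)) \<longrightarrow>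
     (\<exists>u \<in> chains K (Suc m). w - bd u \<in> chains L m))"

lemma deforms_refl:
  fixes ty :: "'k::field itself"
  shows "deforms ty K K"
  unfolding deforms_def
proof (intro allI ballI impI)
  fix m and w :: "'a list \<Rightarrow> 'k" assume "w \<in> chains K m"
  then have "w - bd 0 \<in> chains K m" by (simp only: bd_0 diff_0_right)
  then show "\<exists>u\<in>chains K (Suc m). w - bd u \<in> chains K m" using chains_0 by (rule rev_bexI[rotated])
qed

text \<open>Subtracting \<open>bd u\<close> does not change the boundary of \<open>w\<close>, so the
  remainder is a relative cycle of \<open>(K', L)\<close> and can be deformed further; the two
  fillings add up.\<close>

lemma deforms_trans:
  fixes ty :: "'k::field itself"
  assumes K: "simp_complex K" and "L \<subseteq> K'" "K' \<subseteq> K" and 1: "deforms ty K K'" and 2: "deforms ty K' L"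
  shows "deforms ty K L"
  unfolding deforms_def
proof (intro allI ballI impI)
  fix m and w :: "'a list \<Rightarrow> 'k" assume w: "w \<in> chains K m" "m = 0 \<or> bd w \<in> chains L (m - 1)"
  then have "m = 0 \<or> bd w \<in> chains K' (m - 1)" using chains_mono[OF \<open>L \<subseteq> K'\<close>] by blast
  with 1 w(1) obtain u where u: "u \<in> chains K (Suc m)" "w - bd u \<in> chains K' m"
    unfolding deforms_def by blast
  have "bd (w - bd u) = bd w"
    using bd_in_chains[OF K u(1)] w(1) u(1) by (simp add: bd_diff chains_finite bd_bd[OF K u(1)])
  with 2 w u obtain v where v: "v \<in> chains K' (Suc m)" "w - bd u - bd v \<in> chains L m"
    unfolding deforms_def by metis
  then have v': "v \<in> chains K (Suc m)" using chains_mono[OF \<open>K' \<subseteq> K\<close>] by blast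
  have "w - bd (u + v) \<in> chains L m"
    using v u v' by (simp add: bd_add chains_finite diff_diff_eq)
  then show "\<exists>u\<in>chains K (Suc m). w - bd u \<in> chains L m"
    using chains_add[OF u(1) v'] by blast
qed

text \<open>\<open>P\<close> is a free face: its only possible proper coface is
  \<open>insert x P\<close>. Hence no remaining simplex has a removed one as a face.\<close>

lemma simp_complex_collapse:
  assumes K: "simp_complex K" and free: "\<And>R. R \<in> K \<Longrightarrow> P \<subseteq> R \<Longrightarrow> R = P \<or> R = insert x P"
  shows "simp_complex (K - {P, insert x P})"
  unfolding simp_complex_def
proof (intro conjI ballI allI impI)
  show "{} \<notin> K - {P, insert x P}" using K by (auto simp: simp_complex_def)
  fix \<sigma> \<tau> assume s: "\<sigma> \<in> K - {P, insert x P}" and t: "\<tau> \<subseteq> \<sigma> \<and> \<tau> \<noteq> {}"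
  then have "\<tau> \<in> K" using K by (auto simp: simp_complex_def)
  moreover have "\<tau> \<noteq> P" "\<tau> \<noteq> insert x P" using s t free by blast+
  ultimately show "\<tau> \<in> K - {P, insert x P}" by simp
qed

text \<open>Elementary collapse: the part \<open>a\<close> of \<open>w\<close> carried by the two
  removed simplices is filled by its cone from \<open>x\<close>, which trades \<open>a\<close> for
  the cone over the boundary of \<open>a\<close>.\<close>

lemma deforms_collapse:
  fixes ty :: "'k::field itself"
  assumes K: "simp_complex K" and PQ: "insert x P \<in> K" "P \<noteq> {}" "x \<notin> P"
    and free: "\<And>R. R \<in> K \<Longrightarrow> P \<subseteq> R \<Longrightarrow> R = P \<or> R = insert x P"
  shows "deforms ty K (K - {P, insert x P})"
  unfolding deforms_def
proof (intro allI ballI impI)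
  let ?L = "K - {P, insert x P}"
  fix m and w :: "'a list \<Rightarrow> 'k"
  assume w: "w \<in> chains K m" "m = 0 \<or> bd w \<in> chains ?L (m - 1)"
  define a where "a = (\<lambda>xs. if set xs \<in> {P, insert x P} then w xs else 0)"
  define b where "b = (\<lambda>xs. if set xs \<in> {P, insert x P} then 0 else w xs)"
  have wab: "w = a + b" by (auto simp: a_def b_def fun_eq_iff)
  have a: "a \<in> chains K m"
    using w(1) by (auto simp: chains_iff a_def supp_def intro: finite_subset[of _ "supp w"] split: if_splits)
  have b: "b \<in> chains ?L m"
    using w(1) by (auto simp: chains_iff b_def supp_def intro: finite_subset[of _ "supp w"] split: if_splits)
  have L: "simp_complex ?L" by (rule simp_complex_collapse[OF K free])
  have aset: "set xs = P \<or> set xs = insert x P" if "a xs \<noteq> 0" for xs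
    using that by (auto simp: a_def split: if_splits)
  have alen: "length xs = Suc m" if "a xs \<noteq> 0" for xs
    using a that unfolding chains_iff by blast
  have ca: "cone_chain x a \<in> chains K (Suc m)"
    unfolding chains_iff
  proof (intro conjI allI impI)
    show "finite (supp (cone_chain x a))" using a by (simp add: chains_iff finite_supp_cone)
    fix xs assume "cone_chain x a xs \<noteq> 0"
    then obtain ys where ys: "xs = x # ys" "a ys \<noteq> 0" by (auto simp: cone_chain_def split: list.splits if_splits)
    show "length xs = Suc (Suc m)" using ys(1) alen[OF ys(2)] by simp
    have "set xs = insert x P" using aset ys by auto
    then show "set xs \<in> K" using PQ by simp
  qed
  \<comment> \<open>In positive degree the faces of \<open>a\<close> lie in the smaller complex,
    because \<open>w\<close> is a relative cycle and \<open>b\<close> already lives there. In degree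
    0 the only face is the empty list.\<close>
  have aa: "length ys = m \<and> set ys \<subseteq> insert x P \<and> (m = 0 \<or> set ys \<in> ?L)" if "abd a ys \<noteq> 0" for ys
  proof -
    obtain xs where xs: "a xs \<noteq> 0" "length xs = Suc (length ys)" "set ys \<subseteq> set xs"
      using \<open>abd a ys \<noteq> 0\<close> by (rule abd_nonzeroD)
    have 1: "length ys = m" using xs(2) alen[OF xs(1)] by simp
    have 2: "set ys \<subseteq> insert x P" using xs(3) aset[OF xs(1)] by auto
    have 3: "set ys \<in> ?L" if m: "m \<noteq> 0"
    proof -
      obtain n where n: "m = Suc n" using m by (cases m) auto
      have "abd a = bd w - abd b"
        using bd_eq_abd[OF w(1)[unfolded n]] a b by (simp add: wab abd_add chains_finite)
      also have "\<dots> \<in> chains ?L n"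
        using w(2) n abd_in_chains[OF L b[unfolded n]] by (auto intro: chains_diff)
      finally show ?thesis using \<open>abd a ys \<noteq> 0\<close> unfolding chains_iff by blast
    qed
    show ?thesis using 1 2 3 by blast
  qed
  have cb: "cone_chain x (abd a) \<in> chains ?L m"
    unfolding chains_iff
  proof (intro conjI allI impI)
    show "finite (supp (cone_chain x (abd a)))" using a by (simp add: chains_iff finite_supp_cone finite_supp_abd)
    fix xs assume "cone_chain x (abd a) xs \<noteq> 0"
    then obtain ys where ys: "xs = x # ys" "abd a ys \<noteq> 0" by (auto simp: cone_chain_def split: list.splits if_splits)
    show "length xs = Suc m" using aa[OF ys(2)] ys by simp
    have sub: "set xs \<subseteq> insert x P" "set xs \<noteq> {}" using aa[OF ys(2)] ys by auto
    then have "set xs \<in> K" using K PQ(1) by (auto simp: simp_complex_def)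
    moreover have "set xs \<noteq> P" using PQ ys by auto
    \<comment> \<open>Otherwise the face \<open>ys\<close> would contain \<open>P\<close> while
      lying in the smaller complex, against freeness.\<close>
    moreover have "set xs \<noteq> insert x P"
    proof
      assume e: "set xs = insert x P"
      then have P: "P \<subseteq> set ys" using PQ ys by auto
      then have "ys \<noteq> []" using PQ by auto
      then have "set ys \<in> ?L" using aa[OF ys(2)] by auto
      then show False using free P by blast
    qed
    ultimately show "set xs \<in> ?L" by blast
  qed
  have "w - bd (cone_chain x a) = b + cone_chain x (abd a)"
    using bd_eq_abd[OF ca] abd_cone[OF chains_finite[OF a], of x] by (simp add: wab)
  also have "\<dots> \<in> chains ?L m" using b cb by (rule chains_add)
  finally show "\<exists>u\<in>chains K (Suc m). w - bd u \<in> chains ?L m" using ca by blast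
qed

text \<open>A perfect matching \<open>Q \<leftrightarrow> Q \<triangle> {\<mu> Q}\<close> of \<open>K - L\<close> that is acyclic because passing to a coface
  lexicographically increases \<open>(\<rho>, - i)\<close> or keeps the matching vertex.\<close>
lemma deforms_matching:
  fixes ty :: "'k::field itself" and \<rho> :: "'a set \<Rightarrow> real" and i :: "'a set \<Rightarrow> nat"
  assumes "finite K" "\<And>Q. Q \<in> K \<Longrightarrow> finite Q" "simp_complex K" "simp_complex L" "L \<subseteq> K"
    and ins: "\<And>Q. Q \<in> K - L \<Longrightarrow> insert (\<mu> Q) Q \<in> K - L \<and> \<mu> (insert (\<mu> Q) Q) = \<mu> Q"
    and del: "\<And>Q. Q \<in> K - L \<Longrightarrow> Q - {\<mu> Q} \<in> K - L \<and> \<mu> (Q - {\<mu> Q}) = \<mu> Q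
               \<and> \<rho> (Q - {\<mu> Q}) = \<rho> Q \<and> i (Q - {\<mu> Q}) = i Q"
    and ord: "\<And>Q R. Q \<in> K - L \<Longrightarrow> R \<in> K - L \<Longrightarrow> Q \<subseteq> R \<Longrightarrow>
               \<rho> Q < \<rho> R \<or> \<rho> Q = \<rho> R \<and> (i R < i Q \<or> i R = i Q \<and> \<mu> R = \<mu> Q)"
  shows "deforms ty K L"
  using assms
proof (induction "card (K - L)" arbitrary: K rule: less_induct)
  case less
  note ins = less.prems(6) and del = less.prems(7) and ord = less.prems(8)
  show ?case
  proof (cases "K = L")
    case True
    then show ?thesis by (simp add: deforms_refl)
  next
    case False
    let ?S = "K - L"
    have S: "finite ?S" "?S \<noteq> {}" using False less.prems by auto
    \<comment> \<open>The collapse starts at the upper end of the order: maximal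
      \<open>\<rho>\<close>, then minimal \<open>i\<close>, then maximal cardinality.\<close>
    define A where "A = {Q\<in>?S. \<rho> Q = Max (\<rho> ` ?S)}"
    have "Max (\<rho> ` ?S) \<in> \<rho> ` ?S" using S by (intro Max_in) auto
    then have "A \<noteq> {}" unfolding A_def by (auto simp: eq_commute)
    moreover have "finite A" by (rule finite_subset[OF _ S(1)]) (auto simp: A_def)
    ultimately have A: "finite A" "A \<noteq> {}" by auto
    define B where "B = {Q\<in>A. i Q = Min (i ` A)}"
    have "Min (i ` A) \<in> i ` A" using A by (intro Min_in) auto
    then have "B \<noteq> {}" unfolding B_def by (auto simp: eq_commute)
    moreover have "finite B" by (rule finite_subset[OF _ A(1)]) (auto simp: B_def)
    ultimately have B: "finite B" "B \<noteq> {}" by auto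
    have "Max (card ` B) \<in> card ` B" using B by (intro Max_in) auto
    then obtain Q where Q: "Q \<in> B" "card Q = Max (card ` B)" by auto
    have QS: "Q \<in> ?S" using Q by (auto simp: A_def B_def)
    have \<rho>max: "\<rho> R \<le> \<rho> Q" if "R \<in> ?S" for R
      using that Q S by (auto simp: A_def B_def)
    have imin: "i Q \<le> i R" if "R \<in> ?S" "\<rho> R = \<rho> Q" for R
      using that Q A by (auto simp: A_def B_def)
    have cmax: "card R \<le> card Q" if "R \<in> ?S" "\<rho> R = \<rho> Q" "i R = i Q" for R
    proof -
      have "R \<in> B" using that Q by (auto simp: A_def B_def)
      then show ?thesis using Q B by auto
    qed
    \<comment> \<open>A coface of a simplex that has the level and the matching vertex of
      \<open>Q\<close> has them too: a strict step in the order is excluded by the choice of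
      \<open>Q\<close>.\<close>
    have up: "\<rho> R = \<rho> Q \<and> i R = i Q \<and> \<mu> R = \<mu> Q"
      if "R \<in> ?S" "T \<in> ?S" "T \<subseteq> R" "\<rho> T = \<rho> Q" "i T = i Q" "\<mu> T = \<mu> Q" for R T
      using ord[OF that(2,1,3)] \<rho>max[OF that(1)] imin[OF that(1)] that by auto
    define x where "x = \<mu> Q"
    define P where "P = Q - {x}"
    have "x \<in> Q"
    proof (rule ccontr)
      assume "x \<notin> Q"
      moreover have "insert x Q \<in> ?S" using ins[OF QS] by (simp add: x_def)
      moreover have "\<rho> (insert x Q) = \<rho> Q \<and> i (insert x Q) = i Q"
        using up[of "insert x Q" Q] QS calculation by auto
      moreover have "finite Q" by (rule less.prems(2)[OF DiffD1[OF QS]])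
      ultimately show False using cmax[of "insert x Q"] by auto
    qed
    then have QP: "Q = insert x P" and xP: "x \<notin> P" by (auto simp: P_def)
    have P: "P \<in> ?S" "\<mu> P = x" "\<rho> P = \<rho> Q" "i P = i Q"
      using del[OF QS] unfolding P_def x_def by auto
    then have Pne: "P \<noteq> {}" using less.prems(3) by (auto simp: simp_complex_def)
    \<comment> \<open>A coface \<open>R\<close> of \<open>P\<close> shares level and matching vertex
      with \<open>Q\<close>. So does \<open>insert x R\<close>, which contains \<open>Q\<close> and
      by maximal cardinality equals it.\<close>
    have free: "R = P \<or> R = insert x P" if R: "R \<in> K" "P \<subseteq> R" for R
    proof -
      have RS: "R \<in> ?S" using R P Pne less.prems(4) by (auto simp: simp_complex_def)
      have R': "\<rho> R = \<rho> Q \<and> i R = i Q \<and> \<mu> R = \<mu> Q"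
        using up[OF RS P(1) R(2)] P by (simp add: x_def)
      then have iR: "insert x R \<in> ?S" using ins[OF RS] by (simp add: x_def)
      have "card (insert x R) \<le> card Q"
        using up[OF iR RS] R' by (intro cmax[OF iR]) auto
      moreover have "Q \<subseteq> insert x R" using R QP by auto
      moreover have "finite (insert x R)" by (rule less.prems(2)[OF DiffD1[OF iR]])
      ultimately have "Q = insert x R" by (metis card_seteq)
      then have "insert x R = insert x P" using QP by simp
      then show ?thesis using xP by (metis insert_absorb insert_ident)
    qed
    let ?K' = "K - {P, insert x P}"
    have inK: "insert x P \<in> K" using QS QP by auto
    have 1: "deforms ty K ?K'"
      using deforms_collapse[OF less.prems(3) inK Pne xP free] .
    have K': "simp_complex ?K'" by (rule simp_complex_collapse[OF less.prems(3) free])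
    have sub: "L \<subseteq> ?K'" using P QS QP less.prems(5) by auto
    have diff: "?K' - L = ?S - {P, Q}" using QP by auto
    have "deforms ty ?K' L"
    proof (rule less.hyps)
      show "card (?K' - L) < card ?S"
        unfolding diff using S P by (intro psubset_card_mono) auto
      show "finite ?K'" "simp_complex ?K'" "simp_complex L" "L \<subseteq> ?K'" using less.prems K' sub by auto
      show "finite R" if "R \<in> ?K'" for R using that less.prems by auto
      fix R assume R: "R \<in> ?K' - L"
      then have RS: "R \<in> ?S" and ne: "R \<noteq> P" "R \<noteq> Q" unfolding diff by auto
      have \<mu>Q: "\<mu> Q = x" by (simp add: x_def)
      have "insert (\<mu> R) R \<noteq> P"
        using ins[OF RS] P(2) xP by auto
      moreover have "insert (\<mu> R) R \<noteq> Q"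
      proof
        assume e: "insert (\<mu> R) R = Q"
        then have "\<mu> R = x" using ins[OF RS] \<mu>Q by simp
        then have "insert x R = insert x P" using e QP by simp
        then have "R = Q \<or> R = P" unfolding QP using xP by (metis insert_absorb insert_ident)
        then show False using ne by blast
      qed
      ultimately show "insert (\<mu> R) R \<in> ?K' - L \<and> \<mu> (insert (\<mu> R) R) = \<mu> R"
        using ins[OF RS] unfolding diff by auto
      have "R - {\<mu> R} \<noteq> Q"
      proof
        assume e: "R - {\<mu> R} = Q"
        then have "\<mu> R = x" using conjunct1[OF conjunct2[OF del[OF RS]]] \<mu>Q by simp
        then have "x \<notin> Q" unfolding e[symmetric] by simp
        then show False using \<open>x \<in> Q\<close> by simp
      qed
      moreover have "R - {\<mu> R} \<noteq> P"
      proof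
        assume e: "R - {\<mu> R} = P"
        then have "\<mu> R = x" using conjunct1[OF conjunct2[OF del[OF RS]]] P(2) by simp
        then have "P = R - {x}" using e by simp
        then have "R = Q \<or> R = P" unfolding QP by (cases "x \<in> R") (simp_all add: insert_absorb)
        then show False using ne by blast
      qed
      ultimately show "R - {\<mu> R} \<in> ?K' - L \<and> \<mu> (R - {\<mu> R}) = \<mu> R
               \<and> \<rho> (R - {\<mu> R}) = \<rho> R \<and> i (R - {\<mu> R}) = i R"
        using del[OF RS] unfolding diff by auto
    next
      fix R T assume "R \<in> ?K' - L" "T \<in> ?K' - L" "R \<subseteq> T"
      then show "\<rho> R < \<rho> T \<or> \<rho> R = \<rho> T \<and> (i T < i R \<or> i T = i R \<and> \<mu> T = \<mu> R)"
        using ord[of R T] by auto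
    qed
    then show ?thesis using deforms_trans[OF less.prems(3) sub _ 1] by auto
  qed
qed

section \<open>Smallest enclosing balls\<close>

definition enclosing_ball :: "'a::euclidean_space set \<Rightarrow> 'a \<Rightarrow> real \<Rightarrow> bool" where
  "enclosing_ball Q c \<rho> \<longleftrightarrow> (\<forall>q\<in>Q. dist c q \<le> \<rho>)"

definition is_meb :: "'a::euclidean_space set \<Rightarrow> 'a \<Rightarrow> real \<Rightarrow> bool" where
  "is_meb Q c \<rho> \<longleftrightarrow> enclosing_ball Q c \<rho> \<and> (\<forall>c' \<rho>'. enclosing_ball Q c' \<rho>' \<longrightarrow> \<rho> \<le> \<rho>')"

lemma continuous_on_Max_dist:
  assumes "finite Q" "Q \<noteq> {}"
  shows "continuous_on UNIV (\<lambda>c::'a::euclidean_space. Max (dist c ` Q))"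
  using assms
proof (induction rule: finite_ne_induct)
  case (singleton x)
  then show ?case by (simp add: continuous_intros)
next
  case (insert x F)
  then have eq: "(\<lambda>c::'a. Max (dist c ` insert x F)) = (\<lambda>c. max (dist c x) (Max (dist c ` F)))"
    by simp
  show ?case
    unfolding eq by (intro continuous_on_max insert.IH continuous_intros)
qed

lemma meb_exists:
  assumes "finite Q" "Q \<noteq> {}"
  shows "\<exists>c \<rho>. is_meb Q c \<rho>"
proof -
  define f where "f c = Max (dist c ` Q)" for c :: 'a
  have f: "enclosing_ball Q c \<rho> \<longleftrightarrow> f c \<le> \<rho>" for c \<rho>
    using assms by (simp add: f_def enclosing_ball_def)
  have le: "dist c q \<le> f c" if "q \<in> Q" for c q
    using f[of c "f c"] that by (simp add: enclosing_ball_def)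
  obtain q where q: "q \<in> Q" using assms by blast
  \<comment> \<open>Outside this ball the distance to \<open>q\<close> alone exceeds
    \<open>f q\<close>, so a minimum over the compact ball is global.\<close>
  have "continuous_on (cball q (f q)) f"
    unfolding f_def using continuous_on_Max_dist[OF assms] continuous_on_subset by blast
  moreover have "cball q (f q) \<noteq> {}"
    using le[OF q, of q] by simp
  ultimately obtain c where c: "c \<in> cball q (f q)" "\<And>c'. c' \<in> cball q (f q) \<Longrightarrow> f c \<le> f c'"
    using continuous_attains_inf[OF compact_cball] by blast
  have "f c \<le> f c'" for c'
  proof (cases "c' \<in> cball q (f q)")
    case True
    then show ?thesis by (rule c)
  next
    case False
    then have "f q < dist q c'" by simp
    also have "\<dots> \<le> f c'" using le[OF q, of c'] by (simp add: dist_commute)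
    finally have "f q \<le> f c'" by simp
    moreover have "f c \<le> f q" using le[OF q, of q] by (intro c) simp
    ultimately show ?thesis by simp
  qed
  then have "is_meb Q c (f c)"
    unfolding is_meb_def f by (meson order_refl order_trans)
  then show ?thesis by blast
qed

lemma meb_outside:
  assumes "is_meb Q c \<rho>" "finite Q" "Q \<noteq> {}"
  shows "\<exists>q\<in>Q. \<rho> \<le> dist c' q"
proof -
  have "enclosing_ball Q c' (Max (dist c' ` Q))"
    using assms by (simp add: enclosing_ball_def)
  then have "\<rho> \<le> Max (dist c' ` Q)"
    using assms(1) unfolding is_meb_def by blast
  moreover have "Max (dist c' ` Q) \<in> dist c' ` Q"
    using assms by (intro Max_in) auto
  ultimately show ?thesis by auto
qed

text \<open>First-order optimality: a short move of the centre along \<open>a\<close> would bring it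
  strictly closer to all points on the sphere, while interior points have slack by continuity.
  Uniqueness of the centre, removal of interior points and the hull property each exhibit such a
  forbidden direction.\<close>

lemma meb_no_descent:
  assumes meb: "is_meb Q c \<rho>" and Q: "finite Q" "Q \<noteq> {}"
    and descent: "\<And>q. q \<in> Q \<Longrightarrow> dist c q = \<rho> \<Longrightarrow> a \<bullet> (q - c) > 0"
  shows False
proof -
  have "eventually (\<lambda>t. dist (c + t *\<^sub>R a) q < \<rho>) (at_right 0)" if q: "q \<in> Q" for q
  proof (cases "dist c q = \<rho>")
    case True
    define e where "e = a \<bullet> (q - c)"
    have e: "e > 0" using descent[OF q True] by (simp add: e_def)
    have "((\<lambda>t. t * (a \<bullet> a)) \<longlongrightarrow> 0 * (a \<bullet> a)) (at_right 0)"
      by (intro tendsto_intros)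
    then have "eventually (\<lambda>t. t * (a \<bullet> a) < 2 * e) (at_right 0)"
      using e by (intro order_tendstoD(2)) auto
    then show ?thesis
      using eventually_at_right_less[of 0]
    proof eventually_elim
      case (elim t)
      have "(dist (c + t *\<^sub>R a) q)\<^sup>2 = (dist c q)\<^sup>2 - t * (2 * e - t * (a \<bullet> a))"
        unfolding dist_norm power2_norm_eq_inner e_def
        by (simp add: inner_commute algebra_simps)
      also have "\<dots> < (dist c q)\<^sup>2" using elim by simp
      finally have "dist (c + t *\<^sub>R a) q < dist c q" by (rule power2_less_imp_less) simp
      then show ?case using True by simp
    qed
  next
    case False
    then have "dist c q < \<rho>"
      using meb q by (auto simp: is_meb_def enclosing_ball_def less_le)
    moreover have "((\<lambda>t. dist (c + t *\<^sub>R a) q) \<longlongrightarrow> dist (c + 0 *\<^sub>R a) q) (at_right 0)"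
      by (intro tendsto_intros)
    ultimately show ?thesis by (intro order_tendstoD(2)) auto
  qed
  then have "eventually (\<lambda>t. \<forall>q\<in>Q. dist (c + t *\<^sub>R a) q < \<rho>) (at_right 0)"
    using Q by (simp add: eventually_ball_finite)
  then obtain t where "\<forall>q\<in>Q. dist (c + t *\<^sub>R a) q < \<rho>"
    using eventually_happens'[OF trivial_limit_at_right_real] by blast
  then show False using meb_outside[OF meb Q, of "c + t *\<^sub>R a"] by force
qed

lemma dist_shift_center:
  fixes c c' q :: "'a::real_inner"
  shows "(dist c' q)\<^sup>2 = (dist c q)\<^sup>2 - 2 * ((c' - c) \<bullet> (q - c)) + (dist c c')\<^sup>2"
  unfolding dist_norm power2_norm_eq_inner by (simp add: inner_commute algebra_simps)

text \<open>The direction towards a second centre with the same radius would be a descent direction;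
  strictness comes from the term \<open>(dist c c')\<^sup>2\<close> in
  \<open>dist_shift_center\<close>.\<close>

lemma meb_center_unique:
  assumes meb: "is_meb Q c \<rho>" and Q: "finite Q" "Q \<noteq> {}" and enc: "enclosing_ball Q c' \<rho>"
  shows "c' = c"
proof (rule ccontr)
  assume ne: "c' \<noteq> c"
  show False
  proof (rule meb_no_descent[OF meb Q, of "c' - c"])
    fix q assume q: "q \<in> Q" "dist c q = \<rho>"
    have "(dist c' q)\<^sup>2 \<le> (dist c q)\<^sup>2"
      using enc q by (intro power_mono) (auto simp: enclosing_ball_def)
    moreover have "(dist c c')\<^sup>2 > 0" using ne by simp
    ultimately show "(c' - c) \<bullet> (q - c) > 0"
      using dist_shift_center[of c' q c] by linarith
  qed
qed

lemma meb_unique: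
  assumes "is_meb Q c \<rho>" "is_meb Q c' \<rho>'" "finite Q" "Q \<noteq> {}"
  shows "c' = c" "\<rho>' = \<rho>"
proof -
  show "\<rho>' = \<rho>" using assms by (meson antisym is_meb_def)
  then show "c' = c" using assms meb_center_unique[of Q c \<rho> c'] by (simp add: is_meb_def)
qed

text \<open>The direction towards a centre with a smaller radius for \<open>Q - {x}\<close> would be
  a descent direction for \<open>Q\<close>, because \<open>x\<close> is not among the points on the
  sphere.\<close>

lemma meb_remove_interior:
  assumes meb: "is_meb Q c \<rho>" and Q: "finite Q" and x: "dist c x < \<rho>" and ne: "Q - {x} \<noteq> {}"
  shows "is_meb (Q - {x}) c \<rho>"
  unfolding is_meb_def
proof (intro conjI allI impI)
  show "enclosing_ball (Q - {x}) c \<rho>" using meb by (simp add: is_meb_def enclosing_ball_def)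
  fix c' \<rho>' assume enc: "enclosing_ball (Q - {x}) c' \<rho>'"
  show "\<rho> \<le> \<rho>'"
  proof (rule ccontr)
    assume less: "\<not> \<rho> \<le> \<rho>'"
    show False
    proof (rule meb_no_descent[OF meb Q, of "c' - c"])
      show "Q \<noteq> {}" using ne by blast
      fix q assume q: "q \<in> Q" "dist c q = \<rho>"
      then have "q \<in> Q - {x}" using x by auto
      then have "dist c' q \<le> \<rho>'" using enc by (simp add: enclosing_ball_def)
      then have "dist c' q < dist c q" using less q by simp
      then have "(dist c' q)\<^sup>2 < (dist c q)\<^sup>2" by (intro power_strict_mono) auto
      then show "(c' - c) \<bullet> (q - c) > 0"
        using dist_shift_center[of c' q c] zero_le_power2[of "dist c c'"] by linarith
    qed
  qed
qed

lemma meb_insert: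
  assumes "is_meb Q c \<rho>" "dist c x \<le> \<rho>"
  shows "is_meb (insert x Q) c \<rho>"
proof -
  have "enclosing_ball Q c' \<rho>'" if "enclosing_ball (insert x Q) c' \<rho>'" for c' \<rho>'
    using that by (simp add: enclosing_ball_def)
  then show ?thesis
    using assms by (auto simp: is_meb_def enclosing_ball_def)
qed

text \<open>The normal of a hyperplane separating the centre from the points on the sphere is a
  descent direction.\<close>

lemma meb_center_in_hull:
  assumes meb: "is_meb Q c \<rho>" and Q: "finite Q" "Q \<noteq> {}"
  shows "c \<in> convex hull {q\<in>Q. dist c q = \<rho>}"
proof (rule ccontr)
  let ?B = "{q\<in>Q. dist c q = \<rho>}"
  assume "c \<notin> convex hull ?B"
  moreover have "closed (convex hull ?B)"
    using Q by (intro compact_imp_closed finite_imp_compact_convex_hull) simp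
  ultimately obtain a b where ab: "a \<bullet> c < b" "\<And>x. x \<in> convex hull ?B \<Longrightarrow> b < a \<bullet> x"
    using separating_hyperplane_closed_point[of "convex hull ?B" c] by auto
  show False
  proof (rule meb_no_descent[OF meb Q, of a])
    fix q assume "q \<in> Q" "dist c q = \<rho>"
    then have "b < a \<bullet> q" by (intro ab hull_inc) auto
    then show "a \<bullet> (q - c) > 0" using ab(1) by (simp add: inner_diff_right)
  qed
qed

text \<open>Averaging \<open>\<parallel>q - p\<parallel>\<^sup>2\<close> over the barycentric weights of the centre gives \<open>2 \<rho>\<^sup>2\<close> for each
  \<open>p\<close> on the sphere; summing over these \<open>p\<close> yields Jung's bound.\<close>
lemma jung:
  assumes meb: "is_meb Q c \<rho>" and Q: "finite Q" "Q \<noteq> {}" "card Q \<le> Suc m"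
    and diam: "\<And>p q. p \<in> Q \<Longrightarrow> q \<in> Q \<Longrightarrow> dist p q \<le> 2 * r"
  shows "\<rho> \<le> cconst m * r"
proof -
  let ?B = "{q\<in>Q. dist c q = \<rho>}"
  have fB: "finite ?B" using Q by simp
  obtain u where u: "\<And>q. q \<in> ?B \<Longrightarrow> 0 \<le> u q" "sum u ?B = 1" "(\<Sum>q\<in>?B. u q *\<^sub>R q) = c"
    using meb_center_in_hull[OF meb Q(1,2)] unfolding convex_hull_finite[OF fB] by auto
  have r: "0 \<le> r" using Q diam[of q q for q] by fastforce
  have point: "2 * \<rho>\<^sup>2 \<le> (1 - u p) * (2 * r)\<^sup>2" if p: "p \<in> ?B" for p
  proof -
    have eq: "(dist q p)\<^sup>2 = 2 * \<rho>\<^sup>2 - 2 * ((q - c) \<bullet> (p - c))" if "q \<in> ?B" for q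
      using dist_shift_center[of q p c] that p by (simp add: dist_commute)
    \<comment> \<open>The inner products average to zero, since the weighted mean of the points on
      the sphere is \<open>c\<close>.\<close>
    have "(\<Sum>q\<in>?B. u q * (dist q p)\<^sup>2) = (\<Sum>q\<in>?B. u q * (2 * \<rho>\<^sup>2) - 2 * ((u q *\<^sub>R q - u q *\<^sub>R c) \<bullet> (p - c)))"
      by (intro sum.cong refl) (simp only: eq scaleR_diff_right[symmetric] inner_scaleR_left, simp add: algebra_simps)
    also have "\<dots> = (\<Sum>q\<in>?B. u q) * (2 * \<rho>\<^sup>2) - 2 * (((\<Sum>q\<in>?B. u q *\<^sub>R q) - (\<Sum>q\<in>?B. u q) *\<^sub>R c) \<bullet> (p - c))"
      unfolding sum_subtractf sum_distrib_left[symmetric] inner_sum_left[symmetric] sum_distrib_right scaleR_sum_left ..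
    finally have "2 * \<rho>\<^sup>2 = (\<Sum>q\<in>?B. u q * (dist q p)\<^sup>2)" using u by simp
    \<comment> \<open>Dropping the vanishing term \<open>q = p\<close> leaves total weight
      \<open>1 - u p\<close>; this is what improves the bound over
      \<open>\<rho> \<le> sqrt 2 * r\<close>.\<close>
    also have "\<dots> = (\<Sum>q\<in>?B - {p}. u q * (dist q p)\<^sup>2)"
      using fB p by (subst sum.remove[of _ p]) auto
    also have "\<dots> \<le> (\<Sum>q\<in>?B - {p}. u q * (2 * r)\<^sup>2)"
      using u(1) diam p by (intro sum_mono mult_left_mono power_mono) auto
    also have "\<dots> = (1 - u p) * (2 * r)\<^sup>2"
      using u(2) sum.remove[OF fB p, of u] by (simp add: sum_distrib_right[symmetric])
    finally show ?thesis .
  qed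
  define n where "n = card ?B"
  have "?B \<noteq> {}" using u(2) by force
  then have n: "1 \<le> n" using fB by (simp add: n_def Suc_le_eq card_gt_0_iff)
  have "n \<le> Suc m" using card_mono[of Q ?B] Q by (simp add: n_def)
  have "(\<Sum>p\<in>?B. 2 * \<rho>\<^sup>2) \<le> (\<Sum>p\<in>?B. (1 - u p) * (2 * r)\<^sup>2)"
    by (intro sum_mono point)
  also have "\<dots> = (real n - 1) * (2 * r)\<^sup>2"
    unfolding sum_distrib_right[symmetric] sum_subtractf u(2) n_def by simp
  finally have "real n * \<rho>\<^sup>2 \<le> (real n - 1) * (2 * r\<^sup>2)"
    by (simp add: n_def power2_eq_square algebra_simps)
  then have "\<rho>\<^sup>2 \<le> (real n - 1) * (2 * r\<^sup>2) / real n"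
    using n by (simp add: field_simps)
  also have "\<dots> = (1 - 1 / real n) * (2 * r\<^sup>2)" using n by (simp add: field_simps)
  \<comment> \<open>The bound grows with the number \<open>n \<le> m + 1\<close> of points on the
    sphere; at \<open>n = m + 1\<close> the factor of \<open>r\<^sup>2\<close> is
    \<open>2 * m / (m + 1)\<close>, the square of \<open>cconst m\<close>.\<close>
  also have "\<dots> \<le> (1 - 1 / real (Suc m)) * (2 * r\<^sup>2)"
    using n \<open>n \<le> Suc m\<close> by (intro mult_right_mono diff_left_mono divide_left_mono) auto
  also have "\<dots> = (cconst m * r)\<^sup>2"
    by (simp add: cconst_def power_mult_distrib field_simps)
  finally have "\<rho>\<^sup>2 \<le> (cconst m * r)\<^sup>2" .
  then show ?thesis
    by (rule power2_le_imp_le) (simp add: cconst_def r)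
qed

section \<open>The Cech complex deforms to its Delaunay part\<close>

definition cech :: "'a::euclidean_space set \<Rightarrow> real \<Rightarrow> 'a set set" where
  "cech X s = {Q. Q \<subseteq> X \<and> Q \<noteq> {} \<and> (\<exists>c. enclosing_ball Q c s)}"

text \<open>Some sphere, in the power-function form \<open>\<parallel>p\<parallel>\<^sup>2 - a \<bullet> p + b\<close> in which spheres can be
  interpolated, encloses \<open>Q\<close> and excludes \<open>E\<close>.\<close>
definition separable :: "'a::euclidean_space set \<Rightarrow> 'a set \<Rightarrow> bool" where
  "separable Q E \<longleftrightarrow> (\<exists>a b. (\<forall>q\<in>Q. q \<bullet> q - a \<bullet> q + b \<le> 0) \<and> (\<forall>e\<in>E. 0 \<le> e \<bullet> e - a \<bullet> e + b))"

lemma separable_mono: "separable Q E \<Longrightarrow> Q' \<subseteq> Q \<Longrightarrow> E' \<subseteq> E \<Longrightarrow> separable Q' E'"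
  unfolding separable_def by (meson subsetD)

text \<open>A sphere witnessing the first assumption cannot exclude \<open>x\<close>, so it encloses
  \<open>x\<close> as well.\<close>

lemma separable_insert:
  assumes "separable Q E" "\<not> separable Q (insert x E)"
  shows "separable (insert x Q) E"
proof -
  obtain a b where ab: "\<forall>q\<in>Q. q \<bullet> q - a \<bullet> q + b \<le> 0" "\<forall>e\<in>E. 0 \<le> e \<bullet> e - a \<bullet> e + b"
    using assms(1) unfolding separable_def by blast
  then have "\<not> 0 \<le> x \<bullet> x - a \<bullet> x + b"
    using assms(2) unfolding separable_def by (metis insert_iff)
  then show ?thesis
    using ab unfolding separable_def by (intro exI[of _ a] exI[of _ b]) auto
qed

text \<open>In power-function form the spheres are an affine family. Between one that encloses
  \<open>x\<close> and one that excludes it, some convex combination passes through \<open>x\<close>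
  and meets both requirements. Contrapositively, deleting the matching vertex preserves
  inseparability.\<close>

lemma separable_remove:
  assumes "separable Q E" "separable (Q - {x}) (insert x E)" "x \<in> Q"
  shows "separable Q (insert x E)"
proof -
  define g where "g a b p = p \<bullet> p - a \<bullet> p + b" for a p :: 'a and b :: real
  obtain a b where ab: "\<forall>q\<in>Q. g a b q \<le> 0" "\<forall>e\<in>E. 0 \<le> g a b e"
    using assms(1) unfolding separable_def g_def by blast
  obtain a' b' where ab': "\<forall>q\<in>Q - {x}. g a' b' q \<le> 0" "\<forall>e\<in>insert x E. 0 \<le> g a' b' e"
    using assms(2) unfolding separable_def g_def by blast
  have "\<exists>t. 0 \<le> t \<and> t \<le> 1 \<and> (1 - t) * g a b x + t * g a' b' x = 0"
  proof (cases "g a b x = 0")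
    case True
    then show ?thesis by (intro exI[of _ 0]) simp
  next
    case False
    then have 1: "g a b x < 0" "0 \<le> g a' b' x" using ab ab' assms(3) by (auto simp: less_le)
    then show ?thesis
      by (intro exI[of _ "- g a b x / (g a' b' x - g a b x)"]) (auto simp: field_simps)
  qed
  then obtain t where t: "0 \<le> t" "t \<le> 1" "(1 - t) * g a b x + t * g a' b' x = 0" by blast
  define a'' b'' where "a'' = (1 - t) *\<^sub>R a + t *\<^sub>R a'" and "b'' = (1 - t) * b + t * b'"
  have mix: "g a'' b'' p = (1 - t) * g a b p + t * g a' b' p" for p
    by (simp add: g_def a''_def b''_def inner_add_left inner_diff_left algebra_simps)
  have "g a'' b'' q \<le> 0" if "q \<in> Q" for q
  proof (cases "q = x")
    case True
    then show ?thesis using t mix by simp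
  next
    case False
    then have "(1 - t) * g a b q \<le> 0" "t * g a' b' q \<le> 0"
      using ab ab' that t by (auto intro!: mult_nonneg_nonpos)
    then show ?thesis by (simp add: mix)
  qed
  moreover have "0 \<le> g a'' b'' e" if "e \<in> insert x E" for e
  proof (cases "e = x")
    case True
    then show ?thesis using t mix by simp
  next
    case False
    then show ?thesis using ab ab' that t by (simp add: mix)
  qed
  ultimately show ?thesis unfolding separable_def g_def by blast
qed

lemma power_of_sphere:
  fixes c p :: "'a::real_inner"
  shows "p \<bullet> p - (2 *\<^sub>R c) \<bullet> p + (c \<bullet> c - w) = (dist c p)\<^sup>2 - w"
  unfolding dist_norm power2_norm_eq_inner by (simp add: inner_commute algebra_simps)

text \<open>As \<open>Q \<subseteq> X\<close>, the enclosed points of \<open>Q\<close> are also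
  excluded and so lie on the separating sphere, which is an empty sphere through \<open>Q\<close>;
  its centre lies in all their Voronoi cells.\<close>

lemma delaunay_iff_separable:
  assumes "Q \<subseteq> X" "Q \<noteq> {}"
  shows "Q \<in> delaunay X \<longleftrightarrow> separable Q X"
proof
  assume "Q \<in> delaunay X"
  then obtain c where c: "\<And>x y. x \<in> Q \<Longrightarrow> y \<in> X \<Longrightarrow> dist c x \<le> dist c y"
    unfolding delaunay_def voronoi_def by blast
  obtain x0 where x0: "x0 \<in> Q" using assms by blast
  have "q \<bullet> q - (2 *\<^sub>R c) \<bullet> q + (c \<bullet> c - (dist c x0)\<^sup>2) \<le> 0" if "q \<in> Q" for q
    unfolding power_of_sphere using c[OF that, of x0] x0 assms by (auto intro: power_mono)
  moreover have "0 \<le> e \<bullet> e - (2 *\<^sub>R c) \<bullet> e + (c \<bullet> c - (dist c x0)\<^sup>2)" if "e \<in> X" for e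
    unfolding power_of_sphere using c[OF x0 that] by (auto intro: power_mono)
  ultimately show "separable Q X" unfolding separable_def by blast
next
  assume "separable Q X"
  then obtain a b where ab: "\<forall>q\<in>Q. q \<bullet> q - a \<bullet> q + b \<le> 0" "\<forall>e\<in>X. 0 \<le> e \<bullet> e - a \<bullet> e + b"
    unfolding separable_def by blast
  define c where "c = (1/2) *\<^sub>R a"
  have pw: "p \<bullet> p - a \<bullet> p + b = (dist c p)\<^sup>2 - (c \<bullet> c - b)" for p
    using power_of_sphere[of p c "c \<bullet> c - b"] by (simp add: c_def)
  have "dist c x \<le> dist c y" if "x \<in> Q" "y \<in> X" for x y
  proof (rule power2_le_imp_le)
    show "(dist c x)\<^sup>2 \<le> (dist c y)\<^sup>2"
      using ab that unfolding pw by (meson diff_ge_0_iff_ge diff_le_0_iff_le order_trans)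
  qed simp
  then have "c \<in> (\<Inter>x\<in>Q. voronoi X x)" unfolding voronoi_def by blast
  then show "Q \<in> delaunay X" using assms unfolding delaunay_def by blast
qed

lemma simp_complex_subset: "simp_complex K \<Longrightarrow> \<sigma> \<in> K \<Longrightarrow> \<tau> \<subseteq> \<sigma> \<Longrightarrow> \<tau> \<noteq> {} \<Longrightarrow> \<tau> \<in> K"
  unfolding simp_complex_def by simp

lemma simp_complex_cech: "simp_complex (cech X s)"
  unfolding simp_complex_def cech_def enclosing_ball_def
  by (intro conjI ballI allI impI CollectI) (auto, meson subsetD)

lemma simp_complex_delaunay: "simp_complex (delaunay X)"
  unfolding simp_complex_def
proof (intro conjI ballI allI impI)
  show "{} \<notin> delaunay X" by (simp add: delaunay_def)
  fix \<sigma> \<tau> assume \<sigma>: "\<sigma> \<in> delaunay X" and \<tau>: "\<tau> \<subseteq> \<sigma> \<and> \<tau> \<noteq> {}"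
  have "(\<Inter>x\<in>\<sigma>. voronoi X x) \<subseteq> (\<Inter>x\<in>\<tau>. voronoi X x)"
    using \<tau> by (intro INF_superset_mono) auto
  moreover have "(\<Inter>x\<in>\<sigma>. voronoi X x) \<noteq> {}" "\<sigma> \<subseteq> X" using \<sigma> by (auto simp: delaunay_def)
  ultimately have "(\<Inter>x\<in>\<tau>. voronoi X x) \<noteq> {}" by (metis subset_empty)
  then show "\<tau> \<in> delaunay X"
    using \<tau> \<open>\<sigma> \<subseteq> X\<close> unfolding delaunay_def mem_Collect_eq by (intro conjI) auto
qed

lemma simp_complex_Int: "simp_complex K \<Longrightarrow> simp_complex L \<Longrightarrow> simp_complex (K \<inter> L)"
  unfolding simp_complex_def by (intro conjI ballI allI impI IntI) (simp, metis Int_iff, metis Int_iff)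

text \<open>The matching vertex is strictly inside the smallest enclosing ball, so inserting or
  deleting it keeps the ball and hence the sets \<open>E Q j\<close>;
  \<open>separable_insert\<close> and \<open>separable_remove\<close> then keep the index. For
  \<open>Q \<subseteq> R\<close> with equal radii the balls agree and inseparability passes from
  \<open>Q\<close> to \<open>R\<close>, so the index can only drop, and equal indices give the same
  vertex.\<close>

lemma deforms_cech_delaunay:
  fixes X :: "'a::euclidean_space set" and ty :: "'k::field itself"
  assumes X: "finite X"
  shows "deforms ty (cech X s) (cech X s \<inter> delaunay X)"
proof -
  let ?K = "cech X s" and ?L = "cech X s \<inter> delaunay X"
  have K: "Q \<subseteq> X" "finite Q" "Q \<noteq> {}" if "Q \<in> ?K" for Q
    using that X finite_subset by (auto simp: cech_def)
  define ball_of where "ball_of Q = (SOME p. is_meb Q (fst p) (snd p))" for Q :: "'a set"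
  define ctr where "ctr Q = fst (ball_of Q)" for Q
  define rad where "rad Q = snd (ball_of Q)" for Q
  have meb: "is_meb Q (ctr Q) (rad Q)" if QK: "Q \<in> ?K" for Q
  proof -
    obtain c \<rho> where "is_meb Q (fst (c, \<rho>)) (snd (c, \<rho>))"
      using meb_exists[OF K(2,3)[OF QK]] by auto
    then show ?thesis unfolding ctr_def rad_def ball_of_def by (rule someI)
  qed
  have meb_eq: "ctr Q = c \<and> rad Q = \<rho>" if "Q \<in> ?K" "is_meb Q c \<rho>" for Q c \<rho>
    using meb_unique[OF that(2) meb[OF that(1)] K(2,3)[OF that(1)]] by simp
  obtain xs where xs: "set xs = X" using finite_list[OF X] by blast
  define E where "E Q j = {x\<in>X. rad Q \<le> dist (ctr Q) x} \<union> set (take j xs)" for Q j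
  have E_subset: "E Q j \<subseteq> X" for Q j
    using set_take_subset[of j xs] by (auto simp: E_def xs)
  have E_mono: "E Q i \<subseteq> E Q j" if "i \<le> j" for Q i j
    unfolding E_def using set_take_subset_set_take[OF that, of xs] by (intro Un_mono order_refl)
  have E_Suc: "E Q (Suc j) = insert (xs ! j) (E Q j)" if "j < length xs" for Q j
    using that by (auto simp: E_def take_Suc_conv_app_nth)
  define idx where "idx Q = (LEAST j. \<not> separable Q (E Q j))" for Q
  \<comment> \<open>For a non-Delaunay \<open>Q\<close> the first failing prefix has positive length
    \<open>idx Q\<close>; its last entry is the culprit.\<close>
  define \<mu> where "\<mu> Q = xs ! (idx Q - 1)" for Q
  have idxI: "idx Q = Suc j" if "separable Q (E Q j)" "\<not> separable Q (E Q (Suc j))" for Q j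
    unfolding idx_def
  proof (rule Least_equality)
    fix i assume "\<not> separable Q (E Q i)"
    then have "\<not> i \<le> j" using separable_mono[OF that(1) order_refl E_mono] by auto
    then show "Suc j \<le> i" by simp
  qed (rule that)
  have first: "\<exists>j<length xs. separable Q (E Q j) \<and> \<not> separable Q (E Q (Suc j))
      \<and> idx Q = Suc j \<and> \<mu> Q = xs ! j \<and> xs ! j \<in> X \<and> dist (ctr Q) (xs ! j) < rad Q"
    if Q: "Q \<in> ?K - ?L" for Q
  proof -
    have QK: "Q \<in> ?K" using Q by blast
    \<comment> \<open>The smallest enclosing sphere itself separates \<open>Q\<close> from the
      points outside its open ball.\<close>
    have "separable Q (E Q 0)"
      unfolding separable_def
    proof (intro exI[of _ "2 *\<^sub>R ctr Q"] exI[of _ "ctr Q \<bullet> ctr Q - (rad Q)\<^sup>2"] conjI ballI)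
      obtain q0 where q0: "q0 \<in> Q" using K(3)[OF QK] by blast
      have le: "dist (ctr Q) q \<le> rad Q" if "q \<in> Q" for q
        using meb[OF QK] that by (simp add: is_meb_def enclosing_ball_def)
      then have "0 \<le> rad Q" using q0 zero_le_dist order_trans by blast
      then show "0 \<le> e \<bullet> e - (2 *\<^sub>R ctr Q) \<bullet> e + (ctr Q \<bullet> ctr Q - (rad Q)\<^sup>2)" if "e \<in> E Q 0" for e
        unfolding power_of_sphere using that by (auto simp: E_def intro: power_mono)
      show "q \<bullet> q - (2 *\<^sub>R ctr Q) \<bullet> q + (ctr Q \<bullet> ctr Q - (rad Q)\<^sup>2) \<le> 0" if "q \<in> Q" for q
        unfolding power_of_sphere using le[OF that] by (auto intro: power_mono)
    qed
    moreover have "\<not> separable Q (E Q (length xs))"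
    proof -
      have "E Q (length xs) = X" using E_subset by (auto simp: E_def xs)
      then show ?thesis
        using Q delaunay_iff_separable[OF K(1)[OF QK] K(3)[OF QK]] by auto
    qed
    ultimately obtain j where j: "j < length xs" "separable Q (E Q j)" "\<not> separable Q (E Q (Suc j))"
      using dec_induct[of 0 "length xs" "\<lambda>j. separable Q (E Q j)"] by auto
    have i: "idx Q = Suc j" using idxI j by blast
    have x: "xs ! j \<in> X" using j(1) xs nth_mem by blast
    \<comment> \<open>Points outside the open ball belong to every \<open>E Q j\<close>, so adding
      one cannot destroy separability.\<close>
    have "dist (ctr Q) (xs ! j) < rad Q"
    proof (rule ccontr)
      assume "\<not> ?thesis"
      then have "xs ! j \<in> E Q j" using x by (simp add: E_def)
      then have "E Q (Suc j) = E Q j" using E_Suc[OF j(1)] by (simp add: insert_absorb)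
      then show False using j by simp
    qed
    then show ?thesis using j i x by (auto simp: \<mu>_def)
  qed
  have notDel: "R \<in> ?K - ?L" if "R \<in> ?K" "\<not> separable R (E Q j)" for R Q j
  proof -
    have "\<not> separable R X"
      using separable_mono[OF _ order_refl E_subset[of Q j], of R] that(2) by auto
    then show ?thesis
      using that(1) delaunay_iff_separable[OF K(1)[OF that(1)] K(3)[OF that(1)]] by simp
  qed
  show ?thesis
  proof (rule deforms_matching[where \<mu> = \<mu> and \<rho> = rad and i = idx])
    show "finite ?K" by (rule finite_subset[of _ "Pow X"]) (auto simp: cech_def X)
    show "finite Q" if "Q \<in> ?K" for Q using K(2)[OF that] .
    show "simp_complex ?K" "simp_complex ?L" "?L \<subseteq> ?K"
      by (auto intro: simp_complex_cech simp_complex_Int simp_complex_delaunay)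
  next
    fix Q assume Q: "Q \<in> ?K - ?L"
    then have QK: "Q \<in> ?K" by blast
    from first[OF Q] obtain j where j: "j < length xs" "separable Q (E Q j)" "\<not> separable Q (E Q (Suc j))"
      "\<mu> Q = xs ! j" "xs ! j \<in> X" "dist (ctr Q) (xs ! j) < rad Q" "idx Q = Suc j" by blast
    let ?R = "insert (\<mu> Q) Q" and ?T = "Q - {\<mu> Q}"
    have ER: "E R = E Q" if "ctr R = ctr Q" "rad R = rad Q" for R
      using that by (auto simp: E_def fun_eq_iff)
    have mebR: "is_meb ?R (ctr Q) (rad Q)"
      using meb_insert[OF meb[OF QK]] j by simp
    have "enclosing_ball Q c s \<Longrightarrow> rad Q \<le> s" for c
      using meb[OF QK] by (simp add: is_meb_def)
    then have "rad Q \<le> s" using QK by (auto simp: cech_def)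
    then have "enclosing_ball ?R (ctr Q) s"
      using mebR by (auto simp: is_meb_def enclosing_ball_def)
    then have RK: "?R \<in> ?K" using K(1)[OF QK] j unfolding cech_def by auto
    then have R: "ctr ?R = ctr Q \<and> rad ?R = rad Q" using meb_eq[OF RK mebR] by blast
    have sepR: "separable ?R (E Q j)"
      using separable_insert[OF j(2)] j(3) E_Suc[OF j(1)] j(4) by simp
    have nsepR: "\<not> separable ?R (E Q (Suc j))"
      using j(3) separable_mono[OF _ subset_insertI order_refl] by auto
    have "idx ?R = Suc j"
      using idxI[of ?R j] sepR nsepR ER[of ?R] R by simp
    then have "\<mu> ?R = \<mu> Q" using j by (simp add: \<mu>_def)
    then show "?R \<in> ?K - ?L \<and> \<mu> ?R = \<mu> Q"
      using notDel[OF RK nsepR] by blast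
    show "?T \<in> ?K - ?L \<and> \<mu> ?T = \<mu> Q \<and> rad ?T = rad Q \<and> idx ?T = idx Q"
    proof (cases "\<mu> Q \<in> Q")
      case False
      then show ?thesis using Q by simp
    next
      case True
      \<comment> \<open>Some point of \<open>Q\<close> lies on the enclosing sphere, hence differs
        from the matching vertex.\<close>
      obtain q where "q \<in> Q" "rad Q \<le> dist (ctr Q) q"
        using meb_outside[OF meb[OF QK] K(2,3)[OF QK]] by blast
      then have ne: "?T \<noteq> {}" using j by auto
      have TK: "?T \<in> ?K"
        by (rule simp_complex_subset[OF simp_complex_cech QK Diff_subset ne])
      have "is_meb ?T (ctr Q) (rad Q)"
        using meb_remove_interior[OF meb[OF QK] K(2)[OF QK]] j ne by simp
      then have T: "ctr ?T = ctr Q \<and> rad ?T = rad Q" using meb_eq[OF TK] by blast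
      have sepT: "separable ?T (E Q j)" by (rule separable_mono[OF j(2) Diff_subset order_refl])
      have nsepT: "\<not> separable ?T (E Q (Suc j))"
        using separable_remove[OF j(2), of "\<mu> Q"] j(3,4) E_Suc[OF j(1)] True by auto
      have "idx ?T = Suc j"
        using idxI[of ?T j] sepT nsepT ER[of ?T] T by simp
      then show ?thesis using notDel[OF TK nsepT] T j by (simp add: \<mu>_def)
    qed
  next
    fix Q R assume QR: "Q \<in> ?K - ?L" "R \<in> ?K - ?L" "Q \<subseteq> R"
    then have QK: "Q \<in> ?K" and RK: "R \<in> ?K" by auto
    have enc: "enclosing_ball Q (ctr R) (rad R)"
      using meb[OF RK] QR(3) by (auto simp: is_meb_def enclosing_ball_def)
    then have le: "rad Q \<le> rad R" using meb[OF QK] by (simp add: is_meb_def)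
    show "rad Q < rad R \<or> rad Q = rad R \<and> (idx R < idx Q \<or> idx R = idx Q \<and> \<mu> R = \<mu> Q)"
    proof (cases "rad Q = rad R")
      case True
      then have "ctr R = ctr Q"
        using meb_center_unique[OF meb[OF QK] K(2,3)[OF QK]] enc by simp
      then have E: "E R = E Q" using True by (auto simp: E_def fun_eq_iff)
      from first[OF QR(1)] obtain j where j: "\<not> separable Q (E Q (Suc j))" "idx Q = Suc j" by blast
      have "\<not> separable R (E R (Suc j))" unfolding E using j(1) separable_mono[OF _ QR(3) order_refl] by auto
      then have "idx R \<le> Suc j" unfolding idx_def by (rule Least_le)
      then have "idx R \<le> idx Q" by (simp add: j(2))
      then show ?thesis using True by (auto simp: \<mu>_def less_le)
    qed (use le in auto)
  qed
qed

section \<open>Comparison of Cech and Rips complexes\<close>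

lemma cech_subset_rips: "cech X s \<subseteq> rips X s"
proof
  fix Q assume "Q \<in> cech X s"
  then obtain c where c: "Q \<subseteq> X" "Q \<noteq> {}" "enclosing_ball Q c s" by (auto simp: cech_def)
  have "diameter Q \<le> 2 * s"
  proof (rule diameter_le)
    fix x y assume "x \<in> Q" "y \<in> Q"
    then have "dist c x \<le> s" "dist c y \<le> s" using c(3) by (auto simp: enclosing_ball_def)
    then show "norm (x - y) \<le> 2 * s"
      using dist_triangle3[of x y c] by (simp add: dist_norm)
  qed (use c in auto)
  then show "Q \<in> rips X s" using c by (simp add: rips_def)
qed

lemma rips_skeleton_subset_cech:
  assumes "finite X" "Q \<in> rips X r" "card Q \<le> Suc m"
  shows "Q \<in> cech X (cconst m * r)"
proof -
  have Q: "Q \<subseteq> X" "Q \<noteq> {}" "finite Q" "diameter Q \<le> 2 * r"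
    using assms finite_subset by (auto simp: rips_def)
  obtain c \<rho> where meb: "is_meb Q c \<rho>" using meb_exists Q by blast
  have "dist p q \<le> 2 * r" if "p \<in> Q" "q \<in> Q" for p q
    using diameter_bounded_bound[OF finite_imp_bounded[OF Q(3)] that] Q(4) by linarith
  then have "\<rho> \<le> cconst m * r" using jung[OF meb Q(3,2) assms(3)] by blast
  then have "enclosing_ball Q c (cconst m * r)"
    using meb by (force simp: is_meb_def enclosing_ball_def)
  then show ?thesis using Q by (auto simp: cech_def)
qed

section \<open>Dimensions of finitely generated subspaces\<close>

context vector_space
begin

text \<open>The space of all functions on lists can be infinite-dimensional, and \<open>dim\<close>
  takes the value 0 when bases are infinite; finite generation of the subspaces at hand makes
  \<open>dim\<close> monotone.\<close>

definition fin_gen :: "'b set \<Rightarrow> bool" where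
  "fin_gen V \<longleftrightarrow> (\<exists>F. finite F \<and> V \<subseteq> span F)"

lemma fin_gen_subset: "local.fin_gen W \<Longrightarrow> V \<subseteq> W \<Longrightarrow> local.fin_gen V"
  unfolding local.fin_gen_def by (meson subset_trans)

lemma fin_gen_independent:
  assumes "local.fin_gen V" "\<not> dependent B" "B \<subseteq> V"
  shows "finite B"
proof -
  obtain F where "finite F" "V \<subseteq> span F" using assms(1) unfolding local.fin_gen_def by blast
  then show ?thesis using independent_span_bound[of F B] assms by auto
qed

lemma fin_gen_span_Un:
  assumes "local.fin_gen V" "local.fin_gen W"
  shows "local.fin_gen (span (V \<union> W))"
proof -
  obtain F G where "finite F" "V \<subseteq> span F" "finite G" "W \<subseteq> span G"
    using assms unfolding local.fin_gen_def by blast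
  then have "finite (F \<union> G)" "V \<union> W \<subseteq> span (F \<union> G)"
    using span_mono[of F "F \<union> G"] span_mono[of G "F \<union> G"] by auto
  then show ?thesis unfolding local.fin_gen_def using span_minimal subspace_span by blast
qed

lemma dim_mono_fin_gen:
  assumes "local.fin_gen W" "V \<subseteq> span W"
  shows "dim V \<le> dim W"
proof -
  obtain B where B: "B \<subseteq> W" "\<not> dependent B" "W \<subseteq> span B" "card B = dim W"
    using basis_exists by blast
  have "V \<subseteq> span B" using assms(2) span_minimal[OF B(3) subspace_span] by blast
  then show ?thesis
    using dim_le_card[of V B] local.fin_gen_independent[OF assms(1) B(2,1)] B(4) by simp
qed

lemma dim_insert_fin_gen:
  assumes "local.fin_gen Y" "v \<notin> span Y"
  shows "dim (insert v Y) = Suc (dim Y)"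
proof -
  obtain B where B: "B \<subseteq> Y" "\<not> dependent B" "Y \<subseteq> span B" "card B = dim Y"
    using basis_exists by blast
  have sp: "span B = span Y" using B(1,3) span_eq span_superset by (metis subset_trans)
  then have "span (insert v B) = span (insert v Y)" by (simp add: span_insert)
  moreover have "\<not> dependent (insert v B)" using B(2) assms(2) sp by (intro independent_insertI) auto
  ultimately have "dim (insert v Y) = card (insert v B)" by (rule dim_eq_card)
  moreover have "v \<notin> B" using assms(2) B(1) span_superset by blast
  ultimately show ?thesis
    using B(4) local.fin_gen_independent[OF assms(1) B(2,1)] by simp
qed

text \<open>A basis of the intersection is extended to a basis of \<open>S\<close>; the added
  vectors are independent modulo \<open>T\<close>, so each raises the dimension by one.\<close>

lemma dim_span_Un_Int:
  assumes S: "subspace S" "local.fin_gen S" and T: "subspace T" "local.fin_gen T"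
  shows "dim (span (S \<union> T)) + dim (S \<inter> T) = dim S + dim T"
proof -
  obtain B where B: "B \<subseteq> S \<inter> T" "\<not> dependent B" "S \<inter> T \<subseteq> span B" "card B = dim (S \<inter> T)"
    using basis_exists by blast
  obtain C where C: "B \<subseteq> C" "C \<subseteq> S" "\<not> dependent C" "S \<subseteq> span C"
    using maximal_independent_subset_extend[of B S] B by auto
  have fC: "finite C" using local.fin_gen_independent[OF S(2) C(3,2)] .
  have dimS: "dim S = card C" using basis_card_eq_dim[OF C(2,4,3)] by simp
  have step: "dim (G \<union> T) = dim T + card G" if "finite G" "G \<subseteq> C - B" for G
    using that
  proof (induction G rule: finite_induct)
    case (insert v G)
    have "v \<notin> span (G \<union> T)"
    proof
      assume "v \<in> span (G \<union> T)"
      then obtain g t where gt: "g \<in> span G" "t \<in> span T" "v = g + t"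
        unfolding span_Un by blast
      have "g \<in> S"
        using gt(1) insert.prems C(2) span_minimal[OF _ S(1), of G] by blast
      moreover have "v \<in> S" using insert.prems C(2) by blast
      ultimately have "v - g \<in> S" by (intro subspace_diff[OF S(1)])
      moreover have "t \<in> T" using gt(2) T(1) by (metis span_eq_iff)
      ultimately have "t \<in> span B" using B(3) gt(3) by auto
      then have "t \<in> span (C - {v})" using span_mono[of B "C - {v}"] C(1) insert.prems by blast
      moreover have "g \<in> span (C - {v})"
        using gt(1) span_mono[of G "C - {v}"] insert.prems insert.hyps by blast
      ultimately have "v \<in> span (C - {v})" using gt(3) span_add by blast
      then show False using C(3) insert.prems unfolding dependent_def by blast
    qed
    moreover have "local.fin_gen (G \<union> T)"
    proof -
      have "local.fin_gen G" unfolding local.fin_gen_def using insert.hyps span_superset by (intro exI[of _ G] conjI)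
      from local.fin_gen_span_Un[OF this T(2)] show ?thesis by (rule local.fin_gen_subset) (rule span_superset)
    qed
    ultimately have "dim (insert v (G \<union> T)) = Suc (dim (G \<union> T))" by (intro local.dim_insert_fin_gen)
    then show ?case using insert by simp
  qed simp
  have "span ((C - B) \<union> T) = span (S \<union> T)"
  proof (rule antisym)
    show "span ((C - B) \<union> T) \<subseteq> span (S \<union> T)" using C(2) by (intro span_mono) auto
    have "C \<subseteq> (C - B) \<union> T" using B(1) by blast
    then have "S \<subseteq> span ((C - B) \<union> T)" using C(4) span_mono by blast
    moreover have "T \<subseteq> span ((C - B) \<union> T)" using span_superset by blast
    ultimately show "span (S \<union> T) \<subseteq> span ((C - B) \<union> T)"
      by (intro span_minimal subspace_span) auto
  qed
  then have "dim (span (S \<union> T)) = dim T + card (C - B)"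
    using step[of "C - B"] fC dim_span by (metis finite_Diff order_refl)
  moreover have "card (C - B) + card B = card C"
    using fC C(1) by (simp add: card_Diff_subset card_mono finite_subset)
  ultimately show ?thesis using dimS B(4) by simp
qed

text \<open>\<open>V \<inter> B\<close> and \<open>U \<inter> B'\<close> lie in
  \<open>V \<inter> B'\<close> and meet in \<open>U \<inter> B\<close>, so the dimension formula
  applies. Every rank inequality below is an instance, except those that use the cokernel.\<close>

lemma dim_supermodular:
  assumes sub: "subspace U" "subspace V" "subspace B" "subspace B'"
    and fg: "local.fin_gen V" and "U \<subseteq> V" "B \<subseteq> B'"
  shows "dim (V \<inter> B) + dim (U \<inter> B') \<le> dim (V \<inter> B') + dim (U \<inter> B)"
proof -
  have eq: "(V \<inter> B) \<inter> (U \<inter> B') = U \<inter> B" using assms by blast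
  have "dim (span ((V \<inter> B) \<union> (U \<inter> B'))) + dim ((V \<inter> B) \<inter> (U \<inter> B')) = dim (V \<inter> B) + dim (U \<inter> B')"
    by (intro local.dim_span_Un_Int subspace_inter sub local.fin_gen_subset[OF fg]) (use assms in auto)
  moreover have "dim (span ((V \<inter> B) \<union> (U \<inter> B'))) \<le> dim (V \<inter> B')"
    using assms by (subst dim_span, intro local.dim_mono_fin_gen)
      (auto intro: local.fin_gen_subset[OF fg] span_superset[THEN subsetD])
  ultimately show ?thesis unfolding eq by linarith
qed

text \<open>Modulo \<open>B'\<close> each element of \<open>Z\<close> is represented in
  \<open>Z'\<close>; since \<open>B' \<subseteq> B\<close>, elements of \<open>Z \<inter> B\<close>
  are represented in \<open>Z' \<inter> B\<close>. The dimension formula is then applied to the sums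
  of both with \<open>B'\<close>.\<close>

lemma dim_cokernel_bound:
  assumes sub: "subspace Z" "subspace Z'" "subspace B" "subspace B'"
    and fg: "local.fin_gen Z" "local.fin_gen Z'" "local.fin_gen B'" and "B' \<subseteq> B" and Z: "Z \<subseteq> span (Z' \<union> B')"
  shows "dim (Z \<inter> B) + dim (Z' \<inter> B') \<le> dim (Z' \<inter> B) + dim (Z \<inter> B')"
proof -
  have "Z \<inter> B \<subseteq> span ((Z' \<inter> B) \<union> B')"
  proof
    fix v assume v: "v \<in> Z \<inter> B"
    then have "v \<in> span (Z' \<union> B')" using Z by blast
    then obtain z b where zb: "z \<in> span Z'" "b \<in> span B'" "v = z + b" unfolding span_Un by blast
    then have b: "b \<in> B'" and "z \<in> Z'" using sub span_eq_iff by blast+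
    moreover have "v - b \<in> B" using v b assms(8) sub(3) subspace_diff by blast
    ultimately have "z \<in> Z' \<inter> B" using zb(3) by simp
    then show "v \<in> span ((Z' \<inter> B) \<union> B')"
      using b zb(3) span_add span_superset by (metis Un_iff span_base)
  qed
  then have "(Z \<inter> B) \<union> B' \<subseteq> span ((Z' \<inter> B) \<union> B')" using span_superset by blast
  moreover have fg2: "local.fin_gen (Z \<inter> B)" "local.fin_gen (Z' \<inter> B)"
    using fg local.fin_gen_subset by (metis Int_lower1)+
  have "local.fin_gen (Z' \<inter> B \<union> B')"
    using local.fin_gen_span_Un[OF fg2(2) fg(3)] local.fin_gen_subset span_superset by blast
  ultimately have "dim (span ((Z \<inter> B) \<union> B')) \<le> dim (span ((Z' \<inter> B) \<union> B'))"
    unfolding dim_span by (rule local.dim_mono_fin_gen[rotated])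
  moreover have "dim (span ((Z \<inter> B) \<union> B')) + dim (Z \<inter> B \<inter> B') = dim (Z \<inter> B) + dim B'"
    by (intro local.dim_span_Un_Int subspace_inter sub fg fg2)
  moreover have "dim (span ((Z' \<inter> B) \<union> B')) + dim (Z' \<inter> B \<inter> B') = dim (Z' \<inter> B) + dim B'"
    by (intro local.dim_span_Un_Int subspace_inter sub fg fg2)
  moreover have eq: "Z \<inter> B \<inter> B' = Z \<inter> B'" "Z' \<inter> B \<inter> B' = Z' \<inter> B'" using assms(8) by auto
  ultimately show ?thesis unfolding eq by linarith
qed

text \<open>A basis of \<open>Z \<inter> B\<close> is extended to \<open>Z\<close> and then
  discarded. Together with \<open>relative_generators_card\<close> this identifies the least number
  of generators of \<open>Z\<close> modulo \<open>B\<close>.\<close>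

lemma relative_generators_exist:
  assumes "subspace Z" "subspace B" "local.fin_gen Z"
  shows "\<exists>G\<subseteq>Z. finite G \<and> card G + dim (Z \<inter> B) = dim Z \<and> Z \<subseteq> span (G \<union> B)"
proof -
  obtain A where A: "A \<subseteq> Z \<inter> B" "\<not> dependent A" "Z \<inter> B \<subseteq> span A" "card A = dim (Z \<inter> B)"
    using basis_exists by blast
  obtain C where C: "A \<subseteq> C" "C \<subseteq> Z" "\<not> dependent C" "Z \<subseteq> span C"
    using maximal_independent_subset_extend[of A Z] A by auto
  have fC: "finite C" using local.fin_gen_independent[OF assms(3) C(3,2)] .
  have "card (C - A) + card A = card C"
    using fC C(1) by (simp add: card_Diff_subset card_mono finite_subset)
  moreover have "dim Z = card C" using basis_card_eq_dim[OF C(2,4,3)] by simp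
  moreover have "Z \<subseteq> span ((C - A) \<union> B)"
    using C(4) A(1) span_mono[of C "(C - A) \<union> B"] by blast
  ultimately show ?thesis using A(4) C(2) fC by (intro exI[of _ "C - A"]) auto
qed

lemma relative_generators_card:
  assumes "subspace Z" "subspace B" "local.fin_gen Z" "local.fin_gen B" "finite G" "Z \<subseteq> span (G \<union> B)"
  shows "dim Z \<le> card G + dim (Z \<inter> B)"
proof -
  obtain A where A: "A \<subseteq> B" "\<not> dependent A" "B \<subseteq> span A" "card A = dim B"
    using basis_exists by blast
  have fA: "finite A" using local.fin_gen_independent[OF assms(4) A(2,1)] .
  have sp: "G \<union> B \<subseteq> span (G \<union> A)"
    using A(3) span_mono[of A "G \<union> A"] span_superset[of "G \<union> A"] by blast
  then have "span (G \<union> B) \<subseteq> span (G \<union> A)" by (intro span_minimal subspace_span)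
  then have "Z \<union> B \<subseteq> span (G \<union> A)" using assms(6) sp by blast
  then have "dim (span (Z \<union> B)) \<le> card (G \<union> A)"
    unfolding dim_span using fA assms(5) by (intro dim_le_card) auto
  also have "\<dots> \<le> card G + dim B" using card_Un_le[of G A] A(4) by simp
  finally have "dim (span (Z \<union> B)) \<le> card G + dim B" .
  then show ?thesis
    using local.dim_span_Un_Int[OF assms(1,3,2,4)] by linarith
qed

end

section \<open>Cosets in function spaces and the dimension of a quotient\<close>

definition fun_scale :: "'k::field \<Rightarrow> ('b \<Rightarrow> 'k) \<Rightarrow> 'b \<Rightarrow> 'k" where
  "fun_scale a f = (\<lambda>x. a * f x)"

global_interpretation fv: vector_space "fun_scale :: 'k::field \<Rightarrow> ('b \<Rightarrow> 'k) \<Rightarrow> 'b \<Rightarrow> 'k"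
  by unfold_locales (auto simp: fun_scale_def fun_eq_iff algebra_simps)

lemma span_from_diff:
  assumes "f - g \<in> fv.span S" "g \<in> fv.span S"
  shows "f \<in> fv.span S"
  using fv.span_add[OF assms] by simp

definition coset :: "('b \<Rightarrow> 'k::field) set \<Rightarrow> ('b \<Rightarrow> 'k) \<Rightarrow> ('b \<Rightarrow> 'k) set" where
  "coset B z = {z + b | b. b \<in> B}"

lemma coset_iff: "f \<in> coset B z \<longleftrightarrow> f - z \<in> B"
  unfolding coset_def by (auto simp: algebra_simps) (metis add_diff_cancel_left' diff_add_cancel)

lemma coset_eq_iff:
  assumes "fv.subspace B"
  shows "coset B y = coset B z \<longleftrightarrow> y - z \<in> B"
proof
  assume "coset B y = coset B z"
  moreover have "y \<in> coset B y" using fv.subspace_0[OF assms] by (simp add: coset_iff)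
  ultimately show "y - z \<in> B" by (simp add: coset_iff)
next
  assume yz: "y - z \<in> B"
  have "f - y \<in> B \<longleftrightarrow> f - z \<in> B" for f
  proof
    assume "f - y \<in> B"
    then show "f - z \<in> B" using fv.subspace_add[OF assms _ yz, of "f - y"] by simp
  next
    assume "f - z \<in> B"
    then show "f - y \<in> B" using fv.subspace_diff[OF assms _ yz, of "f - z"] by simp
  qed
  then show "coset B y = coset B z" by (auto simp: coset_iff)
qed

lemma sum_fun_apply: "(\<Sum>A\<in>F. g A) y = (\<Sum>A\<in>F. (g A y :: 'k::field))"
  by (induction F rule: infinite_finite_induct) auto

lemma qspan_coset:
  "qspan Bd F = {coset Bd (\<Sum>A\<in>F. fun_scale (u A) (g A)) | u g. \<forall>A\<in>F. g A \<in> A}"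
  unfolding qspan_def coset_def plus_fun_def sum_fun_apply fun_scale_def ..

text \<open>Families of cosets spanning the quotient correspond to sets generating \<open>Z\<close>
  modulo \<open>B\<close>, whose least size is \<open>dim Z - dim (Z \<inter> B)\<close>.\<close>

lemma qdim_coset:
  assumes Z: "fv.subspace Z" "fv.fin_gen Z" and B: "fv.subspace B" "fv.fin_gen B"
  shows "qdim B (coset B ` Z) + fv.dim (Z \<inter> B) = fv.dim Z"
proof -
  let ?P = "\<lambda>m. \<exists>F. finite F \<and> F \<subseteq> coset B ` Z \<and> card F = m \<and> coset B ` Z \<subseteq> qspan B F"
  obtain G where G: "G \<subseteq> Z" "finite G" "card G + fv.dim (Z \<inter> B) = fv.dim Z" "Z \<subseteq> fv.span (G \<union> B)"
    using fv.relative_generators_exist[OF Z(1) B(1) Z(2)] by blast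
  \<comment> \<open>Two generators in one coset would make one redundant, against the lower bound on
    generating sets.\<close>
  have inj: "inj_on (coset B) G"
  proof (rule inj_onI, rule ccontr)
    fix g h assume gh: "g \<in> G" "h \<in> G" "coset B g = coset B h" "g \<noteq> h"
    let ?H = "G - {g}"
    have "g - h \<in> fv.span (?H \<union> B)"
      using gh(3) coset_eq_iff[OF B(1)] by (intro fv.span_base) auto
    moreover have "h \<in> fv.span (?H \<union> B)" using gh by (intro fv.span_base) auto
    ultimately have g: "g \<in> fv.span (?H \<union> B)" by (rule span_from_diff)
    have "G \<union> B \<subseteq> fv.span (?H \<union> B)"
    proof
      fix f assume f: "f \<in> G \<union> B"
      show "f \<in> fv.span (?H \<union> B)"
        using g f by (cases "f = g") (auto intro: fv.span_base)
    qed
    then have "fv.span (G \<union> B) \<subseteq> fv.span (?H \<union> B)"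
      by (rule fv.span_minimal[OF _ fv.subspace_span])
    then have "Z \<subseteq> fv.span (?H \<union> B)" using G(4) by (rule order_trans[rotated])
    then have "fv.dim Z \<le> card ?H + fv.dim (Z \<inter> B)"
      using G(2) by (intro fv.relative_generators_card Z B) auto
    moreover have "card ?H < card G" using gh(1) G(2) by (intro psubset_card_mono) auto
    ultimately show False using G(3) by linarith
  qed
  have "?P (card G)"
  proof (intro exI[of _ "coset B ` G"] conjI)
    show "finite (coset B ` G)" "coset B ` G \<subseteq> coset B ` Z" using G by auto
    show "card (coset B ` G) = card G" by (rule card_image[OF inj])
    show "coset B ` Z \<subseteq> qspan B (coset B ` G)"
    proof
      fix A assume "A \<in> coset B ` Z"
      then obtain z where z: "z \<in> Z" "A = coset B z" by blast
      then obtain x b where xb: "x \<in> fv.span G" "b \<in> fv.span B" "z = x + b"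
        using G(4) unfolding fv.span_Un by blast
      obtain u where u: "x = (\<Sum>g\<in>G. fun_scale (u g) g)"
        using xb(1) unfolding fv.span_finite[OF G(2)] by blast
      let ?p = "inv_into G (coset B)"
      have "b \<in> B" using xb(2) fv.span_eq_iff[THEN iffD2, OF B(1)] by simp
      then have "A = coset B x" using z(2) xb(3) coset_eq_iff[OF B(1)] by simp
      also have "x = (\<Sum>A\<in>coset B ` G. fun_scale (u (?p A)) (?p A))"
        unfolding u by (subst sum.reindex[OF inj]) (simp add: inv_into_f_f[OF inj])
      finally have A: "A = coset B (\<Sum>A\<in>coset B ` G. fun_scale (u (?p A)) (?p A))" .
      have "\<forall>A\<in>coset B ` G. ?p A \<in> A"
        using inj fv.subspace_0[OF B(1)] by (auto simp: coset_iff)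
      then show "A \<in> qspan B (coset B ` G)"
        unfolding qspan_coset using A by (intro CollectI exI[of _ "\<lambda>A. u (?p A)"] exI[of _ ?p] conjI)
    qed
  qed
  moreover have "card G \<le> m" if Pm: "?P m" for m
  proof -
    obtain F where F: "finite F" "F \<subseteq> coset B ` Z" "card F = m" "coset B ` Z \<subseteq> qspan B F"
      using Pm by (elim exE conjE)
    have "\<exists>z. A = coset B z" if "A \<in> F" for A
      using F(2) that by blast
    then obtain h where h: "\<And>A. A \<in> F \<Longrightarrow> A = coset B (h A)" by metis
    have "z \<in> fv.span (h ` F \<union> B)" if "z \<in> Z" for z
    proof -
      have "coset B z \<in> qspan B F" using F(4) that by blast
      then obtain u g where ug: "coset B z = coset B (\<Sum>A\<in>F. fun_scale (u A) (g A))" "\<forall>A\<in>F. g A \<in> A"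
        unfolding qspan_coset by blast
      \<comment> \<open>\<open>qspan\<close> admits arbitrary representatives; they differ from the
        fixed ones by elements of \<open>B\<close>.\<close>
      have gA: "g A \<in> fv.span (h ` F \<union> B)" if "A \<in> F" for A
      proof -
        have "g A \<in> coset B (h A)" using ug(2) that unfolding h[OF that, symmetric] by (rule bspec)
        then have "g A - h A \<in> fv.span (h ` F \<union> B)"
          by (intro fv.span_base) (simp add: coset_iff)
        moreover have "h A \<in> fv.span (h ` F \<union> B)" using that by (intro fv.span_base) auto
        ultimately show ?thesis by (rule span_from_diff)
      qed
      have "(\<Sum>A\<in>F. fun_scale (u A) (g A)) \<in> fv.span (h ` F \<union> B)"
        by (intro fv.span_sum fv.span_scale gA)
      moreover have "z - (\<Sum>A\<in>F. fun_scale (u A) (g A)) \<in> fv.span (h ` F \<union> B)"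
        using ug(1) coset_eq_iff[OF B(1)] by (intro fv.span_base) simp
      ultimately show ?thesis by (rule span_from_diff[rotated])
    qed
    then have "fv.dim Z \<le> card (h ` F) + fv.dim (Z \<inter> B)"
      using F(1) by (intro fv.relative_generators_card Z B) auto
    then show ?thesis using G(3) card_image_le[OF F(1), of h] F(3) by linarith
  qed
  ultimately have "qdim B (coset B ` Z) = card G"
    unfolding qdim_def by (intro Least_equality)
  then show ?thesis using G(3) by simp
qed

section \<open>Matching by order statistics\<close>

text \<open>Sortedness is recorded by counts, which remain correct under ties and can be compared
  with ranks.\<close>

lemma sorted_enumeration:
  fixes k :: "'a \<Rightarrow> 'c::linorder"
  assumes "finite A"
  shows "\<exists>e. bij_betw e {..<card A} A \<and>
    (\<forall>i<card A. card {x\<in>A. k x < k (e i)} \<le> i \<and> i < card {x\<in>A. k x \<le> k (e i)})"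
proof -
  obtain zs where zs: "set zs = A" "distinct zs" using finite_distinct_list[OF assms] by blast
  define xs where "xs = sort_key k zs"
  have xs: "set xs = A" "distinct xs" "sorted (map k xs)" using zs by (simp_all add: xs_def)
  have len: "length xs = card A" using distinct_card[OF xs(2)] xs(1) by simp
  have mono: "k (xs ! i) \<le> k (xs ! j)" if "i \<le> j" "j < length xs" for i j
    using sorted_nth_mono[OF xs(3), of i j] that by simp
  have bij: "bij_betw ((!) xs) {..<card A} A"
    using bij_betw_nth[OF xs(2) _ xs(1)[symmetric], of "{..<card A}"] len by simp
  have "card {x\<in>A. k x < k (xs ! i)} \<le> i \<and> i < card {x\<in>A. k x \<le> k (xs ! i)}" if i: "i < card A" for i
  proof
    have "{x\<in>A. k x < k (xs ! i)} \<subseteq> (!) xs ` {..<i}"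
    proof
      fix x assume x: "x \<in> {x\<in>A. k x < k (xs ! i)}"
      then obtain j where j: "j < length xs" "x = xs ! j" using xs(1) by (auto simp: in_set_conv_nth)
      have "j < i"
      proof (rule ccontr)
        assume "\<not> j < i"
        then have "k (xs ! i) \<le> k (xs ! j)" using mono[of i j] j(1) by simp
        moreover have "k (xs ! j) < k (xs ! i)" using x j(2) by simp
        ultimately show False by (rule leD[THEN notE])
      qed
      then show "x \<in> (!) xs ` {..<i}" using j by blast
    qed
    from card_mono[OF _ this] have "card {x\<in>A. k x < k (xs ! i)} \<le> card ((!) xs ` {..<i})" by simp
    also have "\<dots> \<le> card {..<i}" by (rule card_image_le) simp
    finally show "card {x\<in>A. k x < k (xs ! i)} \<le> i" by simp
    have "(!) xs ` {..i} \<subseteq> {x\<in>A. k x \<le> k (xs ! i)}"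
    proof
      fix x assume "x \<in> (!) xs ` {..i}"
      then obtain j where j: "j \<le> i" "x = xs ! j" by auto
      have "xs ! j \<in> A" using j(1) i len nth_mem[of j xs] xs(1) by simp
      then show "x \<in> {x\<in>A. k x \<le> k (xs ! i)}" using mono[OF j(1)] i len j(2) by simp
    qed
    from card_mono[OF _ this] have "card ((!) xs ` {..i}) \<le> card {x\<in>A. k x \<le> k (xs ! i)}"
      using assms by simp
    moreover have "inj_on ((!) xs) {..i}"
      using bij i by (auto simp: bij_betw_def intro: inj_on_subset)
    ultimately show "i < card {x\<in>A. k x \<le> k (xs ! i)}" by (simp add: card_image)
  qed
  then show ?thesis using bij by blast
qed

text \<open>Elements in the same sorted position are paired, and the counts on both sides are
  compared through that position. Counting positions from 0, an unpaired element of \<open>B\<close>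
  has position at least \<open>card A\<close>.\<close>

lemma sorted_pairing:
  fixes k :: "'a \<Rightarrow> 'c::linorder" and l :: "'b \<Rightarrow> 'c"
  assumes A: "finite A" and B: "finite B" and le: "card A \<le> card B"
  obtains f where "inj_on f A" "f ` A \<subseteq> B"
    "\<forall>a\<in>A. card {x\<in>A. k x < k a} < card {y\<in>B. l y \<le> l (f a)}"
    "\<forall>a\<in>A. card {y\<in>B. l y < l (f a)} < card {x\<in>A. k x \<le> k a}"
    "\<forall>b\<in>B - f ` A. card A < card {y\<in>B. l y \<le> l b}"
proof -
  obtain e where e: "bij_betw e {..<card A} A"
    "\<And>i. i < card A \<Longrightarrow> card {x\<in>A. k x < k (e i)} \<le> i \<and> i < card {x\<in>A. k x \<le> k (e i)}"
    using sorted_enumeration[OF A, of k] by blast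
  obtain e' where e': "bij_betw e' {..<card B} B"
    "\<And>i. i < card B \<Longrightarrow> card {x\<in>B. l x < l (e' i)} \<le> i \<and> i < card {x\<in>B. l x \<le> l (e' i)}"
    using sorted_enumeration[OF B, of l] by blast
  define g where "g = inv_into {..<card A} e"
  have g: "g a < card A" "e (g a) = a" if "a \<in> A" for a
  proof -
    have "a \<in> e ` {..<card A}" using e(1) that by (simp add: bij_betw_def)
    then show "g a < card A" "e (g a) = a"
      using inv_into_into[of a e "{..<card A}"] f_inv_into_f[of a e "{..<card A}"] by (auto simp: g_def)
  qed
  have ge: "g (e i) = i" if "i < card A" for i
    using e(1) that by (simp add: g_def bij_betw_def)
  show thesis
  proof (rule that[of "\<lambda>a. e' (g a)"])
    have "inj_on e' {..<card B}" using e'(1) by (simp add: bij_betw_def)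
    then have "g a = g b" if "a \<in> A" "b \<in> A" "e' (g a) = e' (g b)" for a b
      using that g(1) le by (auto dest!: inj_onD[of e'] intro: less_le_trans)
    then show "inj_on (\<lambda>a. e' (g a)) A" using g(2) by (intro inj_onI) metis
    show "(\<lambda>a. e' (g a)) ` A \<subseteq> B"
    proof
      fix y assume "y \<in> (\<lambda>a. e' (g a)) ` A"
      then obtain a where a: "a \<in> A" "y = e' (g a)" by blast
      have "g a \<in> {..<card B}" using g(1)[OF a(1)] le by simp
      then show "y \<in> B" unfolding a(2) by (rule bij_betwE[OF e'(1), rule_format])
    qed
  next
    have gB: "g a < card B" if "a \<in> A" for a using g(1)[OF that] le by simp
    show "\<forall>a\<in>A. card {x\<in>A. k x < k a} < card {y\<in>B. l y \<le> l (e' (g a))}"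
    proof
      fix a assume a: "a \<in> A"
      show "card {x\<in>A. k x < k a} < card {y\<in>B. l y \<le> l (e' (g a))}"
        using e(2)[OF g(1)[OF a]] e'(2)[OF gB[OF a]] g(2)[OF a] by simp
    qed
    show "\<forall>a\<in>A. card {y\<in>B. l y < l (e' (g a))} < card {x\<in>A. k x \<le> k a}"
    proof
      fix a assume a: "a \<in> A"
      show "card {y\<in>B. l y < l (e' (g a))} < card {x\<in>A. k x \<le> k a}"
        using e(2)[OF g(1)[OF a]] e'(2)[OF gB[OF a]] g(2)[OF a] by simp
    qed
  next
    show "\<forall>b\<in>B - (\<lambda>a. e' (g a)) ` A. card A < card {y\<in>B. l y \<le> l b}"
    proof
      fix b assume b: "b \<in> B - (\<lambda>a. e' (g a)) ` A"
      then obtain j where j: "j < card B" "b = e' j" using e'(1) by (auto simp: bij_betw_def)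
      have "\<not> j < card A"
      proof
        assume "j < card A"
        then have "e j \<in> A" "g (e j) = j" using e(1) ge by (auto simp: bij_betw_def)
        then have "b = e' (g (e j))" using j by simp
        then have "b \<in> (\<lambda>a. e' (g a)) ` A" using \<open>e j \<in> A\<close> by (rule image_eqI)
        then show False using b by simp
      qed
      then show "card A < card {y\<in>B. l y \<le> l b}" using e'(2)[OF j(1)] j(2) by simp
    qed
  qed
qed

section \<open>The bottleneck distance from a partial matching\<close>

definition points :: "(ereal \<times> ereal \<Rightarrow> nat) \<Rightarrow> ((ereal \<times> ereal) \<times> nat) set" where
  "points D = {(p, i). i < D p}"

definition diagonal :: "((ereal \<times> ereal) \<times> nat) set" where
  "diagonal = {((ereal x, ereal x), i) | x i. True}"

lemma augment_eq: "augment D = points D \<union> diagonal"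
  by (simp add: augment_def points_def diagonal_def)

lemma infinite_diagonal: "infinite diagonal"
proof -
  have "range (\<lambda>i::nat. ((ereal 0, ereal 0), i)) \<subseteq> diagonal" by (auto simp: diagonal_def)
  moreover have "infinite (range (\<lambda>i::nat. ((ereal 0, ereal 0), i)))"
    by (intro range_inj_infinite injI) simp
  ultimately show ?thesis by (rule infinite_super)
qed

lemma eqpoll_Un_finite:
  assumes "infinite A" "finite F"
  shows "A \<union> F \<approx> A"
  using assms(2)
proof (induction F rule: finite_induct)
  case (insert x F)
  have "insert x (A \<union> F) \<approx> A \<union> F" using assms(1) by (intro infinite_insert_eqpoll) simp
  then show ?case using insert.IH eqpoll_trans by simp blast
qed simp

lemma eqpoll_Diff_finite:
  assumes "infinite A" "finite F" "F \<subseteq> A"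
  shows "A - F \<approx> A"
proof -
  have "infinite (A - F)" using assms by simp
  from eqpoll_Un_finite[OF this assms(2)] have "A \<approx> A - F"
    using assms(3) by (simp add: Un_absorb2)
  then show ?thesis by (rule eqpoll_sym)
qed

text \<open>Distinct copy labels keep apart points that go to the same place on the
  diagonal.\<close>

lemma inject_into_diagonal:
  assumes "finite U" "\<And>a. a \<in> U \<Longrightarrow> \<exists>x. Q a (ereal x, ereal x)"
  shows "\<exists>u. inj_on u U \<and> u ` U \<subseteq> diagonal \<and> (\<forall>a\<in>U. Q a (fst (u a)))"
proof -
  obtain x where x: "\<And>a. a \<in> U \<Longrightarrow> Q a (ereal (x a), ereal (x a))" using assms(2) by metis
  obtain e :: "'a \<Rightarrow> nat" where e: "inj_on e U" using finite_imp_inj_to_nat_seg[OF assms(1)] by blast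
  show ?thesis
  proof (intro exI[of _ "\<lambda>a. ((ereal (x a), ereal (x a)), e a)"] conjI ballI)
    show "inj_on (\<lambda>a. ((ereal (x a), ereal (x a)), e a)) U"
      using e by (auto simp: inj_on_def)
  qed (use x in \<open>auto simp: diagonal_def\<close>)
qed

text \<open>Unmatched points are paired with diagonal copies. What is left of the diagonal on either
  side is an infinite set minus a finite one; these are equipotent and are paired with each other at
  cost 0.\<close>

lemma bottleneck_le_matching:
  assumes fin: "finite (points D1)" "finite (points D2)"
    and disj: "points D1 \<inter> diagonal = {}" "points D2 \<inter> diagonal = {}"
    and h: "P \<subseteq> points D1" "inj_on h P" "h ` P \<subseteq> points D2"
    and cost: "\<And>a. a \<in> P \<Longrightarrow> pcost (fst a) (fst (h a)) \<le> \<epsilon>"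
    and left1: "\<And>a. a \<in> points D1 - P \<Longrightarrow> \<exists>x. pcost (fst a) (ereal x, ereal x) \<le> \<epsilon>"
    and left2: "\<And>a. a \<in> points D2 - h ` P \<Longrightarrow> \<exists>x. pcost (ereal x, ereal x) (fst a) \<le> \<epsilon>"
    and \<epsilon>: "0 \<le> \<epsilon>"
  shows "bottleneck D1 D2 \<le> \<epsilon>"
proof -
  define U V where "U = points D1 - P" and "V = points D2 - h ` P"
  have fUV: "finite U" "finite V" using fin by (auto simp: U_def V_def)
  obtain u where u: "inj_on u U" "u ` U \<subseteq> diagonal" "\<And>a. a \<in> U \<Longrightarrow> pcost (fst a) (fst (u a)) \<le> \<epsilon>"
    using inject_into_diagonal[OF fUV(1), of "\<lambda>a q. pcost (fst a) q \<le> \<epsilon>"] left1 unfolding U_def by blast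
  obtain v where v: "inj_on v V" "v ` V \<subseteq> diagonal" "\<And>a. a \<in> V \<Longrightarrow> pcost (fst (v a)) (fst a) \<le> \<epsilon>"
    using inject_into_diagonal[OF fUV(2), of "\<lambda>a q. pcost q (fst a) \<le> \<epsilon>"] left2 unfolding V_def by blast
  have "diagonal - v ` V \<approx> diagonal" "diagonal - u ` U \<approx> diagonal"
    by (rule eqpoll_Diff_finite[OF infinite_diagonal]; use fUV u(2) v(2) in simp)+
  then have "diagonal - v ` V \<approx> diagonal - u ` U" using eqpoll_trans eqpoll_sym by blast
  then obtain w where w: "bij_betw w (diagonal - v ` V) (diagonal - u ` U)"
    unfolding eqpoll_def by blast
  define f1 where "f1 x = (if x \<in> P then h x else u x)" for x
  define f2 where "f2 x = (if x \<in> v ` V then inv_into V v x else w x)" for x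
  define f where "f x = (if x \<in> P \<union> U then f1 x else f2 x)" for x
  have PU: "P \<union> U = points D1" "P \<inter> U = {}" using h(1) by (auto simp: U_def)
  have hV: "h ` P \<union> V = points D2" "h ` P \<inter> V = {}" using h(3) by (auto simp: V_def)
  have bij1: "bij_betw f1 (P \<union> U) (h ` P \<union> u ` U)"
    unfolding f1_def
  proof (rule bij_betw_disjoint_Un)
    show "bij_betw h P (h ` P)" "bij_betw u U (u ` U)" using h u by (auto simp: bij_betw_def)
    show "P \<inter> U = {}" using PU by simp
    show "h ` P \<inter> u ` U = {}" using h(3) u(2) disj(2) by blast
  qed
  have bij2: "bij_betw f2 (v ` V \<union> (diagonal - v ` V)) (V \<union> (diagonal - u ` U))"
    unfolding f2_def
  proof (rule bij_betw_disjoint_Un)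
    show "bij_betw (inv_into V v) (v ` V) V" using v(1) by (simp add: bij_betw_inv_into inj_on_imp_bij_betw)
    show "bij_betw w (diagonal - v ` V) (diagonal - u ` U)" by (rule w)
    show "v ` V \<inter> (diagonal - v ` V) = {}" by blast
    show "V \<inter> (diagonal - u ` U) = {}" using disj(2) by (auto simp: V_def)
  qed
  have "bij_betw f ((P \<union> U) \<union> (v ` V \<union> (diagonal - v ` V))) ((h ` P \<union> u ` U) \<union> (V \<union> (diagonal - u ` U)))"
    unfolding f_def
  proof (rule bij_betw_disjoint_Un[OF bij1 bij2])
    show "(P \<union> U) \<inter> (v ` V \<union> (diagonal - v ` V)) = {}"
      using PU(1) v(2) disj(1) by blast
    show "(h ` P \<union> u ` U) \<inter> (V \<union> (diagonal - u ` U)) = {}"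
      using hV u(2) disj(2) by blast
  qed
  moreover have "(P \<union> U) \<union> (v ` V \<union> (diagonal - v ` V)) = augment D1"
    using v(2) unfolding augment_eq PU by blast
  moreover have "(h ` P \<union> u ` U) \<union> (V \<union> (diagonal - u ` U)) = augment D2"
    using u(2) unfolding augment_eq hV(1)[symmetric] by blast
  ultimately have bij: "bij_betw f (augment D1) (augment D2)" by simp
  have "pcost (fst a) (fst (f a)) \<le> \<epsilon>" if a: "a \<in> augment D1" for a
  proof -
    consider "a \<in> P" | "a \<in> U" | "a \<in> v ` V" "a \<notin> P \<union> U" | "a \<in> diagonal" "a \<notin> v ` V" "a \<notin> P \<union> U"
      using a PU(1) unfolding augment_eq by blast
    then show ?thesis
    proof cases
      case 1
      then show ?thesis using cost by (simp add: f_def f1_def)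
    next
      case 2
      then have "a \<notin> P" using PU(2) by blast
      then show ?thesis using 2 u(3) by (simp add: f_def f1_def)
    next
      case 3
      then obtain y where y: "y \<in> V" "a = v y" by blast
      then have "f a = y" using 3 v(1) by (simp add: f_def f2_def)
      then show ?thesis using v(3)[OF y(1)] y(2) by simp
    next
      case 4
      then have fa: "f a = w a" by (simp add: f_def f2_def)
      have "w a \<in> diagonal" using w 4 by (auto simp: bij_betw_def)
      then have "is_diag (fst (w a))" "is_diag (fst a)"
        using 4(1) by (auto simp: diagonal_def is_diag_def)
      then show ?thesis using \<epsilon> by (simp add: fa pcost_def)
    qed
  qed
  then have "(SUP a\<in>augment D1. pcost (fst a) (fst (f a))) \<le> \<epsilon>" by (rule SUP_least)
  then show ?thesis
    unfolding bottleneck_def using bij by (intro INF_lower2[of f]) auto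
qed

section \<open>Diagrams of rank functions\<close>

text \<open>All quantities are locally constant away from \<open>T\<close>, so the left limit at \<open>x\<close> is the value at
  the preceding element of \<open>T\<close> (or at \<open>x - 1\<close>).\<close>
definition prv :: "real set \<Rightarrow> real \<Rightarrow> real" where
  "prv T x = Max (insert (x - 1) {y\<in>T. y < x})"

text \<open>The half-open interval encodes continuity from the right: the value at an element of
  \<open>T\<close> already includes the jump there.\<close>

definition steps :: "real set \<Rightarrow> (real \<Rightarrow> 'v) \<Rightarrow> bool" where
  "steps T f \<longleftrightarrow> (\<forall>x y. x \<le> y \<longrightarrow> T \<inter> {x<..y} = {} \<longrightarrow> f x = f y)"

lemma prv:
  assumes "finite T"
  shows "prv T x < x" "T \<inter> {prv T x<..<x} = {}"
proof -
  have "prv T x \<in> insert (x - 1) {y\<in>T. y < x}"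
    unfolding prv_def using assms by (intro Max_in) auto
  then show "prv T x < x" by auto
  have "y \<le> prv T x" if "y \<in> T" "y < x" for y
    unfolding prv_def using assms that by (intro Max_ge) auto
  then show "T \<inter> {prv T x<..<x} = {}" by fastforce
qed

lemma le_prv: "finite T \<Longrightarrow> y \<in> T \<Longrightarrow> y < x \<Longrightarrow> y \<le> prv T x"
  unfolding prv_def by (intro Max_ge) auto

lemma stepsD:
  assumes "steps T f" "x \<le> y" "\<And>z. z \<in> T \<Longrightarrow> x < z \<Longrightarrow> z \<le> y \<Longrightarrow> False"
  shows "f x = f y"
proof -
  have "T \<inter> {x<..y} = {}" using assms(3) by auto
  then show ?thesis using assms(1,2) unfolding steps_def by simp
qed

lemma steps_prv:
  assumes "finite T" "steps T f" "x \<notin> T"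
  shows "f (prv T x) = f x"
proof (rule stepsD[OF assms(2)])
  show "prv T x \<le> x" using prv(1)[OF assms(1), of x] by simp
  fix z assume z: "z \<in> T" "prv T x < z" "z \<le> x"
  then have "z \<noteq> x" using assms(3) by auto
  then show False using le_prv[OF assms(1) z(1), of x] z by simp
qed

lemma steps_telescope:
  fixes f :: "real \<Rightarrow> int"
  assumes T: "finite T" and f: "steps T f" and "s \<le> t"
  shows "(\<Sum>x\<in>{x\<in>T. s < x \<and> x \<le> t}. f x - f (prv T x)) = f t - f s"
  using \<open>s \<le> t\<close>
proof (induction "card {x\<in>T. s < x \<and> x \<le> t}" arbitrary: t rule: less_induct)
  case less
  let ?A = "\<lambda>t. {x\<in>T. s < x \<and> x \<le> t}"
  have fin: "finite (?A t)" for t using T by simp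
  show ?case
  proof (cases "?A t = {}")
    case True
    then have "f s = f t" using less.prems by (intro stepsD[OF f]) auto
    then show ?thesis unfolding True by simp
  next
    case False
    define m where "m = Max (?A t)"
    have m: "m \<in> ?A t" unfolding m_def using fin False by (intro Max_in)
    have mmax: "y \<le> m" if "y \<in> ?A t" for y unfolding m_def using fin that by (intro Max_ge)
    have fm: "f m = f t"
    proof (rule stepsD[OF f])
      show "m \<le> t" using m by simp
      fix z assume "z \<in> T" "m < z" "z \<le> t"
      then show False using mmax[of z] m by simp
    qed
    \<comment> \<open>For the first jump after \<open>s\<close> the preceding element of
      \<open>T\<close> may lie below \<open>s\<close>, hence the cut-off; \<open>f\<close> is
      constant in between.\<close>
    define p where "p = max s (prv T m)"
    have pm: "p < m" using m prv(1)[OF T, of m] by (simp add: p_def)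
    have fp: "f (prv T m) = f p"
    proof (rule stepsD[OF f])
      show "prv T m \<le> p" by (simp add: p_def)
      fix z assume z: "z \<in> T" "prv T m < z" "z \<le> p"
      then show False using le_prv[OF T z(1), of m] pm by simp
    qed
    have A: "?A t = insert m (?A p)"
    proof (intro equalityI subsetI)
      fix y assume y: "y \<in> ?A t"
      show "y \<in> insert m (?A p)"
      proof (cases "y = m")
        case False
        then have "y < m" using mmax[OF y] by simp
        then have "y \<le> p" using le_prv[OF T, of y m] y by (simp add: p_def)
        then show ?thesis using y by simp
      qed simp
    next
      fix y assume "y \<in> insert m (?A p)"
      then show "y \<in> ?A t" using m pm by auto
    qed
    have mA: "m \<notin> ?A p" using pm by simp
    have "(\<Sum>x\<in>?A p. f x - f (prv T x)) = f p - f s"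
    proof (rule less.hyps)
      show "card (?A p) < card (?A t)" unfolding A using fin mA by simp
      show "s \<le> p" by (simp add: p_def)
    qed
    then show ?thesis unfolding A sum.insert[OF fin mA] using fm fp by simp
  qed
qed

text \<open>Pairs bars with common birth \<open>b\<close>. Sorting by decreasing death, hence the
  negated keys, turns comparisons of counts into comparisons of paired deaths. More than
  \<open>card A\<close> elements of \<open>B\<close> die no earlier than an unpaired
  \<open>y\<close>, so \<open>ge\<close> at \<open>t = b\<close> bounds the death of
  \<open>y\<close>.\<close>

lemma pairing_by_death:
  fixes v :: "'a \<Rightarrow> ereal" and w :: "'b \<Rightarrow> ereal"
  assumes c: "0 < c" and A: "finite A" "\<And>a. a \<in> A \<Longrightarrow> ereal b < v a"
    and B: "finite B" "\<And>y. y \<in> B \<Longrightarrow> ereal b < w y"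
    and le: "\<And>t. b \<le> t \<Longrightarrow> card {a\<in>A. ereal t < v a} \<le> card {y\<in>B. ereal t < w y}"
    and ge: "\<And>t. b \<le> t \<Longrightarrow> card {y\<in>B. ereal (c * t) < w y} \<le> card {a\<in>A. ereal t < v a}"
  shows "\<exists>f. inj_on f A \<and> f ` A \<subseteq> B \<and> (\<forall>a\<in>A. v a \<le> w (f a) \<and> w (f a) \<le> ereal c * v a)
    \<and> (\<forall>y\<in>B - f ` A. w y \<le> ereal (c * b))"
proof -
  have "{a\<in>A. ereal b < v a} = A" "{y\<in>B. ereal b < w y} = B" using A B by auto
  then have cAB: "card A \<le> card B" using le[of b] by simp
  obtain f where f: "inj_on f A" "f ` A \<subseteq> B"
    "\<forall>a\<in>A. card {x\<in>A. - v x < - v a} < card {y\<in>B. - w y \<le> - w (f a)}"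
    "\<forall>a\<in>A. card {y\<in>B. - w y < - w (f a)} < card {x\<in>A. - v x \<le> - v a}"
    "\<forall>y\<in>B - f ` A. card A < card {z\<in>B. - w z \<le> - w y}"
    by (rule sorted_pairing[OF A(1) B(1) cAB, of "\<lambda>a. - v a" "\<lambda>y. - w y"])
  have f3: "card {x\<in>A. v a < v x} < card {y\<in>B. w (f a) \<le> w y}" if "a \<in> A" for a
    using f(3)[rule_format, OF that] by simp
  have f4: "card {y\<in>B. w (f a) < w y} < card {x\<in>A. v a \<le> v x}" if "a \<in> A" for a
    using f(4)[rule_format, OF that] by simp
  have f5: "card A < card {z\<in>B. w y \<le> w z}" if "y \<in> B - f ` A" for y
    using f(5)[rule_format, OF that] by simp
  have 1: "v a \<le> w (f a)" if a: "a \<in> A" for a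
  proof (rule ccontr)
    assume "\<not> v a \<le> w (f a)"
    then have less: "w (f a) < v a" by simp
    have fa: "f a \<in> B" using f(2) a by blast
    obtain t where t: "w (f a) = ereal t" "b < t"
      using less B(2)[OF fa] by (cases "w (f a)") auto
    have "card {x\<in>A. v a \<le> v x} \<le> card {x\<in>A. ereal t < v x}"
      using less A(1) t(1) by (intro card_mono) (auto intro: less_le_trans)
    also have "\<dots> \<le> card {y\<in>B. ereal t < w y}" using t(2) by (intro le) simp
    finally show False using f4[OF a] t(1) by simp
  qed
  have 2: "w (f a) \<le> ereal c * v a" if a: "a \<in> A" for a
  proof (cases "v a")
    case (real t)
    then have t: "b < t" using A(2)[OF a] by simp
    show ?thesis
    proof (rule ccontr)
      assume "\<not> w (f a) \<le> ereal c * v a"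
      then have less: "ereal (c * t) < w (f a)" using real by simp
      have "card {y\<in>B. w (f a) \<le> w y} \<le> card {y\<in>B. ereal (c * t) < w y}"
        using less B(1) by (intro card_mono) (auto intro: less_le_trans)
      also have "\<dots> \<le> card {x\<in>A. ereal t < v x}" using t by (intro ge) simp
      finally show False using f3[OF a] real by simp
    qed
  next
    case PInf
    then show ?thesis using c by simp
  qed (use A(2)[OF a] in auto)
  have 3: "w y \<le> ereal (c * b)" if y: "y \<in> B - f ` A" for y
  proof (rule ccontr)
    assume "\<not> w y \<le> ereal (c * b)"
    then have less: "ereal (c * b) < w y" by simp
    have "card {z\<in>B. w y \<le> w z} \<le> card {z\<in>B. ereal (c * b) < w z}"
      using less B(1) by (intro card_mono) (auto intro: less_le_trans)
    also have "\<dots> \<le> card {x\<in>A. ereal b < v x}" by (intro ge) simp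
    also have "\<dots> \<le> card A" using A(1) by (intro card_mono) auto
    finally show False using f5[OF y] by simp
  qed
  show ?thesis using f(1,2) 1 2 3 by blast
qed

text \<open>The dual pairing of bars with common death \<open>d\<close>, by increasing birth. Counts
  can be compared only before \<open>d\<close>, so an unpaired \<open>y\<close> has to be born so
  late that \<open>c * w y\<close> reaches \<open>d\<close>.\<close>

lemma pairing_by_birth:
  fixes v :: "'a \<Rightarrow> real" and w :: "'b \<Rightarrow> real" and d :: ereal
  assumes A: "finite A" "\<And>a. a \<in> A \<Longrightarrow> 0 \<le> v a \<and> ereal (v a) < d"
    and B: "finite B" "\<And>y. y \<in> B \<Longrightarrow> 0 \<le> w y"
    and le: "\<And>s. 0 \<le> s \<Longrightarrow> ereal s < d \<Longrightarrow> card {a\<in>A. v a \<le> s} \<le> card {y\<in>B. w y \<le> s}"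
    and ge: "\<And>s. 0 \<le> s \<Longrightarrow> ereal (c * s) < d \<Longrightarrow> card {y\<in>B. w y \<le> s} \<le> card {a\<in>A. v a \<le> c * s}"
  shows "\<exists>f. inj_on f A \<and> f ` A \<subseteq> B \<and> (\<forall>a\<in>A. w (f a) \<le> v a \<and> v a \<le> c * w (f a))
    \<and> (\<forall>y\<in>B - f ` A. d \<le> ereal (c * w y))"
proof -
  have cAB: "card A \<le> card B"
  proof (cases "A = {}")
    case False
    \<comment> \<open>The latest birth in \<open>A\<close> lies before \<open>d\<close>, and
      comparing counts there captures all of \<open>A\<close>.\<close>
    define s where "s = Max (v ` A)"
    have "s \<in> v ` A" unfolding s_def using A(1) False by (intro Max_in) auto
    then have s: "0 \<le> s" "ereal s < d" using A(2) by auto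
    have "v a \<le> s" if "a \<in> A" for a unfolding s_def using A(1) that by (intro Max_ge) auto
    then have "A = {a\<in>A. v a \<le> s}" by auto
    then have "card A \<le> card {y\<in>B. w y \<le> s}" using le[OF s] by simp
    also have "\<dots> \<le> card B" using B(1) by (intro card_mono) auto
    finally show ?thesis .
  qed simp
  obtain f where f: "inj_on f A" "f ` A \<subseteq> B"
    "\<forall>a\<in>A. card {x\<in>A. v x < v a} < card {y\<in>B. w y \<le> w (f a)}"
    "\<forall>a\<in>A. card {y\<in>B. w y < w (f a)} < card {x\<in>A. v x \<le> v a}"
    "\<forall>y\<in>B - f ` A. card A < card {z\<in>B. w z \<le> w y}"
    by (rule sorted_pairing[OF A(1) B(1) cAB, of v w])
  have 1: "w (f a) \<le> v a" if a: "a \<in> A" for a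
  proof (rule ccontr)
    assume less: "\<not> w (f a) \<le> v a"
    have "card {x\<in>A. v x \<le> v a} \<le> card {y\<in>B. w y \<le> v a}" using A(2)[OF a] by (intro le) auto
    also have "\<dots> \<le> card {y\<in>B. w y < w (f a)}" using less B(1) by (intro card_mono) auto
    finally show False using f(4)[rule_format, OF a] by simp
  qed
  have 2: "v a \<le> c * w (f a)" if a: "a \<in> A" for a
  proof (rule ccontr)
    assume less: "\<not> v a \<le> c * w (f a)"
    have "ereal (c * w (f a)) < d" using less A(2)[OF a] by (auto intro: less_trans[of _ "ereal (v a)"])
    moreover have "0 \<le> w (f a)" using B(2) f(2) a by blast
    ultimately have "card {y\<in>B. w y \<le> w (f a)} \<le> card {x\<in>A. v x \<le> c * w (f a)}" by (intro ge)
    also have "\<dots> \<le> card {x\<in>A. v x < v a}" using less A(1) by (intro card_mono) auto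
    finally show False using f(3)[rule_format, OF a] by simp
  qed
  have 3: "d \<le> ereal (c * w y)" if y: "y \<in> B - f ` A" for y
  proof (rule ccontr)
    assume "\<not> d \<le> ereal (c * w y)"
    then have "ereal (c * w y) < d" by simp
    moreover have "0 \<le> w y" using B(2) y by blast
    ultimately have "card {z\<in>B. w z \<le> w y} \<le> card {x\<in>A. v x \<le> c * w y}" by (intro ge)
    also have "\<dots> \<le> card A" using A(1) by (intro card_mono) auto
    finally show False using f(5)[rule_format, OF y] by simp
  qed
  show ?thesis using f(1,2) 1 2 3 by blast
qed

text \<open>In terms of bars: the number born by \<open>s\<close> that die exactly at
  \<open>d\<close>. Bars that never die are read off past the last jump.\<close>

definition death_jump :: "real set \<Rightarrow> (real \<Rightarrow> real \<Rightarrow> int) \<Rightarrow> ereal \<Rightarrow> real \<Rightarrow> int" where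
  "death_jump T r d s = (if d = \<infinity> then r s (Max (insert 0 T))
     else r s (prv T (real_of_ereal d)) - r s (real_of_ereal d))"

definition rank_mult :: "real set \<Rightarrow> (real \<Rightarrow> real \<Rightarrow> int) \<Rightarrow> real \<Rightarrow> ereal \<Rightarrow> int" where
  "rank_mult T r b d = death_jump T r d b - death_jump T r d (prv T b)"

definition rank_dgm :: "real set \<Rightarrow> (real \<Rightarrow> real \<Rightarrow> int) \<Rightarrow> ereal \<times> ereal \<Rightarrow> nat" where
  "rank_dgm T r p = (if \<exists>b. fst p = ereal b \<and> ereal b < snd p
     then nat (rank_mult T r (real_of_ereal (fst p)) (snd p)) else 0)"

abbreviation birth :: "(ereal \<times> ereal) \<times> nat \<Rightarrow> ereal" where "birth x \<equiv> fst (fst x)"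
abbreviation death :: "(ereal \<times> ereal) \<times> nat \<Rightarrow> ereal" where "death x \<equiv> snd (fst x)"

lemma card_points:
  assumes "finite Q"
  shows "card {x\<in>points D. fst x \<in> Q} = (\<Sum>p\<in>Q. D p)"
proof -
  have "{x\<in>points D. fst x \<in> Q} = (SIGMA p:Q. {..<D p})" by (auto simp: points_def)
  then show ?thesis using assms by simp
qed

text \<open>\<open>r s t\<close> stands for the number of bars born by \<open>s\<close> and alive at
  \<open>t\<close>. Then \<open>mono\<close> and \<open>mixed\<close> are the non-negativity of the
  number of bars born between \<open>b'\<close> and \<open>b\<close> that are alive at
  \<open>t\<close>, respectively die between \<open>d'\<close> and \<open>d\<close>.\<close>

locale rank_function =
  fixes T :: "real set" and r :: "real \<Rightarrow> real \<Rightarrow> int"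
  assumes finite_T: "finite T" and T_nonneg: "\<And>x. x \<in> T \<Longrightarrow> 0 \<le> x"
    and steps_birth: "\<And>t. steps T (\<lambda>s. r s t)" and steps_death: "\<And>s. steps T (r s)"
    and mono: "\<And>b' b t. b' \<le> b \<Longrightarrow> b \<le> t \<Longrightarrow> r b' t \<le> r b t"
    and mixed: "\<And>b' b d' d. b' \<le> b \<Longrightarrow> b \<le> d' \<Longrightarrow> d' \<le> d \<Longrightarrow> r b' d' - r b' d \<le> r b d' - r b d"
    and negative: "\<And>s t. s < 0 \<Longrightarrow> r s t = 0"
begin

abbreviation "D \<equiv> rank_dgm T r"

text \<open>Any such \<open>t\<close> computes the left limit at \<open>d\<close>. The freedom
  matters because rank inequalities require ordered indices, while \<open>prv T d\<close> may
  precede the birth in question; \<open>t\<close> is then the maximum of the two.\<close>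

lemma death_jump_real:
  assumes "prv T d \<le> t" "t < d"
  shows "death_jump T r (ereal d) s = r s t - r s d"
proof -
  have "r s (prv T d) = r s t"
  proof (rule stepsD[OF steps_death assms(1)])
    fix z assume z: "z \<in> T" "prv T d < z" "z \<le> t"
    then show False using le_prv[OF finite_T z(1), of d] assms(2) by simp
  qed
  then show ?thesis by (simp add: death_jump_def)
qed

lemma top_const:
  assumes "Max (insert 0 T) \<le> t"
  shows "r s (Max (insert 0 T)) = r s t"
proof (rule stepsD[OF steps_death assms])
  fix z assume z: "z \<in> T" "Max (insert 0 T) < z" "z \<le> t"
  have "z \<le> Max (insert 0 T)" using finite_T z(1) by (intro Max_ge) auto
  then show False using z(2) by simp
qed

lemma death_jump_infinity:
  "Max (insert 0 T) \<le> t \<Longrightarrow> death_jump T r \<infinity> s = r s t"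
  using top_const by (simp add: death_jump_def)

lemma steps_death_jump: "steps T (death_jump T r d)"
  using steps_birth unfolding steps_def death_jump_def by (metis (full_types))

lemma rank_mult_birth: "b \<notin> T \<Longrightarrow> rank_mult T r b d = 0"
  using steps_prv[OF finite_T steps_death_jump] by (simp add: rank_mult_def)

lemma death_jump_notin: "d \<notin> T \<Longrightarrow> death_jump T r (ereal d) s = 0"
  using steps_prv[OF finite_T steps_death] by (simp add: death_jump_def)

lemma rank_mult_nonneg:
  assumes "ereal b < d"
  shows "0 \<le> rank_mult T r b d"
proof (cases d)
  case (real d')
  define t where "t = max b (prv T d')"
  have t: "prv T d' \<le> t" "t < d'" "b \<le> t"
    using assms real prv(1)[OF finite_T, of d'] by (auto simp: t_def)
  show ?thesis
    unfolding rank_mult_def real death_jump_real[OF t(1,2)]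
    using mixed[of "prv T b" b t d'] t prv(1)[OF finite_T, of b] by simp
next
  case PInf
  define t where "t = max b (Max (insert 0 T))"
  have t: "Max (insert 0 T) \<le> t" "b \<le> t" by (auto simp: t_def)
  show ?thesis
    unfolding rank_mult_def PInf death_jump_infinity[OF t(1)]
    using mono[of "prv T b" b t] t prv(1)[OF finite_T, of b] by simp
qed (use assms in auto)

lemma int_D: "ereal b < d \<Longrightarrow> int (D (ereal b, d)) = rank_mult T r b d"
  using rank_mult_nonneg by (simp add: rank_dgm_def)

lemma D_support:
  assumes "0 < D p"
  obtains b where "fst p = ereal b" "b \<in> T" "0 \<le> b" "ereal b < snd p" "snd p = \<infinity> \<or> snd p \<in> ereal ` T"
proof -
  have "\<exists>b. fst p = ereal b \<and> ereal b < snd p"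
    using assms unfolding rank_dgm_def by (rule_tac ccontr) simp
  then obtain b where b: "fst p = ereal b" "ereal b < snd p" by blast
  then have m: "rank_mult T r b (snd p) \<noteq> 0" using assms by (auto simp: rank_dgm_def)
  then have "b \<in> T" using rank_mult_birth by blast
  moreover have "snd p = \<infinity> \<or> snd p \<in> ereal ` T"
  proof (cases "snd p")
    case (real d)
    have "d \<in> T"
    proof (rule ccontr)
      assume "d \<notin> T"
      then show False using m real by (simp add: rank_mult_def death_jump_notin)
    qed
    then show ?thesis using real by simp
  qed (use b in auto)
  ultimately show thesis using that b T_nonneg by blast
qed

lemma point_cases:
  assumes "x \<in> points D"
  obtains b where "birth x = ereal b" "b \<in> T" "0 \<le> b" "ereal b < death x" "death x = \<infinity> \<or> death x \<in> ereal ` T"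
proof -
  have "0 < D (fst x)" using assms by (auto simp: points_def)
  then show thesis using D_support that by blast
qed

lemma finite_points: "finite (points D)"
proof (rule finite_subset)
  show "points D \<subseteq> (SIGMA p:(ereal ` T \<times> insert \<infinity> (ereal ` T)). {..<D p})"
  proof
    fix x assume x: "x \<in> points D"
    then obtain b where "birth x = ereal b" "b \<in> T" "death x = \<infinity> \<or> death x \<in> ereal ` T"
      by (rule point_cases)
    then have "fst x \<in> ereal ` T \<times> insert \<infinity> (ereal ` T)" by (cases "fst x") auto
    then show "x \<in> (SIGMA p:(ereal ` T \<times> insert \<infinity> (ereal ` T)). {..<D p})"
      using x by (cases x) (auto simp: points_def)
  qed
  show "finite (SIGMA p:(ereal ` T \<times> insert \<infinity> (ereal ` T)). {..<D p})"
    using finite_T by auto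
qed

text \<open>The multiplicities over all deaths after \<open>t\<close> telescope; the infinite bars
  cancel the contribution of the upper end.\<close>

lemma count_death:
  assumes "b \<le> t"
  shows "int (card {x\<in>points D. birth x = ereal b \<and> ereal t < death x}) = r b t - r (prv T b) t"
proof (cases "b \<in> T")
  case False
  then have "{x\<in>points D. birth x = ereal b \<and> ereal t < death x} = {}"
    by (auto elim!: point_cases)
  moreover have "r (prv T b) t = r b t" using steps_prv[OF finite_T steps_birth False] .
  ultimately show ?thesis by (simp only: card.empty)
next
  case True
  define \<alpha> where "\<alpha> t = r b t - r (prv T b) t" for t
  let ?X = "{x\<in>T. t < x}"
  let ?E = "insert \<infinity> (ereal ` ?X)"
  let ?Q = "{ereal b} \<times> ?E"
  have finQ: "finite ?Q" using finite_T by simp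
  have "{x\<in>points D. birth x = ereal b \<and> ereal t < death x} = {x\<in>points D. fst x \<in> ?Q}"
  proof (intro Collect_cong conj_cong refl)
    fix x assume "x \<in> points D"
    then have "death x = \<infinity> \<or> death x \<in> ereal ` T" by (rule point_cases)
    then show "(birth x = ereal b \<and> ereal t < death x) = (fst x \<in> ?Q)"
      by (cases "fst x") auto
  qed
  then have "int (card {x\<in>points D. birth x = ereal b \<and> ereal t < death x}) = int (\<Sum>p\<in>?Q. D p)"
    by (simp only: card_points[OF finQ])
  also have "(\<Sum>p\<in>?Q. D p) = (\<Sum>d\<in>?E. D (ereal b, d))"
    unfolding sum.cartesian_product' by simp
  also have "int \<dots> = (\<Sum>d\<in>?E. rank_mult T r b d)"
    unfolding of_nat_sum using assms by (intro sum.cong refl int_D) auto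
  also have "\<dots> = rank_mult T r b \<infinity> + (\<Sum>x\<in>?X. rank_mult T r b (ereal x))"
    using finite_T by (subst sum.insert) (auto simp: sum.reindex inj_on_def)
  also have "(\<Sum>x\<in>?X. rank_mult T r b (ereal x)) = (\<Sum>x\<in>?X. - \<alpha> x - - \<alpha> (prv T x))"
    by (intro sum.cong refl) (simp add: rank_mult_def death_jump_def \<alpha>_def)
  also have "?X = {x\<in>T. t < x \<and> x \<le> max t (Max (insert 0 T))}"
  proof (intro Collect_cong conj_cong refl)
    fix x assume "x \<in> T"
    then have "x \<le> Max (insert 0 T)" using finite_T by (intro Max_ge) auto
    then show "(t < x) = (t < x \<and> x \<le> max t (Max (insert 0 T)))" by auto
  qed
  also have "(\<Sum>x\<in>\<dots>. - \<alpha> x - - \<alpha> (prv T x)) = - \<alpha> (max t (Max (insert 0 T))) - - \<alpha> t"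
  proof (rule steps_telescope[OF finite_T])
    show "steps T (\<lambda>x. - \<alpha> x)"
      using steps_death unfolding \<alpha>_def steps_def by (metis (full_types))
  qed simp
  also have "rank_mult T r b \<infinity> = \<alpha> (max t (Max (insert 0 T)))"
    using death_jump_infinity[of "max t (Max (insert 0 T))"] by (simp add: rank_mult_def \<alpha>_def)
  finally show ?thesis by (simp add: \<alpha>_def)
qed

text \<open>Dual telescoping over births, started at a negative time, where the rank
  vanishes.\<close>

lemma count_birth:
  assumes "ereal s < d"
  shows "int (card {x\<in>points D. death x = d \<and> birth x \<le> ereal s}) = death_jump T r d s"
proof (cases "d = \<infinity> \<or> d \<in> ereal ` T")
  case False
  then have "{x\<in>points D. death x = d \<and> birth x \<le> ereal s} = {}"
    by (auto elim!: point_cases)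
  moreover have "death_jump T r d s = 0"
    using False assms by (cases d) (auto intro: death_jump_notin)
  ultimately show ?thesis by (simp only: card.empty)
next
  case True
  let ?X = "{x\<in>T. x \<le> s}"
  let ?Q = "ereal ` ?X \<times> {d}"
  have finQ: "finite ?Q" using finite_T by simp
  have "{x\<in>points D. death x = d \<and> birth x \<le> ereal s} = {x\<in>points D. fst x \<in> ?Q}"
  proof (intro Collect_cong conj_cong refl)
    fix x assume "x \<in> points D"
    then obtain b where "birth x = ereal b" "b \<in> T" by (rule point_cases)
    then show "(death x = d \<and> birth x \<le> ereal s) = (fst x \<in> ?Q)"
      by (cases "fst x") auto
  qed
  then have "int (card {x\<in>points D. death x = d \<and> birth x \<le> ereal s}) = int (\<Sum>p\<in>?Q. D p)"
    by (simp only: card_points[OF finQ])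
  also have "(\<Sum>p\<in>?Q. D p) = (\<Sum>x\<in>?X. D (ereal x, d))"
    unfolding sum.cartesian_product' by (simp add: sum.reindex inj_on_def)
  also have "int \<dots> = (\<Sum>x\<in>?X. rank_mult T r x d)"
    unfolding of_nat_sum using assms by (intro sum.cong refl int_D) (auto intro: le_less_trans[of _ "ereal s"])
  also have "\<dots> = (\<Sum>x\<in>?X. death_jump T r d x - death_jump T r d (prv T x))"
    by (simp only: rank_mult_def)
  also have "?X = {x\<in>T. min s (-1) < x \<and> x \<le> s}"
  proof (intro Collect_cong conj_cong refl)
    fix x assume "x \<in> T"
    then show "(x \<le> s) = (min s (-1) < x \<and> x \<le> s)" using T_nonneg[of x] by auto
  qed
  also have "(\<Sum>x\<in>\<dots>. death_jump T r d x - death_jump T r d (prv T x)) = death_jump T r d s - death_jump T r d (min s (-1))"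
    by (rule steps_telescope[OF finite_T steps_death_jump]) simp
  also have "death_jump T r d (min s (-1)) = 0"
    by (simp add: death_jump_def negative)
  finally show ?thesis by simp
qed

end

text \<open>\<open>rM\<close> is for Delaunay-Rips, \<open>rN\<close> for Rips and \<open>rI\<close>
  for the image. \<open>MI\<close> and \<open>IM\<close> compare the bars of given birth and yield
  an injection \<open>f\<close> from the bars of \<open>rI\<close> into those of \<open>rM\<close>
  that keeps births; the other four compare the bars of given death and yield \<open>g\<close> into
  those of \<open>rN\<close> that keeps deaths. The matching is \<open>g\<close> after the inverse
  of \<open>f\<close>.\<close>

lemma rank_matching:
  assumes rfM: "rank_function T rM" and rfI: "rank_function T rI" and rfN: "rank_function T rN"
    and c: "1 \<le> c"
    and MI: "\<And>b' b t. b' \<le> b \<Longrightarrow> b \<le> t \<Longrightarrow> rI b t - rI b' t \<le> rM b t - rM b' t"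
    and IM: "\<And>b' b t. b' \<le> b \<Longrightarrow> 0 \<le> b \<Longrightarrow> b \<le> t \<Longrightarrow> rM b (c * t) - rM b' (c * t) \<le> rI b t - rI b' t"
    and IN: "\<And>s d' d. s \<le> d' \<Longrightarrow> d' \<le> d \<Longrightarrow> rI s d' - rI s d \<le> rN s d' - rN s d"
    and IN_inf: "\<And>s t. s \<le> t \<Longrightarrow> rI s t \<le> rN s t"
    and NI: "\<And>s d' d. 0 \<le> s \<Longrightarrow> c * s \<le> d' \<Longrightarrow> d' \<le> d \<Longrightarrow> rN s d' - rN s d \<le> rI (c * s) d' - rI (c * s) d"
    and NI_inf: "\<And>s t. 0 \<le> s \<Longrightarrow> c * s \<le> t \<Longrightarrow> rN s t \<le> rI (c * s) t"
  obtains P h where "P \<subseteq> points (rank_dgm T rM)" "inj_on h P" "h ` P \<subseteq> points (rank_dgm T rN)"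
    "\<forall>x\<in>P. birth (h x) \<le> birth x \<and> birth x \<le> ereal c * birth (h x) \<and>
       death (h x) \<le> death x \<and> death x \<le> ereal c * death (h x)"
    "\<forall>x\<in>points (rank_dgm T rM) - P. death x \<le> ereal c * birth x"
    "\<forall>x\<in>points (rank_dgm T rN) - h ` P. death x \<le> ereal c * birth x"
proof -
  interpret M: rank_function T rM by (rule rfM)
  interpret I: rank_function T rI by (rule rfI)
  interpret N: rank_function T rN by (rule rfN)
  let ?SM = "points M.D" and ?SI = "points I.D" and ?SN = "points N.D"
  have fin: "finite ?SM" "finite ?SI" "finite ?SN"
    by (rule M.finite_points I.finite_points N.finite_points)+
  have c0: "0 < c" using c by simp
  have c_mono: "t \<le> c * t" if "0 \<le> t" for t
    using mult_right_mono[OF c that] by simp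
  let ?AI = "\<lambda>b. {x\<in>?SI. birth x = ereal b}" and ?AM = "\<lambda>b. {x\<in>?SM. birth x = ereal b}"
  define same_birth where "same_birth b f \<longleftrightarrow> inj_on f (?AI b) \<and> f ` ?AI b \<subseteq> ?AM b
      \<and> (\<forall>a\<in>?AI b. death a \<le> death (f a) \<and> death (f a) \<le> ereal c * death a)
      \<and> (\<forall>y\<in>?AM b - f ` ?AI b. death y \<le> ereal (c * b))" for b f
  have ex_birth: "\<exists>f. same_birth b f" if b: "b \<in> T" for b
    unfolding same_birth_def
  proof (rule pairing_by_death[OF c0])
    have b0: "0 \<le> b" by (rule I.T_nonneg[OF b])
    have pb: "prv T b \<le> b" using prv(1)[OF I.finite_T, of b] by simp
    show "finite (?AI b)" "finite (?AM b)" using fin by auto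
    show "ereal b < death a" if "a \<in> ?AI b" for a
      using that by (auto elim: I.point_cases)
    show "ereal b < death a" if "a \<in> ?AM b" for a
      using that by (auto elim: M.point_cases)
    fix t assume t: "b \<le> t"
    have sets: "{a\<in>?AI b. ereal t < death a} = {x\<in>?SI. birth x = ereal b \<and> ereal t < death x}"
      "{a\<in>?AM b. ereal u < death a} = {x\<in>?SM. birth x = ereal b \<and> ereal u < death x}" for u
      by auto
    have "int (card {a\<in>?AI b. ereal t < death a}) \<le> int (card {y\<in>?AM b. ereal t < death y})"
      unfolding sets I.count_death[OF t] M.count_death[OF t] by (rule MI[OF pb t])
    then show "card {a\<in>?AI b. ereal t < death a} \<le> card {y\<in>?AM b. ereal t < death y}" by simp
    have ct: "b \<le> c * t" using c_mono[of t] b0 t by simp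
    have "int (card {y\<in>?AM b. ereal (c * t) < death y}) \<le> int (card {a\<in>?AI b. ereal t < death a})"
      unfolding sets I.count_death[OF t] M.count_death[OF ct] by (rule IM[OF pb b0 t])
    then show "card {y\<in>?AM b. ereal (c * t) < death y} \<le> card {a\<in>?AI b. ereal t < death a}" by simp
  qed
  have "\<forall>b\<in>T. \<exists>f. same_birth b f" by (rule ballI) (rule ex_birth)
  from bchoice[OF this] obtain F where "\<forall>b\<in>T. same_birth b (F b)" by (elim exE)
  note F = this[rule_format, unfolded same_birth_def]
  define f where "f x = F (real_of_ereal (birth x)) x" for x
  have f: "f x \<in> ?SM \<and> birth (f x) = birth x \<and> death x \<le> death (f x) \<and> death (f x) \<le> ereal c * death x"
    if xI: "x \<in> ?SI" for x
  proof -
    obtain b where b: "birth x = ereal b" "b \<in> T" using I.point_cases[OF xI] by metis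
    then have x: "x \<in> ?AI b" using xI by simp
    have fx: "f x = F b x" using b by (simp add: f_def)
    have "F b x \<in> ?AM b" using F[OF b(2)] x by (meson image_subset_iff)
    moreover have "death x \<le> death (F b x) \<and> death (F b x) \<le> ereal c * death x"
      using F[OF b(2)] x by meson
    ultimately show ?thesis unfolding fx using b by simp
  qed
  have f_inj: "inj_on f ?SI"
  proof (rule inj_onI)
    fix x y assume xy: "x \<in> ?SI" "y \<in> ?SI" "f x = f y"
    obtain b where b: "birth x = ereal b" "b \<in> T" using I.point_cases[OF xy(1)] by metis
    have "birth x = birth y" using f[OF xy(1)] f[OF xy(2)] xy(3) by metis
    then have by': "birth y = ereal b" using b(1) by simp
    have eq: "F b x = F b y" using xy(3) by (simp add: f_def b(1) by')
    have mem: "x \<in> ?AI b" "y \<in> ?AI b" using xy(1,2) b(1) by' by simp_all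
    show "x = y" by (rule inj_onD[OF conjunct1[OF F[OF b(2)]] eq mem])
  qed
  have f_left: "death y \<le> ereal c * birth y" if y: "y \<in> ?SM - f ` ?SI" for y
  proof -
    have yM: "y \<in> ?SM" using y by simp
    obtain b where b: "birth y = ereal b" "b \<in> T" using M.point_cases[OF yM] by metis
    have "y \<notin> F b ` ?AI b"
    proof
      assume "y \<in> F b ` ?AI b"
      then obtain x where x: "x \<in> ?AI b" "y = F b x" by blast
      then have "y = f x" by (simp add: f_def)
      then show False using x(1) y by blast
    qed
    then have "y \<in> ?AM b - F b ` ?AI b" using yM b by simp
    then have "death y \<le> ereal (c * b)"
      by (rule F[OF b(2), THEN conjunct2, THEN conjunct2, THEN conjunct2, THEN bspec])
    then show ?thesis using b by simp
  qed
  let ?DT = "insert \<infinity> (ereal ` T)"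
  let ?BI = "\<lambda>d. {x\<in>?SI. death x = d}" and ?BN = "\<lambda>d. {x\<in>?SN. death x = d}"
  let ?rb = "\<lambda>x. real_of_ereal (birth x)"
  define same_death where "same_death d g \<longleftrightarrow> inj_on g (?BI d) \<and> g ` ?BI d \<subseteq> ?BN d
      \<and> (\<forall>a\<in>?BI d. ?rb (g a) \<le> ?rb a \<and> ?rb a \<le> c * ?rb (g a))
      \<and> (\<forall>y\<in>?BN d - g ` ?BI d. d \<le> ereal (c * ?rb y))" for d g
  have ex_death: "\<exists>g. same_death d g" if d: "d \<in> ?DT" for d
    unfolding same_death_def
  proof (rule pairing_by_birth)
    show "finite (?BI d)" "finite (?BN d)" using fin by auto
    show "0 \<le> ?rb a \<and> ereal (?rb a) < d" if "a \<in> ?BI d" for a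
      using that by (auto elim: I.point_cases)
    show "0 \<le> ?rb a" if "a \<in> ?BN d" for a
      using that by (auto elim: N.point_cases)
    fix s :: real assume s: "0 \<le> s"
    have rbI: "(?rb x \<le> u) = (birth x \<le> ereal u)" if "x \<in> ?SI" for x u
      using I.point_cases[OF that] by (metis ereal_less_eq(3) real_of_ereal.simps(1))
    have rbN: "(?rb x \<le> u) = (birth x \<le> ereal u)" if "x \<in> ?SN" for x u
      using N.point_cases[OF that] by (metis ereal_less_eq(3) real_of_ereal.simps(1))
    have setI: "{a\<in>?BI d. ?rb a \<le> u} = {x\<in>?SI. death x = d \<and> birth x \<le> ereal u}" for u
      using rbI by auto
    have setN: "{a\<in>?BN d. ?rb a \<le> u} = {x\<in>?SN. death x = d \<and> birth x \<le> ereal u}" for u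
      using rbN by auto
    {
      assume sd: "ereal s < d"
      have "death_jump T rI d s \<le> death_jump T rN d s"
      proof (cases d)
        case (real d')
        define t where "t = max s (prv T d')"
        have t: "prv T d' \<le> t" "t < d'" "s \<le> t"
          using sd real prv(1)[OF I.finite_T, of d'] by (auto simp: t_def)
        show ?thesis
          unfolding real I.death_jump_real[OF t(1,2)] N.death_jump_real[OF t(1,2)]
          using IN[OF t(3)] t(2) by simp
      next
        case PInf
        define t where "t = max s (Max (insert 0 T))"
        have t: "Max (insert 0 T) \<le> t" "s \<le> t" by (auto simp: t_def)
        show ?thesis
          unfolding PInf I.death_jump_infinity[OF t(1)] N.death_jump_infinity[OF t(1)]
          by (rule IN_inf[OF t(2)])
      qed (use sd in auto)
      then have "int (card {a\<in>?BI d. ?rb a \<le> s}) \<le> int (card {y\<in>?BN d. ?rb y \<le> s})"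
        unfolding setI setN I.count_birth[OF sd] N.count_birth[OF sd] .
      then show "card {a\<in>?BI d. ?rb a \<le> s} \<le> card {y\<in>?BN d. ?rb y \<le> s}" by simp
    }
    {
      assume csd: "ereal (c * s) < d"
      have sd: "ereal s < d"
        using c_mono[OF s] csd by (intro le_less_trans[OF _ csd]) simp
      have "death_jump T rN d s \<le> death_jump T rI d (c * s)"
      proof (cases d)
        case (real d')
        define t where "t = max (c * s) (prv T d')"
        have t: "prv T d' \<le> t" "t < d'" "c * s \<le> t"
          using csd real prv(1)[OF I.finite_T, of d'] by (auto simp: t_def)
        show ?thesis
          unfolding real I.death_jump_real[OF t(1,2)] N.death_jump_real[OF t(1,2)]
          using NI[OF s t(3)] t(2) by simp
      next
        case PInf
        define t where "t = max (c * s) (Max (insert 0 T))"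
        have t: "Max (insert 0 T) \<le> t" "c * s \<le> t" by (auto simp: t_def)
        show ?thesis
          unfolding PInf I.death_jump_infinity[OF t(1)] N.death_jump_infinity[OF t(1)]
          by (rule NI_inf[OF s t(2)])
      qed (use sd in auto)
      then have "int (card {y\<in>?BN d. ?rb y \<le> s}) \<le> int (card {a\<in>?BI d. ?rb a \<le> c * s})"
        unfolding setI setN I.count_birth[OF csd] N.count_birth[OF sd] .
      then show "card {y\<in>?BN d. ?rb y \<le> s} \<le> card {a\<in>?BI d. ?rb a \<le> c * s}" by simp
    }
  qed
  have "\<forall>d\<in>?DT. \<exists>g. same_death d g" by (rule ballI) (rule ex_death)
  from bchoice[OF this] obtain G where "\<forall>d\<in>?DT. same_death d (G d)" by (elim exE)
  note G = this[rule_format, unfolded same_death_def]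
  define g where "g x = G (death x) x" for x
  have deathI: "death x \<in> ?DT" if "x \<in> ?SI" for x using I.point_cases[OF that] by blast
  have deathN: "death x \<in> ?DT" if "x \<in> ?SN" for x using N.point_cases[OF that] by blast
  have g: "g x \<in> ?SN \<and> death (g x) = death x \<and> birth (g x) \<le> birth x \<and> birth x \<le> ereal c * birth (g x)"
    if xI: "x \<in> ?SI" for x
  proof -
    have x: "x \<in> ?BI (death x)" using xI by simp
    have gx: "g x \<in> ?BN (death x)"
      unfolding g_def using G[OF deathI[OF xI]] x by (meson image_subset_iff)
    then have gN: "g x \<in> ?SN" by simp
    have le: "?rb (g x) \<le> ?rb x \<and> ?rb x \<le> c * ?rb (g x)"
      unfolding g_def using G[OF deathI[OF xI]] x by meson
    obtain b where b: "birth x = ereal b" using I.point_cases[OF xI] by metis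
    obtain b' where b': "birth (g x) = ereal b'" using N.point_cases[OF gN] by metis
    show ?thesis using gx le b b' by simp
  qed
  have g_inj: "inj_on g ?SI"
  proof (rule inj_onI)
    fix x y assume xy: "x \<in> ?SI" "y \<in> ?SI" "g x = g y"
    have "death x = death y" using g[OF xy(1)] g[OF xy(2)] xy(3) by metis
    then have d: "death y = death x" by simp
    have eq: "G (death x) x = G (death x) y" using xy(3) by (simp add: g_def d)
    have mem: "x \<in> ?BI (death x)" "y \<in> ?BI (death x)" using xy(1,2) d by simp_all
    show "x = y" by (rule inj_onD[OF conjunct1[OF G[OF deathI[OF xy(1)]]] eq mem])
  qed
  have g_left: "death y \<le> ereal c * birth y" if y: "y \<in> ?SN - g ` ?SI" for y
  proof -
    have yN: "y \<in> ?SN" using y by simp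
    have "y \<notin> G (death y) ` ?BI (death y)"
    proof
      assume "y \<in> G (death y) ` ?BI (death y)"
      then obtain x where x: "x \<in> ?BI (death y)" "y = G (death y) x" by blast
      then have "y = g x" by (simp add: g_def)
      then show False using x(1) y by blast
    qed
    then have "y \<in> ?BN (death y) - G (death y) ` ?BI (death y)" using yN by simp
    then have le: "death y \<le> ereal (c * ?rb y)"
      by (rule G[OF deathN[OF yN], THEN conjunct2, THEN conjunct2, THEN conjunct2, THEN bspec])
    obtain b where "birth y = ereal b" using N.point_cases[OF yN] by metis
    then show ?thesis using le by simp
  qed
  define h where "h y = g (inv_into ?SI f y)" for y
  have h: "h (f x) = g x" if "x \<in> ?SI" for x
    using that f_inj by (simp add: h_def)
  show thesis
  proof (rule that[of "f ` ?SI" h])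
    show "f ` ?SI \<subseteq> ?SM" using f by blast
    show "inj_on h (f ` ?SI)"
      using g_inj h by (auto simp: inj_on_def)
    have hf: "h ` f ` ?SI = g ` ?SI" using h by (simp add: image_image)
    show "h ` f ` ?SI \<subseteq> ?SN" unfolding hf using g by blast
    show "\<forall>x\<in>f ` ?SI. birth (h x) \<le> birth x \<and> birth x \<le> ereal c * birth (h x) \<and>
       death (h x) \<le> death x \<and> death x \<le> ereal c * death (h x)"
      using f g h by simp
    show "\<forall>x\<in>?SM - f ` ?SI. death x \<le> ereal c * birth x" using f_left by blast
    show "\<forall>x\<in>?SN - h ` f ` ?SI. death x \<le> ereal c * birth x" unfolding hf using g_left by blast
  qed
qed

section \<open>Logarithmic coordinates\<close>

definition elog :: "ereal \<Rightarrow> ereal" where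
  "elog x = (if x = 0 then -\<infinity> else if x = \<infinity> then \<infinity> else ereal (ln (real_of_ereal x)))"

lemma eexp_elog: "0 \<le> x \<Longrightarrow> eexp (elog x) = x"
  by (cases x) (auto simp: elog_def eexp_def zero_ereal_def)

lemma elog_eexp: "elog (eexp x) = x"
  by (cases x) (auto simp: elog_def eexp_def zero_ereal_def)

text \<open>If \<open>y\<close> is 0 or infinite, the bounds force \<open>x = y\<close>, so infinite
  logarithms meet at cost 0; otherwise the cost is the logarithm of a ratio in
  \<open>[1, c]\<close>.\<close>

lemma cdist_elog:
  assumes "0 \<le> y" "y \<le> x" "x \<le> ereal c * y" and c: "1 \<le> c"
  shows "cdist (elog x) (elog y) \<le> ereal (ln c)"
proof (cases "x = y")
  case True
  then show ?thesis using c by (simp add: cdist_def)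
next
  case False
  have "y \<noteq> \<infinity>" using assms(2) False by auto
  moreover have "y \<noteq> 0" using assms False by (auto simp: zero_ereal_def[symmetric])
  ultimately obtain b where b: "y = ereal b" "0 < b" using assms(1) by (cases y) auto
  then obtain a where a: "x = ereal a" using assms(2,3) by (cases x) auto
  have ab: "b \<le> a" "a \<le> c * b" using assms(2,3) a b by auto
  have "ln a \<le> ln (c * b)" using ab b(2) by (intro ln_mono) auto
  also have "\<dots> = ln c + ln b" using b(2) c by (simp add: ln_mult)
  finally have "ln a - ln b \<le> ln c" by simp
  moreover have "ln b \<le> ln a" using ab b(2) by (intro ln_mono) auto
  moreover have "a \<noteq> 0" "b \<noteq> 0" using ab b by auto
  ultimately show ?thesis using c by (simp add: a b elog_def cdist_def)
qed

lemma cdist_sym: "cdist x y = cdist y x"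
  by (auto simp: cdist_def abs_minus_commute)

lemma pcost_le: "cdist (fst p) (fst q) \<le> e \<Longrightarrow> cdist (snd p) (snd q) \<le> e \<Longrightarrow> 0 \<le> e \<Longrightarrow> pcost p q \<le> e"
  by (simp add: pcost_def)

text \<open>\<open>L\<close> carries the points of a diagram to those of its logarithm and
  \<open>E\<close> carries them back; the partial matching is transported along both.\<close>

lemma bottleneck_log_le:
  fixes D1 D2 :: "ereal \<times> ereal \<Rightarrow> nat"
  assumes pos1: "\<And>p. 0 < D1 p \<Longrightarrow> 0 \<le> fst p \<and> fst p < snd p \<and> fst p \<noteq> \<infinity>"
    and pos2: "\<And>p. 0 < D2 p \<Longrightarrow> 0 \<le> fst p \<and> fst p < snd p \<and> fst p \<noteq> \<infinity>"
    and fin: "finite (points D1)" "finite (points D2)" and c: "1 \<le> c"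
    and P: "P \<subseteq> points D1" "inj_on h P" "h ` P \<subseteq> points D2"
    and cost: "\<forall>x\<in>P. birth (h x) \<le> birth x \<and> birth x \<le> ereal c * birth (h x) \<and>
       death (h x) \<le> death x \<and> death x \<le> ereal c * death (h x)"
    and left1: "\<forall>x\<in>points D1 - P. death x \<le> ereal c * birth x"
    and left2: "\<forall>x\<in>points D2 - h ` P. death x \<le> ereal c * birth x"
  shows "bottleneck (logdgm D1) (logdgm D2) \<le> ereal (ln c)"
proof -
  define L where "L x = ((elog (birth x), elog (death x)), snd x)" for x :: "(ereal \<times> ereal) \<times> nat"
  define E where "E x = ((eexp (birth x), eexp (death x)), snd x)" for x :: "(ereal \<times> ereal) \<times> nat"
  have LE: "L (E x) = x" for x by (cases x) (simp add: L_def E_def elog_eexp)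
  have pts: "0 \<le> birth x \<and> birth x < death x \<and> birth x \<noteq> \<infinity>" if "x \<in> points D1 \<or> x \<in> points D2" for x
    using that pos1[of "fst x"] pos2[of "fst x"] by (auto simp: points_def)
  have EL: "E (L x) = x" if "x \<in> points D1 \<or> x \<in> points D2" for x
  proof -
    have "0 \<le> birth x" "0 \<le> death x" using pts[OF that] by auto
    then show ?thesis by (simp add: L_def E_def eexp_elog)
  qed
  have Epts: "x \<in> points (logdgm D) \<longleftrightarrow> E x \<in> points D" for x D
    by (cases x) (auto simp: points_def logdgm_def E_def)
  have L_pts: "points (logdgm D) = L ` points D" if "\<And>x. x \<in> points D \<Longrightarrow> E (L x) = x" for D
  proof (intro equalityI subsetI)
    fix x assume "x \<in> points (logdgm D)"
    then have "E x \<in> points D" by (simp only: Epts)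
    then show "x \<in> L ` points D" by (rule image_eqI[rotated]) (simp only: LE)
  next
    fix x assume "x \<in> L ` points D"
    then obtain y where y: "y \<in> points D" "x = L y" by blast
    then show "x \<in> points (logdgm D)" using that[OF y(1)] by (simp only: Epts)
  qed
  have L_pts1: "points (logdgm D1) = L ` points D1" by (rule L_pts) (simp add: EL)
  have L_pts2: "points (logdgm D2) = L ` points D2" by (rule L_pts) (simp add: EL)
  have E_inj: "inj_on L (points D1 \<union> points D2)"
  proof (rule inj_onI)
    fix x y assume xy: "x \<in> points D1 \<union> points D2" "y \<in> points D1 \<union> points D2" "L x = L y"
    have "x = E (L x)" by (rule EL[symmetric]) (use xy(1) in simp)
    also have "\<dots> = E (L y)" by (simp only: xy(3))
    also have "\<dots> = y" by (rule EL) (use xy(2) in simp)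
    finally show "x = y" .
  qed
  have disj: "points (logdgm D) \<inter> diagonal = {}" if less: "\<And>p. 0 < D p \<Longrightarrow> fst p < snd p" for D
  proof -
    have "False" if xp: "x \<in> points (logdgm D)" and xd: "x \<in> diagonal" for x
    proof -
      obtain y i where x: "x = ((ereal y, ereal y), i)" using xd by (auto simp: diagonal_def)
      then have "0 < D (eexp (ereal y), eexp (ereal y))" using xp unfolding x
        by (simp add: points_def logdgm_def)
      from less[OF this] show False by simp
    qed
    then show ?thesis by blast
  qed
  \<comment> \<open>A short bar goes to the diagonal point at its own log birth. Its birth is not 0,
    since its death would then be at most 0.\<close>
  have diag: "\<exists>y. cdist (elog (birth x)) (ereal y) \<le> ereal (ln c) \<and> cdist (elog (death x)) (ereal y) \<le> ereal (ln c)"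
    if x: "x \<in> points D1 \<or> x \<in> points D2" and short: "death x \<le> ereal c * birth x" for x
  proof -
    obtain b where b: "birth x = ereal b" using pts[OF x] by (cases "birth x") auto
    have b0: "b \<noteq> 0"
    proof
      assume "b = 0"
      then have "death x \<le> 0" using short b by (simp add: zero_ereal_def)
      then show False using pts[OF x] by auto
    qed
    then have elog_b: "elog (birth x) = ereal (ln b)" using b by (simp add: elog_def)
    have "cdist (elog (death x)) (elog (birth x)) \<le> ereal (ln c)"
      using pts[OF x] short c by (intro cdist_elog) auto
    moreover have "cdist (elog (birth x)) (elog (birth x)) \<le> ereal (ln c)" using c by (simp add: cdist_def)
    ultimately show ?thesis unfolding elog_b by blast
  qed
  have lnc: "0 \<le> ereal (ln c)" using c by simp
  have ELP: "E (L x) = x" if "x \<in> P" for x by (rule EL) (use P(1) that in blast)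
  show ?thesis
  proof (rule bottleneck_le_matching[where P = "L ` P" and h = "\<lambda>y. L (h (E y))"])
    show "finite (points (logdgm D1))" "finite (points (logdgm D2))"
      unfolding L_pts1 L_pts2 using fin by auto
    show "points (logdgm D1) \<inter> diagonal = {}" "points (logdgm D2) \<inter> diagonal = {}"
      by (rule disj, use pos1 in blast, rule disj, use pos2 in blast)
    show "L ` P \<subseteq> points (logdgm D1)" unfolding L_pts1 using P(1) by (rule image_mono)
    have im: "(\<lambda>y. L (h (E y))) ` L ` P = L ` h ` P" using ELP by (simp add: image_image)
    show "(\<lambda>y. L (h (E y))) ` L ` P \<subseteq> points (logdgm D2)"
      unfolding im L_pts2 using P(3) by (rule image_mono)
    show "inj_on (\<lambda>y. L (h (E y))) (L ` P)"
    proof (rule inj_onI)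
      fix y z assume "y \<in> L ` P" "z \<in> L ` P" and eq: "L (h (E y)) = L (h (E z))"
      then obtain y' z' where yz: "y = L y'" "z = L z'" "y' \<in> P" "z' \<in> P" by blast
      have mem: "h y' \<in> points D1 \<union> points D2" "h z' \<in> points D1 \<union> points D2" using P(3) yz by auto
      have "L (h y') = L (h z')" using eq unfolding yz(1,2) ELP[OF yz(3)] ELP[OF yz(4)] .
      then have "h y' = h z'" by (rule inj_onD[OF E_inj _ mem])
      then have "y' = z'" by (rule inj_onD[OF P(2) _ yz(3,4)])
      then show "y = z" using yz(1,2) by simp
    qed
    fix y assume "y \<in> L ` P"
    then obtain x where x: "x \<in> P" "y = L x" by blast
    have "h x \<in> points D2" using P(3) x(1) by blast
    then have "0 \<le> birth (h x) \<and> birth (h x) < death (h x)" using pts[of "h x"] by blast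
    then have hx: "0 \<le> birth (h x)" "0 \<le> death (h x)" by auto
    have "pcost (fst (L x)) (fst (L (h x))) \<le> ereal (ln c)"
      using cost x(1) hx c by (intro pcost_le lnc) (auto simp: L_def intro!: cdist_elog)
    then show "pcost (fst y) (fst (L (h (E y)))) \<le> ereal (ln c)" using ELP x by simp
  next
    fix y assume y: "y \<in> points (logdgm D1) - L ` P"
    then obtain x where x: "x \<in> points D1" "y = L x" unfolding L_pts1 by blast
    then have "x \<in> points D1 - P" using y by blast
    then have "death x \<le> ereal c * birth x" by (rule left1[rule_format])
    then obtain t where "cdist (elog (birth x)) (ereal t) \<le> ereal (ln c)" "cdist (elog (death x)) (ereal t) \<le> ereal (ln c)"
      using diag[of x] x(1) by blast
    then have "pcost (fst y) (ereal t, ereal t) \<le> ereal (ln c)"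
      unfolding x(2) by (intro pcost_le lnc) (auto simp: L_def)
    then show "\<exists>t. pcost (fst y) (ereal t, ereal t) \<le> ereal (ln c)" by blast
  next
    fix y assume y: "y \<in> points (logdgm D2) - (\<lambda>y. L (h (E y))) ` L ` P"
    then obtain x where x: "x \<in> points D2" "y = L x" unfolding L_pts2 by blast
    have "x \<notin> h ` P"
    proof
      assume "x \<in> h ` P"
      then obtain p where p: "p \<in> P" "x = h p" by blast
      then have "y = L (h (E (L p)))" using x(2) ELP[OF p(1)] by simp
      then have "y \<in> (\<lambda>y. L (h (E y))) ` L ` P" using imageI[OF p(1), of L] by (rule image_eqI)
      then show False using y by simp
    qed
    then have "x \<in> points D2 - h ` P" using x(1) by simp
    then have "death x \<le> ereal c * birth x" by (rule left2[rule_format])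
    then obtain t where "cdist (elog (birth x)) (ereal t) \<le> ereal (ln c)" "cdist (elog (death x)) (ereal t) \<le> ereal (ln c)"
      using diag[of x] x(1) by blast
    then have "pcost (ereal t, ereal t) (fst y) \<le> ereal (ln c)"
      unfolding x(2) by (intro pcost_le lnc) (auto simp: L_def cdist_sym)
    then show "\<exists>t. pcost (ereal t, ereal t) (fst y) \<le> ereal (ln c)" by blast
  qed (rule lnc)
qed

section \<open>Homology as a quotient of cycles\<close>

lemma cycles_iff: "c \<in> cycles K n \<longleftrightarrow> c \<in> chains K n \<and> bd c = 0"
  by (simp add: cycles_def zero_fun_def)

lemma subspace_cycles: "fv.subspace (cycles K n :: ('a list \<Rightarrow> 'b::field) set)"
  unfolding fv.subspace_def
proof (intro conjI ballI allI)
  show "0 \<in> cycles K n" unfolding cycles_iff using chains_0 bd_0 by blast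
next
  fix x y :: "'a list \<Rightarrow> 'b" assume "x \<in> cycles K n" "y \<in> cycles K n"
  then have xy: "x \<in> chains K n" "y \<in> chains K n" "bd x = 0" "bd y = 0" by (auto simp only: cycles_iff)
  have "bd (x + y) = 0" using bd_add[OF chains_finite[OF xy(1)] chains_finite[OF xy(2)]] xy(3,4) by simp
  then show "x + y \<in> cycles K n" unfolding cycles_iff using chains_add[OF xy(1,2)] by blast
next
  fix a and x :: "'a list \<Rightarrow> 'b" assume "x \<in> cycles K n"
  then have x: "x \<in> chains K n" "bd x = 0" by (auto simp only: cycles_iff)
  have "bd (fun_scale a x) = fun_scale a (bd x)"
    unfolding fun_scale_def by (rule bd_scale[OF chains_finite[OF x(1)]])
  then have "bd (fun_scale a x) = 0" using x(2) by simp
  then show "fun_scale a x \<in> cycles K n"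
    unfolding cycles_iff using chains_scale[OF x(1), of a] unfolding fun_scale_def by blast
qed

lemma subspace_bnds: "fv.subspace (bnds K n :: ('a list \<Rightarrow> 'b::field) set)"
  unfolding fv.subspace_def
proof (intro conjI ballI allI)
  show "0 \<in> bnds K n" unfolding bnds_def by (rule image_eqI[of _ bd 0]) (simp_all only: bd_0 chains_0)
next
  fix x y :: "'a list \<Rightarrow> 'b" assume "x \<in> bnds K n" "y \<in> bnds K n"
  then obtain u v where uv: "u \<in> chains K (Suc n)" "v \<in> chains K (Suc n)" "x = bd u" "y = bd v"
    unfolding bnds_def by blast
  have "x + y = bd (u + v)" using uv by (simp only: bd_add chains_finite)
  then show "x + y \<in> bnds K n" unfolding bnds_def using chains_add[OF uv(1,2)] by (rule image_eqI)
next
  fix a and x :: "'a list \<Rightarrow> 'b" assume "x \<in> bnds K n"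
  then obtain u where u: "u \<in> chains K (Suc n)" "x = bd u" unfolding bnds_def by blast
  have "fun_scale a x = bd (\<lambda>y. a * u y)"
    unfolding fun_scale_def u(2) by (rule bd_scale[symmetric, OF chains_finite[OF u(1)]])
  then show "fun_scale a x \<in> bnds K n" unfolding bnds_def using chains_scale[OF u(1)] by (rule image_eqI)
qed

lemma bnds_mono:
  "(chains K (Suc n) :: ('a list \<Rightarrow> 'k::field) set) \<subseteq> chains L (Suc n) \<Longrightarrow>
    (bnds K n :: ('a list \<Rightarrow> 'k) set) \<subseteq> bnds L n"
  unfolding bnds_def by (rule image_mono)

lemma cycles_mono:
  "(chains K n :: ('a list \<Rightarrow> 'k::field) set) \<subseteq> chains L n \<Longrightarrow>
    (cycles K n :: ('a list \<Rightarrow> 'k) set) \<subseteq> cycles L n"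
  unfolding cycles_def by blast

lemma fin_gen_chains:
  fixes K :: "'a set set"
  assumes "finite (\<Union>K)"
  shows "fv.fin_gen (chains K n :: ('a list \<Rightarrow> 'k::field) set)"
proof -
  let ?L = "{xs. set xs \<subseteq> \<Union>K \<and> length xs = Suc n}"
  have L: "finite ?L" by (rule finite_lists_length_eq[OF assms])
  have "chains K n \<subseteq> fv.span (single ` ?L :: ('a list \<Rightarrow> 'k) set)"
  proof
    fix c :: "'a list \<Rightarrow> 'k" assume c: "c \<in> chains K n"
    have "c ys = 0" if "ys \<notin> ?L" for ys
      using c that unfolding chains_iff by blast
    then have "c ys = (\<Sum>xs\<in>?L. fun_scale (c xs) (single xs)) ys" for ys
      unfolding sum_fun_apply fun_scale_def single_def using L
      by (simp add: if_distrib[of "(*) _"] sum.delta' cong: if_cong)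
    then have "c = (\<Sum>xs\<in>?L. fun_scale (c xs) (single xs))" by (rule ext)
    also have "\<dots> \<in> fv.span (single ` ?L)"
      by (intro fv.span_sum fv.span_scale fv.span_base imageI)
    finally show "c \<in> fv.span (single ` ?L)" .
  qed
  then show ?thesis unfolding fv.fin_gen_def using L by (intro exI[of _ "single ` ?L"] conjI finite_imageI)
qed

lemma hcos_coset: "hcos K n z = coset (bnds K n) z"
  by (simp add: hcos_def coset_def plus_fun_def)

lemma hom_coset: "hom K n = coset (bnds K n) ` cycles K n"
  by (simp add: hom_def hcos_coset[abs_def])

lemma hincl_coset:
  fixes z :: "'a list \<Rightarrow> 'k::field"
  assumes "(bnds K n :: ('a list \<Rightarrow> 'k) set) \<subseteq> bnds L n"
  shows "hincl L n (coset (bnds K n) z) = coset (bnds L n) z"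
proof (intro equalityI subsetI)
  fix f assume "f \<in> hincl L n (coset (bnds K n) z)"
  then obtain a b where ab: "f = a + b" "a \<in> coset (bnds K n) z" "b \<in> bnds L n"
    unfolding hincl_def plus_fun_def by blast
  have "a - z \<in> bnds L n" using ab(2) assms unfolding coset_iff by blast
  from fv.subspace_add[OF subspace_bnds this ab(3)]
  show "f \<in> coset (bnds L n) z" unfolding coset_iff ab(1) by (simp add: algebra_simps)
next
  fix f assume f: "f \<in> coset (bnds L n) z"
  have "z \<in> coset (bnds K n) z" unfolding coset_iff using fv.subspace_0[OF subspace_bnds] by simp
  moreover have "f - z \<in> bnds L n" using f unfolding coset_iff .
  moreover have "f = (\<lambda>ys. z ys + (f - z) ys)" by (rule ext) simp
  ultimately show "f \<in> hincl L n (coset (bnds K n) z)" unfolding hincl_def by blast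
qed

lemma hadd_coset:
  assumes B: "fv.subspace B"
  shows "hadd (coset B y) (coset B z) = coset B (y + z)"
proof (intro equalityI subsetI)
  fix f assume "f \<in> hadd (coset B y) (coset B z)"
  then obtain a b where ab: "f = a + b" "a - y \<in> B" "b - z \<in> B"
    unfolding hadd_def plus_fun_def coset_iff by blast
  from fv.subspace_add[OF B ab(2,3)]
  show "f \<in> coset B (y + z)" unfolding coset_iff ab(1) by (simp add: algebra_simps)
next
  fix f assume f: "f \<in> coset B (y + z)"
  have "y \<in> coset B y" unfolding coset_iff using fv.subspace_0[OF B] by simp
  moreover have "f - y \<in> coset B z" using f unfolding coset_iff by (simp add: algebra_simps)
  moreover have "f = (\<lambda>ys. y ys + (f - y) ys)" by (rule ext) simp
  ultimately show "f \<in> hadd (coset B y) (coset B z)" unfolding hadd_def by blast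
qed

lemma hsmul_coset: "hsmul K n c (coset (bnds K n) z) = coset (bnds K n) (fun_scale c z)"
proof (intro equalityI subsetI)
  fix f assume "f \<in> hsmul K n c (coset (bnds K n) z)"
  then obtain a b where ab: "f = fun_scale c a + b" "a - z \<in> bnds K n" "b \<in> bnds K n"
    unfolding hsmul_def plus_fun_def coset_iff fun_scale_def by blast
  from fv.subspace_add[OF subspace_bnds fv.subspace_scale[OF subspace_bnds ab(2), of c] ab(3)]
  show "f \<in> coset (bnds K n) (fun_scale c z)"
    unfolding coset_iff ab(1) by (simp add: fv.scale_right_diff_distrib algebra_simps)
next
  fix f assume f: "f \<in> coset (bnds K n) (fun_scale c z)"
  have "z \<in> coset (bnds K n) z" unfolding coset_iff using fv.subspace_0[OF subspace_bnds] by simp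
  moreover have "f - fun_scale c z \<in> bnds K n" using f unfolding coset_iff .
  moreover have "f = (\<lambda>ys. c * z ys + (f - fun_scale c z) ys)" by (rule ext) (simp add: fun_scale_def)
  ultimately show "f \<in> hsmul K n c (coset (bnds K n) z)" unfolding hsmul_def by blast
qed

text \<open>Surjectivity on homology of the inclusion of \<open>L\<close>: a cycle is a relative
  cycle, its boundary being zero.\<close>

lemma deforms_cycle:
  fixes ty :: "'k::field itself" and z :: "'a list \<Rightarrow> 'k"
  assumes "deforms ty K L" and K: "simp_complex K" and z: "z \<in> cycles K n"
  obtains w where "w \<in> cycles L n" "z - w \<in> bnds K n"
proof -
  have zc: "z \<in> chains K n" "bd z = 0" using z by (auto simp: cycles_iff)
  have "n = 0 \<or> bd z \<in> chains L (n - 1)" unfolding zc(2) using chains_0 by blast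
  then obtain u where u: "u \<in> chains K (Suc n)" "z - bd u \<in> chains L n"
    using assms(1) zc(1) unfolding deforms_def by blast
  have fin: "finite (supp (bd u))" using bd_in_chains[OF K u(1)] by (rule chains_finite)
  have "bd (z - bd u) = 0"
    using bd_diff[OF chains_finite[OF zc(1)] fin] bd_bd[OF K u(1)] zc(2) by simp
  then have "z - bd u \<in> cycles L n" using u(2) by (simp only: cycles_iff simp_thms)
  moreover have "z - (z - bd u) \<in> bnds K n" unfolding bnds_def using u(1) by simp
  ultimately show thesis by (rule that)
qed

text \<open>Injectivity on homology: a filling of \<open>z\<close> in \<open>K\<close> is a relative
  cycle one degree higher, since its boundary \<open>z\<close> lies in \<open>L\<close>; its
  deformation into \<open>L\<close> has the same boundary.\<close>

lemma deforms_boundary: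
  fixes ty :: "'k::field itself" and z :: "'a list \<Rightarrow> 'k"
  assumes "deforms ty K L" and K: "simp_complex K" and z: "z \<in> chains L n" "z \<in> bnds K n"
  shows "z \<in> bnds L n"
proof -
  obtain u where u: "u \<in> chains K (Suc n)" "z = bd u" using z(2) unfolding bnds_def by blast
  have "Suc n = 0 \<or> bd u \<in> chains L (Suc n - 1)" using z(1) u(2) by simp
  then obtain v where v: "v \<in> chains K (Suc (Suc n))" "u - bd v \<in> chains L (Suc n)"
    using assms(1) u(1) unfolding deforms_def by blast
  have fin: "finite (supp (bd v))" using bd_in_chains[OF K v(1)] by (rule chains_finite)
  have "bd (u - bd v) = z"
    using bd_diff[OF chains_finite[OF u(1)] fin] bd_bd[OF K v(1)] u(2) by simp
  then show ?thesis unfolding bnds_def using v(2) by (intro image_eqI) auto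
qed

section \<open>Rank functions of pairs of filtrations\<close>

text \<open>The rank is the dimension of \<open>Z s\<close> modulo \<open>B t\<close>. Leaving
  \<open>Z\<close> and \<open>B\<close> independent of each other covers the image module, whose
  cycles and boundaries come from different filtrations.\<close>

lemma rank_function_dim:
  fixes Z B :: "real \<Rightarrow> ('b \<Rightarrow> 'k::field) set"
  assumes T: "finite T" "\<And>x. x \<in> T \<Longrightarrow> 0 \<le> x"
    and Z: "\<And>s. fv.subspace (Z s)" "\<And>s. fv.fin_gen (Z s)" "\<And>s t. s \<le> t \<Longrightarrow> Z s \<subseteq> Z t" "steps T Z" "\<And>s. s < 0 \<Longrightarrow> Z s = {0}"
    and B: "\<And>s. fv.subspace (B s)" "\<And>s t. s \<le> t \<Longrightarrow> B s \<subseteq> B t" "steps T B"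
  shows "rank_function T (\<lambda>s t. int (fv.dim (Z s)) - int (fv.dim (Z s \<inter> B t)))"
proof
  show "finite T" "\<And>x. x \<in> T \<Longrightarrow> 0 \<le> x" by (fact T)+
  show "steps T (\<lambda>s. int (fv.dim (Z s)) - int (fv.dim (Z s \<inter> B t)))" for t
    using Z(4) unfolding steps_def by simp
  show "steps T (\<lambda>t. int (fv.dim (Z s)) - int (fv.dim (Z s \<inter> B t)))" for s
    using B(3) unfolding steps_def by simp
next
  fix b' b t :: real assume "b' \<le> b" "b \<le> t"
  then have sub: "Z b' \<subseteq> Z b" using Z(3) by simp
  have eq: "Z b \<inter> (Z b \<inter> B t) = Z b \<inter> B t" "Z b' \<inter> (Z b \<inter> B t) = Z b' \<inter> B t" "Z b' \<inter> Z b = Z b'" using sub by auto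
  \<comment> \<open>Supermodularity for \<open>Z b \<inter> B t\<close> inside \<open>Z b\<close>:
    intersecting with the larger one gives back the full cycle spaces.\<close>
  have "fv.dim (Z b \<inter> (Z b \<inter> B t)) + fv.dim (Z b' \<inter> Z b) \<le> fv.dim (Z b \<inter> Z b) + fv.dim (Z b' \<inter> (Z b \<inter> B t))"
    by (rule fv.dim_supermodular[OF Z(1) Z(1) fv.subspace_inter[OF Z(1) B(1)] Z(1) Z(2) sub Int_lower1])
  then show "int (fv.dim (Z b')) - int (fv.dim (Z b' \<inter> B t)) \<le> int (fv.dim (Z b)) - int (fv.dim (Z b \<inter> B t))"
    unfolding eq by simp
next
  fix b' b d' d :: real assume "b' \<le> b" "b \<le> d'" "d' \<le> d"
  then have "fv.dim (Z b \<inter> B d') + fv.dim (Z b' \<inter> B d) \<le> fv.dim (Z b \<inter> B d) + fv.dim (Z b' \<inter> B d')"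
    by (intro fv.dim_supermodular Z B) auto
  then show "int (fv.dim (Z b')) - int (fv.dim (Z b' \<inter> B d')) - (int (fv.dim (Z b')) - int (fv.dim (Z b' \<inter> B d)))
     \<le> int (fv.dim (Z b)) - int (fv.dim (Z b \<inter> B d')) - (int (fv.dim (Z b)) - int (fv.dim (Z b \<inter> B d)))"
    by simp
next
  fix s t :: real assume "s < 0"
  then have "Z s = {0}" by (rule Z(5))
  moreover have "{0} \<inter> B t = {0}" using fv.subspace_0[OF B(1)] by auto
  ultimately show "int (fv.dim (Z s)) - int (fv.dim (Z s \<inter> B t)) = 0" by simp
qed

section \<open>Diagrams computed from ranks of homology\<close>

lemma evvalI:
  assumes "eventually (\<lambda>x. f x = m) Fl" "Fl \<noteq> bot"
  shows "evval Fl f = m"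
  unfolding evval_def
proof (rule the_equality)
  show "eventually (\<lambda>x. f x = m) Fl" by (rule assms(1))
next
  fix m' assume "eventually (\<lambda>x. f x = m') Fl"
  with assms(1) have "eventually (\<lambda>x. m = m') Fl" by eventually_elim simp
  then show "m' = m" using assms(2) by (simp add: eventually_const)
qed

context rank_function
begin

lemma birth_left_const:
  assumes "prv T b \<le> u" "u < b"
  shows "r u t = r (prv T b) t"
proof -
  have "r (prv T b) t = r u t"
  proof (rule stepsD[OF steps_birth assms(1)])
    fix z assume z: "z \<in> T" "prv T b < z" "z \<le> u"
    then show False using le_prv[OF finite_T z(1), of b] assms(2) by simp
  qed
  then show ?thesis by simp
qed

lemma death_left_const:
  assumes "prv T d \<le> u" "u < d"
  shows "r s u = r s (prv T d)"
proof -
  have "r s (prv T d) = r s u"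
  proof (rule stepsD[OF steps_death assms(1)])
    fix z assume z: "z \<in> T" "prv T d < z" "z \<le> u"
    then show False using le_prv[OF finite_T z(1), of d] assms(2) by simp
  qed
  then show ?thesis by simp
qed

text \<open>For small \<open>e\<close> the arguments \<open>b - e\<close> and \<open>d - e\<close>
  lie where the rank has its left limits, so the eventual values in \<open>pmult\<close> are the
  values at \<open>prv\<close>.\<close>

lemma dgm_eq_rank_dgm:
  assumes rk: "\<And>s t. s \<le> t \<Longrightarrow> int (rk ty F n s t) = r s t"
  shows "dgm ty F n p = rank_dgm T r p"
proof (cases "\<exists>b. fst p = ereal b \<and> ereal b < snd p")
  case True
  then obtain b where b: "fst p = ereal b" "ereal b < snd p" by blast
  have small: "eventually (\<lambda>e::real. 0 < e \<and> e < m) (at_right 0)" if "0 < m" for m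
    using eventually_at_right_real[OF that] by (rule eventually_mono) auto
  have pb: "0 < b - prv T b" using prv(1)[OF finite_T, of b] by simp
  have "pmult ty F n b (snd p) = rank_mult T r b (snd p)"
  proof (cases "snd p")
    case (real d)
    \<comment> \<open>The bound \<open>d - b\<close> keeps \<open>b\<close> below
      \<open>d - e\<close>, since \<open>rk\<close> is identified with \<open>r\<close> only for
      ordered arguments.\<close>
    define m where "m = min (b - prv T b) (min (d - prv T d) (d - b))"
    have "0 < m" using pb b real prv(1)[OF finite_T, of d] by (simp add: m_def)
    have "eventually (\<lambda>e. (let d' = real_of_ereal (ereal d) in
          int (rk ty F n b (d' - e)) - int (rk ty F n (b - e) (d' - e))
          - int (rk ty F n b d') + int (rk ty F n (b - e) d')) = rank_mult T r b (ereal d)) (at_right 0)"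
      using small[OF \<open>0 < m\<close>]
    proof eventually_elim
      case (elim e)
      then have e: "0 < e" "e < b - prv T b" "e < d - prv T d" "e < d - b" by (auto simp: m_def)
      have 1: "int (rk ty F n b (d - e)) = r b (prv T d)"
        using rk[of b "d - e"] death_left_const[of d "d - e" b] e by simp
      have 2: "int (rk ty F n (b - e) (d - e)) = r (prv T b) (prv T d)"
        using rk[of "b - e" "d - e"] death_left_const[of d "d - e"] birth_left_const[of b "b - e"] e by simp
      have 3: "int (rk ty F n b d) = r b d" using rk[of b d] e by simp
      have 4: "int (rk ty F n (b - e) d) = r (prv T b) d"
        using rk[of "b - e" d] birth_left_const[of b "b - e"] e by simp
      show ?case
        by (simp add: 1 2 3 4 Let_def rank_mult_def death_jump_def)
    qed
    then have "evval (at_right (0::real)) (\<lambda>e. let d' = real_of_ereal (ereal d) in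
          int (rk ty F n b (d' - e)) - int (rk ty F n (b - e) (d' - e))
          - int (rk ty F n b d') + int (rk ty F n (b - e) d')) = rank_mult T r b (ereal d)"
      by (rule evvalI) simp
    then show ?thesis unfolding pmult_def real by simp
  next
    case PInf
    let ?t = "max b (Max (insert 0 T))"
    have inner: "evval at_top (\<lambda>t::real. int (rk ty F n b t) - int (rk ty F n (b - e) t)) = r b ?t - r (b - e) ?t"
      if "0 < e" for e
    proof (rule evvalI)
      show "eventually (\<lambda>t::real. int (rk ty F n b t) - int (rk ty F n (b - e) t) = r b ?t - r (b - e) ?t) at_top"
        using eventually_ge_at_top[of ?t]
      proof eventually_elim
        case (elim t)
        have "r s t = r s ?t" for s
          using top_const[of t s] top_const[of ?t s] elim by simp
        then show ?case using rk[of b t] rk[of "b - e" t] elim that by simp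
      qed
    qed simp
    have "eventually (\<lambda>e. evval at_top (\<lambda>t::real. int (rk ty F n b t) - int (rk ty F n (b - e) t)) = rank_mult T r b \<infinity>) (at_right 0)"
      using small[OF pb]
    proof eventually_elim
      case (elim e)
      have "r (b - e) ?t = r (prv T b) ?t" using elim by (intro birth_left_const) auto
      moreover have "death_jump T r \<infinity> s = r s ?t" for s by (rule death_jump_infinity) simp
      ultimately show ?case using inner[of e] elim by (simp add: rank_mult_def)
    qed
    then have "evval (at_right (0::real)) (\<lambda>e. evval at_top (\<lambda>t::real. int (rk ty F n b t) - int (rk ty F n (b - e) t))) = rank_mult T r b \<infinity>"
      by (rule evvalI) simp
    then show ?thesis unfolding pmult_def PInf by simp
  qed (use b in auto)
  then show ?thesis using b by (simp add: dgm_def rank_dgm_def)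
next
  case False
  then show ?thesis by (simp only: dgm_def rank_dgm_def if_False)
qed

end

text \<open>The image of the homology of \<open>F s\<close> consists of the cosets, modulo
  boundaries of \<open>F t\<close>, of cycles of \<open>F s\<close>; \<open>qdim_coset\<close> gives
  its dimension.\<close>

lemma rk_eq_dim:
  fixes F :: "real \<Rightarrow> 'a set set" and ty :: "'k::field itself"
  assumes fin: "\<And>s. finite (\<Union>(F s))" and cplx: "simp_complex (F t)" and sub: "F s \<subseteq> F t"
  shows "int (rk ty F n s t) = int (fv.dim (cycles (F s) n :: ('a list \<Rightarrow> 'k) set))
     - int (fv.dim (cycles (F s) n \<inter> bnds (F t) n :: ('a list \<Rightarrow> 'k) set))"
proof -
  let ?Z = "cycles (F s) n :: ('a list \<Rightarrow> 'k) set" and ?B = "bnds (F t) n :: ('a list \<Rightarrow> 'k) set"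
  have BB: "bnds (F s) n \<subseteq> ?B" by (intro bnds_mono chains_mono sub)
  have "?Z \<subseteq> chains (F s) n" by (auto simp: cycles_iff)
  then have fZ: "fv.fin_gen ?Z" by (rule fv.fin_gen_subset[OF fin_gen_chains[OF fin]])
  have "?B \<subseteq> chains (F t) n" unfolding bnds_def using bd_in_chains[OF cplx] by blast
  then have fB: "fv.fin_gen ?B" by (rule fv.fin_gen_subset[OF fin_gen_chains[OF fin]])
  have "hincl (F t) n ` (hom (F s) n :: ('a list \<Rightarrow> 'k) set set) = coset ?B ` ?Z"
    unfolding hom_coset image_image hincl_coset[OF BB] ..
  then have "rk ty F n s t = qdim ?B (coset ?B ` ?Z)" unfolding rk_def by simp
  then show ?thesis
    using qdim_coset[OF subspace_cycles fZ subspace_bnds fB] by simp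
qed

section \<open>Rips and Delaunay-Rips filtrations\<close>

lemma simp_complex_rips:
  assumes "finite X"
  shows "simp_complex (rips X r)"
  unfolding simp_complex_def
proof (intro conjI ballI allI impI)
  show "{} \<notin> rips X r" by (simp add: rips_def)
  fix \<sigma> \<tau> assume \<sigma>: "\<sigma> \<in> rips X r" and \<tau>: "\<tau> \<subseteq> \<sigma> \<and> \<tau> \<noteq> {}"
  then have "\<sigma> \<subseteq> X" by (simp add: rips_def)
  then have "finite \<sigma>" using assms by (rule finite_subset)
  then have "diameter \<tau> \<le> diameter \<sigma>" using \<tau> by (intro diameter_subset finite_imp_bounded) auto
  then show "\<tau> \<in> rips X r" using \<sigma> \<tau> by (auto simp: rips_def)
qed

lemma delrips_eq: "delrips X r = rips X r \<inter> delaunay X"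
  by (auto simp: delrips_def rips_def delaunay_def)

lemma rips_mono: "r \<le> s \<Longrightarrow> rips X r \<subseteq> rips X s"
  by (auto simp: rips_def)

lemma cech_mono: "r \<le> s \<Longrightarrow> cech X r \<subseteq> cech X s"
  unfolding cech_def enclosing_ball_def by (blast intro: order_trans)

text \<open>The scales at which Rips simplices can enter: the diameter of a finite simplex is
  attained by a pair of points.\<close>

definition half_dists :: "'a::euclidean_space set \<Rightarrow> real set" where
  "half_dists X = (\<lambda>(x, y). dist x y / 2) ` (X \<times> X)"

lemma steps_rips:
  assumes "finite X"
  shows "steps (half_dists X) (rips X)"
  unfolding steps_def
proof (intro allI impI antisym)
  fix r s :: real assume rs: "r \<le> s" "half_dists X \<inter> {r<..s} = {}"
  show "rips X r \<subseteq> rips X s" using rs(1) by (rule rips_mono)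
  show "rips X s \<subseteq> rips X r"
  proof
    fix \<sigma> assume "\<sigma> \<in> rips X s"
    then have \<sigma>: "\<sigma> \<subseteq> X" "\<sigma> \<noteq> {}" "diameter \<sigma> \<le> 2 * s" by (auto simp: rips_def)
    have "compact \<sigma>" using finite_subset[OF \<sigma>(1) assms] by (rule finite_imp_compact)
    then obtain x y where xy: "x \<in> \<sigma>" "y \<in> \<sigma>" "dist x y = diameter \<sigma>"
      using diameter_compact_attained \<sigma>(2) by blast
    have "diameter \<sigma> / 2 \<in> half_dists X"
      unfolding half_dists_def xy(3)[symmetric] using xy(1,2) \<sigma>(1) by (intro image_eqI[of _ _ "(x, y)"]) auto
    then have "diameter \<sigma> / 2 \<notin> {r<..s}" using rs(2) by blast
    then show "\<sigma> \<in> rips X r" using \<sigma> by (auto simp: rips_def)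
  qed
qed

lemma rips_negative:
  assumes "finite X" "r < 0"
  shows "rips X r = {}"
proof -
  have "\<not> diameter \<sigma> \<le> 2 * r" if "\<sigma> \<subseteq> X" for \<sigma>
    using diameter_ge_0[OF finite_imp_bounded[OF finite_subset[OF that assms(1)]]] assms(2) by linarith
  then show ?thesis by (auto simp: rips_def)
qed

lemma cycles_empty: "(cycles {} n :: ('a list \<Rightarrow> 'k::field) set) = {0}"
proof (intro equalityI subsetI)
  fix c :: "'a list \<Rightarrow> 'k" assume "c \<in> cycles {} n"
  then have "c \<in> chains {} n" unfolding cycles_iff by (rule conjunct1)
  then have "c xs = 0" for xs unfolding chains_iff by blast
  then have "c = 0" by (simp add: fun_eq_iff)
  then show "c \<in> {0}" by simp
next
  fix c :: "'a list \<Rightarrow> 'k" assume "c \<in> {0}"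
  then show "c \<in> cycles {} n" using fv.subspace_0[OF subspace_cycles] by simp
qed

text \<open>The lists in these chains have at most \<open>k + 2\<close> distinct entries, so Jung's
  bound applies. Degree \<open>m = k\<close> serves cycles, \<open>m = k + 1\<close> their
  fillings.\<close>

lemma chains_rips_subset_cech:
  assumes "finite X" "m \<le> Suc k"
  shows "chains (rips X r) m \<subseteq> chains (cech X (cconst (k + 1) * r)) m"
proof
  fix c :: "'a list \<Rightarrow> 'b" assume c: "c \<in> chains (rips X r) m"
  have "set xs \<in> cech X (cconst (k + 1) * r)" if "c xs \<noteq> 0" for xs
  proof (rule rips_skeleton_subset_cech[OF assms(1)])
    have xs: "length xs = Suc m" "set xs \<in> rips X r" using c that unfolding chains_iff by blast+
    show "set xs \<in> rips X r" by (rule xs(2))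
    show "card (set xs) \<le> Suc (k + 1)" using card_length[of xs] xs(1) assms(2) by simp
  qed
  then show "c \<in> chains (cech X (cconst (k + 1) * r)) m"
    using c unfolding chains_iff by blast
qed

lemma cconst_ge_1: "1 \<le> cconst (k + 1)"
  by (simp add: cconst_def field_simps)

lemma rips_cycle_to_delaunay:
  fixes X :: "'a::euclidean_space set" and z :: "'a list \<Rightarrow> 'k::field"
  assumes "finite X" "z \<in> cycles (rips X r) k"
  obtains w where "w \<in> cycles (cech X (cconst (k + 1) * r) \<inter> delaunay X) k"
    "z - w \<in> bnds (cech X (cconst (k + 1) * r)) k"
proof -
  have "z \<in> cycles (cech X (cconst (k + 1) * r)) k"
    using cycles_mono[OF chains_rips_subset_cech[OF assms(1), of k k r]] assms(2) by auto
  then show thesis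
    using deforms_cycle[OF deforms_cech_delaunay[OF assms(1), where ty = "TYPE('k)"] simp_complex_cech] that
    by metis
qed

lemma cech_delaunay_boundary:
  fixes X :: "'a::euclidean_space set" and z :: "'a list \<Rightarrow> 'k::field"
  assumes "finite X" "z \<in> cycles (cech X s \<inter> delaunay X) k" "z \<in> bnds (cech X s) k"
  shows "z \<in> bnds (cech X s \<inter> delaunay X) k"
  using assms(2) deforms_boundary[OF deforms_cech_delaunay[OF assms(1), where ty = "TYPE('k)"] simp_complex_cech _ assms(3)]
  unfolding cycles_iff by blast

lemma bnds_rips_subset_cech:
  "finite X \<Longrightarrow> (bnds (rips X r) k :: ('a::euclidean_space list \<Rightarrow> 'k::field) set) \<subseteq> bnds (cech X (cconst (k + 1) * r)) k"
  by (intro bnds_mono chains_rips_subset_cech) simp_all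

lemma cech_delaunay_subset_delrips: "cech X s \<inter> delaunay X \<subseteq> delrips X s"
  using cech_subset_rips[of X s] by (auto simp: delrips_eq)

text \<open>\<open>\<Psi>\<close> is induced by inclusion. \<open>\<Phi>\<close> passes to the Cech
  complex at scale \<open>\<eta> * r\<close>, inverts the isomorphism from its Delaunay part, and
  includes that part into Delaunay-Rips.\<close>

lemma interleaving:
  fixes X :: "'a::euclidean_space set" and ty :: "'k::field itself"
  assumes X: "finite X"
  shows "mult_strong_interleaved ty (rips X) (delrips X) k (cconst (k + 1))"
proof -
  define \<eta> where "\<eta> = cconst (k + 1)"
  have \<eta>: "1 \<le> \<eta>" unfolding \<eta>_def by (rule cconst_ge_1)
  have scale: "r \<le> \<eta> * r" if "0 \<le> r" for r using mult_right_mono[OF \<eta> that] by simp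
  let ?Z = "\<lambda>K. cycles K k :: ('a list \<Rightarrow> 'k) set" and ?B = "\<lambda>K. bnds K k :: ('a list \<Rightarrow> 'k) set"
  let ?R = "rips X" and ?D = "delrips X" and ?C = "cech X" and ?CD = "\<lambda>s. cech X s \<inter> delaunay X"
  have Zmono: "?Z K \<subseteq> ?Z L" and Bmono: "?B K \<subseteq> ?B L" if "K \<subseteq> L" for K L
    by (rule cycles_mono[OF chains_mono[OF that]], rule bnds_mono[OF chains_mono[OF that]])
  have RR: "?R r \<subseteq> ?R s" and DD: "?D r \<subseteq> ?D s" if "r \<le> s" for r s
    using rips_mono[OF that] by (auto simp: delrips_eq)
  have CC: "?C r \<subseteq> ?C s" and CDCD: "?CD r \<subseteq> ?CD s" if "r \<le> s" for r s
    using cech_mono[OF that] by auto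
  have DR: "?D r \<subseteq> ?R r" for r by (auto simp: delrips_eq)
  have CDD: "?CD s \<subseteq> ?D s" for s by (rule cech_delaunay_subset_delrips)
  have CR: "?C s \<subseteq> ?R s" for s by (rule cech_subset_rips)
  have BRC: "?B (?R r) \<subseteq> ?B (?C (\<eta> * r))" for r
    unfolding \<eta>_def by (rule bnds_rips_subset_cech[OF X])
  \<comment> \<open>These cycles already lie in the Delaunay part of the Cech complex at the larger
    scale, so for them \<open>\<Phi>\<close> may choose \<open>w = z\<close>; this gives the
    identity for \<open>\<Phi>\<close> after \<open>\<Psi>\<close>.\<close>
  have ZDC: "?Z (?D r) \<subseteq> ?Z (?CD (\<eta> * r))" for r
  proof
    fix z assume z: "z \<in> ?Z (?D r)"
    then have "z \<in> chains (?R r) k" using chains_mono[OF DR] unfolding cycles_iff by blast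
    then have "z \<in> chains (?C (\<eta> * r)) k"
      using chains_rips_subset_cech[OF X, of k k r] unfolding \<eta>_def by auto
    then have "z \<in> chains (?CD (\<eta> * r)) k"
      using z unfolding cycles_iff chains_iff delrips_eq by blast
    then show "z \<in> ?Z (?CD (\<eta> * r))" using z unfolding cycles_iff by blast
  qed
  \<comment> \<open>The union over all admissible choices avoids selecting representatives; that it
    is a single coset is proved in the fact \<open>\<Phi>\<close>.\<close>
  define \<Phi> where "\<Phi> r A = {w + b | w b. w \<in> ?Z (?CD (\<eta> * r)) \<and> b \<in> ?B (?D (\<eta> * r))
      \<and> (\<exists>z\<in>A. z - w \<in> ?B (?C (\<eta> * r)))}" for r and A :: "('a list \<Rightarrow> 'k) set"
  define \<Psi> where "\<Psi> r A = hincl (?R (\<eta> * r)) k A" for r and A :: "('a list \<Rightarrow> 'k) set"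
  have \<Phi>: "\<Phi> r (coset (?B (?R r)) z) = coset (?B (?D (\<eta> * r))) w"
    if w: "w \<in> ?Z (?CD (\<eta> * r))" and zw: "z - w \<in> ?B (?C (\<eta> * r))" for r z w
  proof (intro equalityI subsetI)
    fix f assume "f \<in> \<Phi> r (coset (?B (?R r)) z)"
    then obtain w' b z' where f: "f = w' + b" "w' \<in> ?Z (?CD (\<eta> * r))" "b \<in> ?B (?D (\<eta> * r))"
      "z' \<in> coset (?B (?R r)) z" "z' - w' \<in> ?B (?C (\<eta> * r))" unfolding \<Phi>_def by blast
    have "z' - z \<in> ?B (?C (\<eta> * r))" using f(4) BRC unfolding coset_iff by blast
    from fv.subspace_diff[OF subspace_bnds fv.subspace_add[OF subspace_bnds this zw] f(5)]
    have "w' - w \<in> ?B (?C (\<eta> * r))" by (simp add: algebra_simps)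
    moreover have "w' - w \<in> ?Z (?CD (\<eta> * r))" by (rule fv.subspace_diff[OF subspace_cycles f(2) w])
    \<comment> \<open>Two choices differ by a cycle of the Delaunay part that bounds in the Cech
      complex, hence bounds in the Delaunay part.\<close>
    ultimately have "w' - w \<in> ?B (?CD (\<eta> * r))" by (intro cech_delaunay_boundary[OF X])
    then have "w' - w \<in> ?B (?D (\<eta> * r))" using Bmono[OF CDD] by blast
    from fv.subspace_add[OF subspace_bnds this f(3)]
    show "f \<in> coset (?B (?D (\<eta> * r))) w" unfolding coset_iff f(1) by (simp add: algebra_simps)
  next
    fix f assume f: "f \<in> coset (?B (?D (\<eta> * r))) w"
    have "z \<in> coset (?B (?R r)) z" unfolding coset_iff using fv.subspace_0[OF subspace_bnds] by simp
    moreover have "f = w + (f - w)" by simp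
    moreover have "f - w \<in> ?B (?D (\<eta> * r))" using f unfolding coset_iff .
    ultimately show "f \<in> \<Phi> r (coset (?B (?R r)) z)"
      unfolding \<Phi>_def using w zw by blast
  qed
  have lift: "\<exists>w\<in>?Z (?CD (\<eta> * r)). z - w \<in> ?B (?C (\<eta> * r))" if z: "z \<in> ?Z (?R r)" for r z
    using rips_cycle_to_delaunay[OF X z] unfolding \<eta>_def by metis
  have \<Psi>: "\<Psi> r (coset (?B (?D r)) z) = coset (?B (?R (\<eta> * r))) z" if "0 \<le> r" for r z
    unfolding \<Psi>_def by (intro hincl_coset Bmono order_trans[OF DR RR] scale that)
  have homE: "\<exists>z\<in>?Z K. A = coset (?B K) z" if "A \<in> hom K k" for K A
    using that unfolding hom_coset by blast
  have homI: "coset (?B K) z \<in> hom K k" if "z \<in> ?Z K" for K z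
    using that unfolding hom_coset by blast
  have lin\<Phi>: "hlinear (?R r) (?D (\<eta> * r)) k (\<Phi> r)" for r
    unfolding hlinear_def
  proof (intro conjI ballI allI)
    fix A :: "('a list \<Rightarrow> 'k) set" assume "A \<in> hom (?R r) k"
    then obtain z where z: "z \<in> ?Z (?R r)" "A = coset (?B (?R r)) z" using homE by blast
    obtain w where w: "w \<in> ?Z (?CD (\<eta> * r))" "z - w \<in> ?B (?C (\<eta> * r))" using lift[OF z(1)] by blast
    have wD: "w \<in> ?Z (?D (\<eta> * r))" using w(1) Zmono[OF CDD] by blast
    show "\<Phi> r A \<in> hom (?D (\<eta> * r)) k" unfolding z(2) \<Phi>[OF w] by (rule homI[OF wD])
    {
      fix c
      have cw: "fun_scale c w \<in> ?Z (?CD (\<eta> * r))" by (rule fv.subspace_scale[OF subspace_cycles w(1)])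
      have "fun_scale c (z - w) \<in> ?B (?C (\<eta> * r))" by (rule fv.subspace_scale[OF subspace_bnds w(2)])
      then have czw: "fun_scale c z - fun_scale c w \<in> ?B (?C (\<eta> * r))"
        by (simp only: fv.scale_right_diff_distrib)
      show "\<Phi> r (hsmul (?R r) k c A) = hsmul (?D (\<eta> * r)) k c (\<Phi> r A)"
        unfolding z(2) hsmul_coset \<Phi>[OF w] \<Phi>[OF cw czw] ..
    }
    fix A' :: "('a list \<Rightarrow> 'k) set" assume "A' \<in> hom (?R r) k"
    then obtain z' where z': "z' \<in> ?Z (?R r)" "A' = coset (?B (?R r)) z'" using homE by blast
    obtain w' where w': "w' \<in> ?Z (?CD (\<eta> * r))" "z' - w' \<in> ?B (?C (\<eta> * r))" using lift[OF z'(1)] by blast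
    have ww: "w + w' \<in> ?Z (?CD (\<eta> * r))" by (rule fv.subspace_add[OF subspace_cycles w(1) w'(1)])
    have "(z - w) + (z' - w') \<in> ?B (?C (\<eta> * r))" by (rule fv.subspace_add[OF subspace_bnds w(2) w'(2)])
    then have zzww: "(z + z') - (w + w') \<in> ?B (?C (\<eta> * r))" by (simp add: algebra_simps)
    show "\<Phi> r (hadd A A') = hadd (\<Phi> r A) (\<Phi> r A')"
      unfolding z(2) z'(2) hadd_coset[OF subspace_bnds] \<Phi>[OF w] \<Phi>[OF w'] \<Phi>[OF ww zzww] ..
  qed
  have lin\<Psi>: "hlinear (?D r) (?R (\<eta> * r)) k (\<Psi> r)" if r: "0 \<le> r" for r
    unfolding hlinear_def
  proof (intro conjI ballI allI)
    fix A :: "('a list \<Rightarrow> 'k) set" assume "A \<in> hom (?D r) k"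
    then obtain z where z: "z \<in> ?Z (?D r)" "A = coset (?B (?D r)) z" using homE by blast
    have "z \<in> ?Z (?R (\<eta> * r))" using z(1) Zmono[OF order_trans[OF DR RR[OF scale[OF r]]]] by blast
    then show "\<Psi> r A \<in> hom (?R (\<eta> * r)) k" unfolding z(2) \<Psi>[OF r] by (rule homI)
    show "\<Psi> r (hsmul (?D r) k c A) = hsmul (?R (\<eta> * r)) k c (\<Psi> r A)" for c
      unfolding z(2) hsmul_coset \<Psi>[OF r] ..
    fix A' :: "('a list \<Rightarrow> 'k) set" assume "A' \<in> hom (?D r) k"
    then obtain z' where z': "z' \<in> ?Z (?D r)" "A' = coset (?B (?D r)) z'" using homE by blast
    show "\<Psi> r (hadd A A') = hadd (\<Psi> r A) (\<Psi> r A')"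
      unfolding z(2) z'(2) hadd_coset[OF subspace_bnds] \<Psi>[OF r] ..
  qed
  have \<Psi>\<Phi>: "\<Psi> (\<eta> * r) (\<Phi> r A) = hincl (?R (\<eta> * \<eta> * r)) k A" if r: "0 \<le> r" and A: "A \<in> hom (?R r) k" for r A
  proof -
    have \<eta>r: "0 \<le> \<eta> * r" using r \<eta> by simp
    obtain z where z: "z \<in> ?Z (?R r)" "A = coset (?B (?R r)) z" using homE[OF A] by blast
    obtain w where w: "w \<in> ?Z (?CD (\<eta> * r))" "z - w \<in> ?B (?C (\<eta> * r))" using lift[OF z(1)] by blast
    have "r \<le> \<eta> * (\<eta> * r)" using scale[OF r] scale[OF \<eta>r] by simp
    then have incl: "hincl (?R (\<eta> * (\<eta> * r))) k A = coset (?B (?R (\<eta> * (\<eta> * r)))) z"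
      unfolding z(2) by (intro hincl_coset Bmono RR)
    have "z - w \<in> ?B (?R (\<eta> * (\<eta> * r)))"
      using w(2) Bmono[OF order_trans[OF CR RR[OF scale[OF \<eta>r]]]] by blast
    then have "coset (?B (?R (\<eta> * (\<eta> * r)))) z = coset (?B (?R (\<eta> * (\<eta> * r)))) w"
      by (simp only: coset_eq_iff[OF subspace_bnds])
    then show ?thesis
      unfolding mult.assoc incl unfolding z(2) \<Phi>[OF w] \<Psi>[OF \<eta>r] by (rule sym)
  qed
  have \<Phi>\<Psi>: "\<Phi> (\<eta> * r) (\<Psi> r A) = hincl (?D (\<eta> * \<eta> * r)) k A" if r: "0 \<le> r" and A: "A \<in> hom (?D r) k" for r A
  proof -
    have \<eta>r: "0 \<le> \<eta> * r" using r \<eta> by simp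
    obtain z where z: "z \<in> ?Z (?D r)" "A = coset (?B (?D r)) z" using homE[OF A] by blast
    have zC: "z \<in> ?Z (?CD (\<eta> * (\<eta> * r)))"
      using z(1) ZDC Zmono[OF CDCD[OF scale[OF \<eta>r]]] by blast
    have z0: "z - z \<in> ?B (?C (\<eta> * (\<eta> * r)))" using fv.subspace_0[OF subspace_bnds] by simp
    have "r \<le> \<eta> * (\<eta> * r)" using scale[OF r] scale[OF \<eta>r] by simp
    then have incl: "hincl (?D (\<eta> * (\<eta> * r))) k A = coset (?B (?D (\<eta> * (\<eta> * r)))) z"
      unfolding z(2) by (intro hincl_coset Bmono DD)
    show ?thesis
      unfolding mult.assoc incl unfolding z(2) \<Psi>[OF r] \<Phi>[OF zC z0] ..
  qed
  have nat\<Phi>: "\<Phi> s (hincl (?R s) k A) = hincl (?D (\<eta> * s)) k (\<Phi> r A)"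
    if r: "0 \<le> r" "r \<le> s" and A: "A \<in> hom (?R r) k" for r s A
  proof -
    obtain z where z: "z \<in> ?Z (?R r)" "A = coset (?B (?R r)) z" using homE[OF A] by blast
    obtain w where w: "w \<in> ?Z (?CD (\<eta> * r))" "z - w \<in> ?B (?C (\<eta> * r))" using lift[OF z(1)] by blast
    have le: "\<eta> * r \<le> \<eta> * s" using r \<eta> by (intro mult_left_mono) auto
    have w2: "w \<in> ?Z (?CD (\<eta> * s))" "z - w \<in> ?B (?C (\<eta> * s))"
      using w Zmono[OF CDCD[OF le]] Bmono[OF CC[OF le]] by blast+
    show ?thesis
      unfolding z(2) \<Phi>[OF w] hincl_coset[OF Bmono[OF RR[OF r(2)]]] hincl_coset[OF Bmono[OF DD[OF le]]] \<Phi>[OF w2] ..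
  qed
  have nat\<Psi>: "\<Psi> s (hincl (?D s) k A) = hincl (?R (\<eta> * s)) k (\<Psi> r A)"
    if r: "0 \<le> r" "r \<le> s" and A: "A \<in> hom (?D r) k" for r s A
  proof -
    obtain z where z: "z \<in> ?Z (?D r)" "A = coset (?B (?D r)) z" using homE[OF A] by blast
    have le: "\<eta> * r \<le> \<eta> * s" using r \<eta> by (intro mult_left_mono) auto
    have s: "0 \<le> s" using r by simp
    show ?thesis
      unfolding z(2) \<Psi>[OF r(1)] hincl_coset[OF Bmono[OF DD[OF r(2)]]] hincl_coset[OF Bmono[OF RR[OF le]]] \<Psi>[OF s] ..
  qed
  show ?thesis
    unfolding mult_strong_interleaved_def \<eta>_def[symmetric]
    by (rule conjI[OF \<eta>], rule exI[of _ \<Phi>], rule exI[of _ \<Psi>])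
      (intro conjI allI impI ballI; (elim conjE)?; (rule lin\<Phi> lin\<Psi> \<Psi>\<Phi> \<Phi>\<Psi> nat\<Phi> nat\<Psi>; assumption))
qed

lemma bottleneck_bound:
  fixes X :: "'a::euclidean_space set" and ty :: "'k::field itself"
  assumes X: "finite X"
  shows "bottleneck (logdgm (dgm ty (delrips X) k)) (logdgm (dgm ty (rips X) k)) \<le> ereal (ln (cconst (k + 1)))"
proof -
  define c where "c = cconst (k + 1)"
  have c: "1 \<le> c" unfolding c_def by (rule cconst_ge_1)
  have scale: "t \<le> c * t" if "0 \<le> t" for t using mult_right_mono[OF c that] by simp
  define T where "T = half_dists X"
  have T: "finite T" "\<And>x. x \<in> T \<Longrightarrow> 0 \<le> x" using X by (auto simp: T_def half_dists_def)
  define ZD ZR BD BR where "ZD s = (cycles (delrips X s) k :: ('a list \<Rightarrow> 'k) set)"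
    and "ZR s = (cycles (rips X s) k :: ('a list \<Rightarrow> 'k) set)"
    and "BD s = (bnds (delrips X s) k :: ('a list \<Rightarrow> 'k) set)"
    and "BR s = (bnds (rips X s) k :: ('a list \<Rightarrow> 'k) set)" for s
  have stR: "steps T (rips X)" unfolding T_def by (rule steps_rips[OF X])
  then have stD: "steps T (delrips X)" unfolding steps_def delrips_eq by simp
  have steps: "steps T ZD" "steps T ZR" "steps T BD" "steps T BR"
    using stR stD unfolding steps_def ZD_def ZR_def BD_def BR_def by simp_all
  have sub: "fv.subspace (ZD s)" "fv.subspace (ZR s)" "fv.subspace (BD s)" "fv.subspace (BR s)" for s
    unfolding ZD_def ZR_def BD_def BR_def by (rule subspace_cycles subspace_bnds)+
  have DD: "delrips X s \<subseteq> delrips X t" and RR: "rips X s \<subseteq> rips X t" if "s \<le> t" for s t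
    using rips_mono[OF that] by (auto simp: delrips_eq)
  have DR: "delrips X s \<subseteq> rips X s" for s by (auto simp: delrips_eq)
  have mono: "ZD s \<subseteq> ZD t" "ZR s \<subseteq> ZR t" "BD s \<subseteq> BD t" "BR s \<subseteq> BR t" if "s \<le> t" for s t
    unfolding ZD_def ZR_def BD_def BR_def
    using cycles_mono[OF chains_mono[OF DD[OF that]]] cycles_mono[OF chains_mono[OF RR[OF that]]]
      bnds_mono[OF chains_mono[OF DD[OF that]]] bnds_mono[OF chains_mono[OF RR[OF that]]] by blast+
  have ZDR: "ZD s \<subseteq> ZR s" and BDR: "BD s \<subseteq> BR s" for s
    unfolding ZD_def ZR_def BD_def BR_def
    using cycles_mono[OF chains_mono[OF DR]] bnds_mono[OF chains_mono[OF DR]] by blast+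
  have cR: "simp_complex (rips X s)" for s by (rule simp_complex_rips[OF X])
  have cD: "simp_complex (delrips X s)" for s
    unfolding delrips_eq by (intro simp_complex_Int cR simp_complex_delaunay)
  have finR: "finite (\<Union>(rips X s))" for s
    by (rule finite_subset[OF _ X]) (auto simp: rips_def)
  have finD: "finite (\<Union>(delrips X s))" for s
    by (rule finite_subset[OF _ finR[of s]]) (use DR[of s] in blast)
  have fgZ: "fv.fin_gen (ZR s)" for s
    unfolding ZR_def by (rule fv.fin_gen_subset[OF fin_gen_chains[OF finR]]) (auto simp: cycles_iff)
  have fgZD: "fv.fin_gen (ZD s)" for s by (rule fv.fin_gen_subset[OF fgZ ZDR])
  have "BR s \<subseteq> chains (rips X s) k" for s
    unfolding BR_def bnds_def using bd_in_chains[OF cR] by blast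
  then have fgB: "fv.fin_gen (BR s)" for s by (rule fv.fin_gen_subset[OF fin_gen_chains[OF finR]])
  have neg: "ZD s = {0}" "ZR s = {0}" if "s < 0" for s
    unfolding ZD_def ZR_def delrips_eq rips_negative[OF X that] by (simp_all add: cycles_empty)
  \<comment> \<open>\<open>rI\<close> combines Delaunay-Rips cycles with Rips boundaries: for
    \<open>s \<le> t\<close> it is the rank of the map from Delaunay-Rips homology at
    \<open>s\<close> to Rips homology at \<open>t\<close>.\<close>
  define rM rI rN where "rM s t = int (fv.dim (ZD s)) - int (fv.dim (ZD s \<inter> BD t))"
    and "rI s t = int (fv.dim (ZD s)) - int (fv.dim (ZD s \<inter> BR t))"
    and "rN s t = int (fv.dim (ZR s)) - int (fv.dim (ZR s \<inter> BR t))" for s t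
  have rfM: "rank_function T rM" and rfI: "rank_function T rI" and rfN: "rank_function T rN"
    unfolding rM_def[abs_def] rI_def[abs_def] rN_def[abs_def]
    by (intro rank_function_dim T sub fgZ fgZD mono steps neg; assumption)+
  interpret M: rank_function T rM by (rule rfM)
  interpret N: rank_function T rN by (rule rfN)
  \<comment> \<open>A Rips filling at scale \<open>t\<close> lies in the Cech complex at
    \<open>c * t\<close>, and the cycle lies in its Delaunay part; injectivity of the deformation
    provides a Delaunay filling.\<close>
  have kernel: "ZD b \<inter> BR t \<subseteq> BD (c * t)" if bt: "b \<le> t" for b t
  proof
    fix z assume z: "z \<in> ZD b \<inter> BR t"
    then have zC: "z \<in> bnds (cech X (c * t)) k"
      using bnds_rips_subset_cech[OF X, of t k] unfolding BR_def c_def by auto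
    have zt: "z \<in> ZD t" using z mono(1)[OF bt] by blast
    then have "z \<in> chains (rips X t) k" using chains_mono[OF DR] unfolding ZD_def cycles_iff by blast
    then have "z \<in> chains (cech X (c * t)) k"
      using chains_rips_subset_cech[OF X, of k k t] unfolding c_def by auto
    then have "z \<in> chains (cech X (c * t) \<inter> delaunay X) k"
      using zt unfolding ZD_def cycles_iff chains_iff delrips_eq by blast
    then have "z \<in> cycles (cech X (c * t) \<inter> delaunay X) k" using zt unfolding ZD_def cycles_iff by blast
    then have "z \<in> bnds (cech X (c * t) \<inter> delaunay X) k" using zC by (rule cech_delaunay_boundary[OF X])
    then show "z \<in> BD (c * t)"
      unfolding BD_def using bnds_mono[OF chains_mono[OF cech_delaunay_subset_delrips]] by blast
  qed
  \<comment> \<open>A Rips cycle is homologous in the Cech complex at \<open>c * s\<close> to a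
    Delaunay cycle; the difference is then a Rips boundary at every
    \<open>t \<ge> c * s\<close>.\<close>
  have cokernel: "ZR s \<subseteq> fv.span (ZD (c * s) \<union> BR t)" if st: "c * s \<le> t" for s t
  proof
    fix z assume "z \<in> ZR s"
    then obtain w where w: "w \<in> cycles (cech X (c * s) \<inter> delaunay X) k" "z - w \<in> bnds (cech X (c * s)) k"
      unfolding ZR_def c_def by (rule rips_cycle_to_delaunay[OF X])
    have "w \<in> ZD (c * s)"
      unfolding ZD_def using w(1) cycles_mono[OF chains_mono[OF cech_delaunay_subset_delrips]] by blast
    then have "w \<in> fv.span (ZD (c * s) \<union> BR t)" by (intro fv.span_base) simp
    moreover have "z - w \<in> BR (c * s)"
      unfolding BR_def using w(2) bnds_mono[OF chains_mono[OF cech_subset_rips]] by blast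
    then have "z - w \<in> BR t" using mono(4)[OF st] by blast
    then have "z - w \<in> fv.span (ZD (c * s) \<union> BR t)" by (intro fv.span_base) simp
    ultimately show "z \<in> fv.span (ZD (c * s) \<union> BR t)" by (rule span_from_diff[rotated])
  qed
  obtain P h where P: "P \<subseteq> points (rank_dgm T rM)" "inj_on h P" "h ` P \<subseteq> points (rank_dgm T rN)"
    "\<forall>x\<in>P. birth (h x) \<le> birth x \<and> birth x \<le> ereal c * birth (h x) \<and>
       death (h x) \<le> death x \<and> death x \<le> ereal c * death (h x)"
    "\<forall>x\<in>points (rank_dgm T rM) - P. death x \<le> ereal c * birth x"
    "\<forall>x\<in>points (rank_dgm T rN) - h ` P. death x \<le> ereal c * birth x"
  proof (rule rank_matching[OF rfM rfI rfN c])
    fix b' b t :: real assume b: "b' \<le> b"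
    have "fv.dim (ZD b \<inter> BD t) + fv.dim (ZD b' \<inter> BR t) \<le> fv.dim (ZD b \<inter> BR t) + fv.dim (ZD b' \<inter> BD t)"
      by (rule fv.dim_supermodular[OF sub(1) sub(1) sub(3) sub(4) fgZD mono(1)[OF b] BDR])
    then show "rI b t - rI b' t \<le> rM b t - rM b' t" by (simp add: rI_def rM_def)
    assume t: "b \<le> t"
    have eq: "ZD b \<inter> (ZD b \<inter> BR t) = ZD b \<inter> BR t" "ZD b' \<inter> (ZD b \<inter> BR t) = ZD b' \<inter> BR t"
      using mono(1)[OF b] by auto
    \<comment> \<open>\<open>kernel\<close> reverses the comparison of boundaries: within
      \<open>ZD b\<close>, those of Rips at \<open>t\<close> are contained in those of Delaunay-Rips
      at \<open>c * t\<close>.\<close>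
    have "fv.dim (ZD b \<inter> (ZD b \<inter> BR t)) + fv.dim (ZD b' \<inter> BD (c * t))
        \<le> fv.dim (ZD b \<inter> BD (c * t)) + fv.dim (ZD b' \<inter> (ZD b \<inter> BR t))"
      by (rule fv.dim_supermodular[OF sub(1) sub(1) fv.subspace_inter[OF sub(1) sub(4)] sub(3) fgZD mono(1)[OF b] kernel[OF t]])
    then show "rM b (c * t) - rM b' (c * t) \<le> rI b t - rI b' t"
      unfolding eq by (simp add: rI_def rM_def)
  next
    fix s d' d :: real assume d: "d' \<le> d"
    have "fv.dim (ZR s \<inter> BR d') + fv.dim (ZD s \<inter> BR d) \<le> fv.dim (ZR s \<inter> BR d) + fv.dim (ZD s \<inter> BR d')"
      by (rule fv.dim_supermodular[OF sub(1) sub(2) sub(4) sub(4) fgZ ZDR mono(4)[OF d]])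
    then show "rI s d' - rI s d \<le> rN s d' - rN s d" by (simp add: rI_def rN_def)
    assume s: "c * s \<le> d'"
    have "fv.dim (ZR s \<inter> BR d) + fv.dim (ZD (c * s) \<inter> BR d') \<le> fv.dim (ZD (c * s) \<inter> BR d) + fv.dim (ZR s \<inter> BR d')"
      by (rule fv.dim_cokernel_bound[OF sub(2) sub(1) sub(4) sub(4) fgZ fgZD fgB mono(4)[OF d] cokernel[OF s]])
    then show "rN s d' - rN s d \<le> rI (c * s) d' - rI (c * s) d" by (simp add: rI_def rN_def)
  next
    fix s t :: real
    have eq: "ZR s \<inter> (ZR s \<inter> BR t) = ZR s \<inter> BR t" "ZD s \<inter> (ZR s \<inter> BR t) = ZD s \<inter> BR t" "ZD s \<inter> ZR s = ZD s"
      using ZDR[of s] by auto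
    have "fv.dim (ZR s \<inter> (ZR s \<inter> BR t)) + fv.dim (ZD s \<inter> ZR s) \<le> fv.dim (ZR s \<inter> ZR s) + fv.dim (ZD s \<inter> (ZR s \<inter> BR t))"
      by (rule fv.dim_supermodular[OF sub(1) sub(2) fv.subspace_inter[OF sub(2) sub(4)] sub(2) fgZ ZDR Int_lower1])
    then show "rI s t \<le> rN s t" unfolding eq by (simp add: rI_def rN_def)
    assume st: "c * s \<le> t"
    \<comment> \<open>With \<open>UNIV\<close> as the larger space the intersections are the full
      cycle spaces; this is the case of bars that never die.\<close>
    have "fv.dim (ZR s \<inter> UNIV) + fv.dim (ZD (c * s) \<inter> BR t) \<le> fv.dim (ZD (c * s) \<inter> UNIV) + fv.dim (ZR s \<inter> BR t)"
      by (rule fv.dim_cokernel_bound[OF sub(2) sub(1) fv.subspace_UNIV sub(4) fgZ fgZD fgB subset_UNIV cokernel[OF st]])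
    then show "rN s t \<le> rI (c * s) t" by (simp add: rI_def rN_def)
  qed
  have dgmM: "dgm ty (delrips X) k = rank_dgm T rM"
  proof
    fix p show "dgm ty (delrips X) k p = rank_dgm T rM p"
      by (rule M.dgm_eq_rank_dgm)
        (simp only: rk_eq_dim[OF finD cD DD] rM_def ZD_def BD_def)
  qed
  have dgmN: "dgm ty (rips X) k = rank_dgm T rN"
  proof
    fix p show "dgm ty (rips X) k p = rank_dgm T rN p"
      by (rule N.dgm_eq_rank_dgm)
        (simp only: rk_eq_dim[OF finR cR RR] rN_def ZR_def BR_def)
  qed
  have posM: "0 \<le> fst p \<and> fst p < snd p \<and> fst p \<noteq> \<infinity>" if p: "0 < rank_dgm T rM p" for p
    using M.D_support[OF p] by (metis PInfty_neq_ereal(1) ereal_less_eq(5))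
  have posN: "0 \<le> fst p \<and> fst p < snd p \<and> fst p \<noteq> \<infinity>" if p: "0 < rank_dgm T rN p" for p
    using N.D_support[OF p] by (metis PInfty_neq_ereal(1) ereal_less_eq(5))
  show ?thesis
    unfolding dgmM dgmN c_def[symmetric]
    by (rule bottleneck_log_le[OF posM posN M.finite_points N.finite_points c P])
qed

theorem theorem1:
  fixes X :: "'a::euclidean_space set" and k :: nat and ty :: "'k::field itself"
  assumes "finite X" and "general_position X"
  shows "mult_strong_interleaved ty (rips X) (delrips X) k (cconst (k + 1)) \<and>
         bottleneck (logdgm (dgm ty (delrips X) k)) (logdgm (dgm ty (rips X) k))
           \<le> ereal (ln (cconst (k + 1)))"
  using interleaving[OF assms(1)] bottleneck_bound[OF assms(1)] by blast

end
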